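(* Assume the Strong Exponential Time Hypothesis (SETH). Then there is no $\varepsilon > 0$ such that \textsc{Dominating Set}, restricted to inputs consisting of a planar graph $G$ together with a linear layout of $G$ of cutwidth $k$ (and the integer $t$), can be solved in time $\mathcal{O}^*((3-\varepsilon)^k)$.
   Context: All graphs are finite, simple and undirected. A set $S\subseteq V(G)$ is a dominating set if every vertex of $G$ is in $S$ or has a neighbor in $S$. \textsc{Dominating Set}: given a graph $G$ and an integer $t$, decide whether $G$ has a dominating set of size $t$. A graph is planar if it has a drawing in the plane in which the curves representing edges intersect only at common endpoints. For an $n$-vertex graph $G$, a linear layout is a bijection $\pi\colon V(G)\to[n]$; its cutwidth is $\mathrm{ctw}_\pi(G)=\max_{1\le i<n}|\{\{u,v\}\in E(G): \pi(u)\le i<\pi(v)\}|$. The notation $\mathcal{O}^*(f(k))$ means $\mathcal{O}(f(k)\cdot N^{\mathcal{O}(1)})$ where $N$ is the input size. SETH: for every $\varepsilon>0$ there is a constant $q$ such that $q$-SAT (satisfiability of CNF formulas with clauses of size at most $q$) on $n$ variables cannot be solved in time $\mathcal{O}^*((2-\varepsilon)^n)$. *)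

theory Defs
  imports "HOL-Analysis.Analysis" "HOL-Library.Log_Nat"
begin

section \<open>Machine model\<close>

text \<open>
  Running times refer to a deterministic random access machine with the logarithmic cost
  criterion. Programs are structured, and memory is split into arrays indexed by natural
  numbers; a program text mentions only finitely many of them (a scalar is a cell with a
  constant index). Since every \<open>rexp\<close> node is charged the binary length of its value,
  this agrees with the usual log-cost RAM (and with the word RAM) up to factors
  polylogarithmic in the running time, which \<open>O_star\<close> bounds do not see.
\<close>

datatype rexp =
    Const nat
  | Get nat rexp
  | Add rexp rexp
  | Sub rexp rexp
  | Mul rexp rexp
  | Div rexp rexp

datatype com =
    Put nat rexp rexp
  | Seq com com
  | Cond rexp com com
  | While rexp com

type_synonym memory = "nat \<Rightarrow> nat \<Rightarrow> nat"

fun rval :: "rexp \<Rightarrow> memory \<Rightarrow> nat" where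
  "rval (Const n) s = n"
| "rval (Get a e) s = s a (rval e s)"
| "rval (Add e f) s = rval e s + rval f s"
| "rval (Sub e f) s = rval e s - rval f s"
| "rval (Mul e f) s = rval e s * rval f s"
| "rval (Div e f) s = rval e s div rval f s"

definition log_cost :: "nat \<Rightarrow> nat" where
  "log_cost x = Suc (floorlog 2 x)"

fun rcost :: "rexp \<Rightarrow> memory \<Rightarrow> nat" where
  "rcost (Const n) s = log_cost n"
| "rcost (Get a e) s = rcost e s + log_cost (rval (Get a e) s)"
| "rcost (Add e f) s = rcost e s + rcost f s + log_cost (rval (Add e f) s)"
| "rcost (Sub e f) s = rcost e s + rcost f s + log_cost (rval (Sub e f) s)"
| "rcost (Mul e f) s = rcost e s + rcost f s + log_cost (rval (Mul e f) s)"
| "rcost (Div e f) s = rcost e s + rcost f s + log_cost (rval (Div e f) s)"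

text \<open>
  \<open>exec c s T s'\<close>: started in memory \<open>s\<close>, program \<open>c\<close> halts in memory \<open>s'\<close> after
  time \<open>T\<close>. \<open>Put a e f\<close> is the assignment \<open>a[e] := f\<close>; a test succeeds
  iff its value is nonzero.
\<close>

inductive exec :: "com \<Rightarrow> memory \<Rightarrow> nat \<Rightarrow> memory \<Rightarrow> bool" where
  Put: "exec (Put a e f) s (Suc (rcost e s + rcost f s))
          (s(a := (s a)(rval e s := rval f s)))"
| Seq: "exec c s T s' \<Longrightarrow> exec d s' U s'' \<Longrightarrow> exec (Seq c d) s (T + U) s''"
| CondTrue: "rval e s \<noteq> 0 \<Longrightarrow> exec c s T s' \<Longrightarrow>
    exec (Cond e c d) s (Suc (rcost e s + T)) s'"
| CondFalse: "rval e s = 0 \<Longrightarrow> exec d s T s' \<Longrightarrow>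
    exec (Cond e c d) s (Suc (rcost e s + T)) s'"
| WhileTrue: "rval e s \<noteq> 0 \<Longrightarrow> exec c s T s' \<Longrightarrow> exec (While e c) s' U s'' \<Longrightarrow>
    exec (While e c) s (Suc (rcost e s + T + U)) s''"
| WhileFalse: "rval e s = 0 \<Longrightarrow> exec (While e c) s (Suc (rcost e s)) s"

text \<open>
  The input occupies the first cells of array 0, all other cells being 0; the length of the
  input is not supplied, so encodings have to be self-delimiting. The answer is read off
  cell 0 of array 0.
\<close>

definition input_memory :: "nat list \<Rightarrow> memory" where
  "input_memory xs = (\<lambda>a i. if a = 0 \<and> i < length xs then xs ! i else 0)"

definition decides_within :: "com \<Rightarrow> nat list \<Rightarrow> bool \<Rightarrow> real \<Rightarrow> bool" where
  "decides_within c xs ans B \<longleftrightarrow>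
     (\<exists>T s. exec c (input_memory xs) T s \<and> (s 0 0 \<noteq> 0 \<longleftrightarrow> ans) \<and> real T \<le> B)"

definition input_size :: "nat list \<Rightarrow> nat" where
  "input_size xs = (\<Sum>x\<leftarrow>xs. log_cost x)"

text \<open>
  The decision problem \<open>yes\<close>, restricted to the instances in \<open>I\<close> and parameterized by
  \<open>par\<close>, is solvable in time \<open>O\<^sup>*(f(k))\<close>. Nothing is required of the algorithm on words
  that do not encode an instance in \<open>I\<close>.
\<close>

definition solvable_O_star ::
  "'i set \<Rightarrow> ('i \<Rightarrow> nat list) \<Rightarrow> ('i \<Rightarrow> bool) \<Rightarrow> ('i \<Rightarrow> nat) \<Rightarrow> (nat \<Rightarrow> real) \<Rightarrow> bool" where
  "solvable_O_star I enc yes par f \<longleftrightarrow>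
     (\<exists>c. \<exists>C::real. \<exists>d::nat. \<forall>x\<in>I.
        decides_within c (enc x) (yes x) (C * f (par x) * real (input_size (enc x)) ^ d))"


section \<open>Satisfiability and SETH\<close>

text \<open>A literal is a variable together with the truth value satisfying it.\<close>

type_synonym literal = "nat \<times> bool"
type_synonym cnf = "literal list list"

definition cnf_vars :: "cnf \<Rightarrow> nat set" where
  "cnf_vars F = (\<Union>c\<in>set F. fst ` set c)"

definition satisfiable :: "cnf \<Rightarrow> bool" where
  "satisfiable F \<longleftrightarrow> (\<exists>\<alpha>::nat \<Rightarrow> bool. \<forall>c\<in>set F. \<exists>(v, b)\<in>set c. \<alpha> v = b)"

definition q_cnf :: "nat \<Rightarrow> cnf set" where
  "q_cnf q = {F. \<forall>c\<in>set F. length c \<le> q}"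

definition enc_cnf :: "cnf \<Rightarrow> nat list" where
  "enc_cnf F = length F #
     concat (map (\<lambda>c. length c # concat (map (\<lambda>(v, b). [v, of_bool b]) c)) F)"

definition SETH :: bool where
  "SETH \<longleftrightarrow> (\<forall>\<epsilon>>0. \<exists>q. \<not> solvable_O_star (q_cnf q) enc_cnf satisfiable
     (\<lambda>F. card (cnf_vars F)) (\<lambda>n. (2 - \<epsilon>) ^ n))"


section \<open>Graphs\<close>

definition simple_graph :: "'a set \<Rightarrow> 'a set set \<Rightarrow> bool" where
  "simple_graph V E \<longleftrightarrow> finite V \<and> (\<forall>e\<in>E. e \<subseteq> V \<and> card e = 2)"

definition dominating_set :: "'a set \<Rightarrow> 'a set set \<Rightarrow> 'a set \<Rightarrow> bool" where
  "dominating_set V E S \<longleftrightarrow> S \<subseteq> V \<and> (\<forall>v\<in>V. v \<in> S \<or> (\<exists>u\<in>S. {u, v} \<in> E))"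

text \<open>The drawing lives in the Euclidean plane, represented by the type \<^typ>\<open>complex\<close>.\<close>

definition planar :: "'a set \<Rightarrow> 'a set set \<Rightarrow> bool" where
  "planar V E \<longleftrightarrow>
     (\<exists>(p :: 'a \<Rightarrow> complex) (\<gamma> :: 'a set \<Rightarrow> real \<Rightarrow> complex).
        inj_on p V \<and>
        (\<forall>e\<in>E. arc (\<gamma> e) \<and> {pathstart (\<gamma> e), pathfinish (\<gamma> e)} = p ` e) \<and>
        (\<forall>e\<in>E. \<forall>v\<in>V. p v \<in> path_image (\<gamma> e) \<longrightarrow> v \<in> e) \<and>
        (\<forall>e\<in>E. \<forall>f\<in>E. e \<noteq> f \<longrightarrow>
           path_image (\<gamma> e) \<inter> path_image (\<gamma> f) \<subseteq> p ` (e \<inter> f)))"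

definition linear_layout :: "'a set \<Rightarrow> ('a \<Rightarrow> nat) \<Rightarrow> bool" where
  "linear_layout V \<pi> \<longleftrightarrow> bij_betw \<pi> V {1..card V}"

text \<open>Inserting 0 only matters for graphs with at most one vertex, where there is no cut.\<close>

definition cutwidth :: "'a set \<Rightarrow> 'a set set \<Rightarrow> ('a \<Rightarrow> nat) \<Rightarrow> nat" where
  "cutwidth V E \<pi> =
     Max (insert 0 ((\<lambda>i. card {e \<in> E. \<exists>u v. e = {u, v} \<and> \<pi> u \<le> i \<and> i < \<pi> v}) ` {1..<card V}))"


section \<open>Planar dominating set with a given layout\<close>

text \<open>
  An instance \<open>(n, E, \<pi>, t)\<close> consists of a graph with vertex set \<open>{..<n}\<close> and edge set
  \<open>E\<close>, a linear layout \<open>\<pi>\<close> and the target size \<open>t\<close>. It is encoded by \<open>n\<close>, the adjacency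
  matrix, the values of \<open>\<pi>\<close>, and \<open>t\<close>.
\<close>

type_synonym ds_instance = "nat \<times> nat set set \<times> (nat \<Rightarrow> nat) \<times> nat"

definition planar_ds_instances :: "ds_instance set" where
  "planar_ds_instances =
     {(n, E, \<pi>, t). simple_graph {..<n} E \<and> planar {..<n} E \<and> linear_layout {..<n} \<pi>}"

fun enc_ds :: "ds_instance \<Rightarrow> nat list" where
  "enc_ds (n, E, \<pi>, t) =
     n # concat (map (\<lambda>u. map (\<lambda>v. of_bool ({u, v} \<in> E)) [0..<n]) [0..<n])
       @ map \<pi> [0..<n] @ [t]"

fun has_dominating_set :: "ds_instance \<Rightarrow> bool" where
  "has_dominating_set (n, E, \<pi>, t) \<longleftrightarrow> (\<exists>S. dominating_set {..<n} E S \<and> card S = t)"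

fun ds_cutwidth :: "ds_instance \<Rightarrow> nat" where
  "ds_cutwidth (n, E, \<pi>, t) = cutwidth {..<n} E \<pi>"

end

theory Submission
  imports Defs
begin

text \<open>
  The reduction. Groups of \<open>b\<close> variables are encoded by \<open>p\<close> ternary digits with
  \<open>2 ^ b \<le> 3 ^ p < 2 ^ (b + 1)\<close>, and each digit is carried by one row, which behaves like a path
  of which every third vertex is chosen: every cut between two columns meets a row in a single edge,
  and the three states of that edge (left end chosen, none chosen, right end chosen) are the three
  digits. A column consists of tiles, one in each row, through which a signal runs from top to
  bottom; it starts undone, must be done at the bottom, and may become done only at a row whose
  digit differs from a prescribed one. So a column forbids one combination of values of the
  groups occurring in a clause, and the columns for all falsifying combinations express the clause.
  The tiles are planar graphs with 16 vertices and four ports, and every set that dominates the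
  inner vertices of a tile has at least 4 elements. If all tiles attain 4, the states along a row
  can only increase, hence they are constant on one of sufficiently many copies of the clauses.
  Going through the tiles column by column gives a layout of cutwidth \<open>p n / b + O(1)\<close> for \<open>n\<close>
  variables. Since \<open>3 ^ p\<close> and \<open>2 ^ b\<close> differ by a factor of at most 2, for large \<open>p\<close> an algorithm
  with running time \<open>(3 - \<epsilon>) ^ k\<close> would decide satisfiability in time \<open>(2 - \<delta>) ^ n\<close>.
\<close>

section \<open>Executing programs\<close>

text \<open>Planarity does not let a row cross wires that lead to a clause gadget, so the check of a
  clause is itself a signal that travels through the rows; a tile has to pass both on at the same
  price, whatever the state of its row. The target \<open>4 * cells\<close> is exactly the lower
  bound, so a single tile with five chosen vertices already exceeds it, and the only freedom left is
  an increase of a row state.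

  SETH and the claim speak about concrete programs, so the map itself has to be executed in
  polynomial time. The parameters \<open>p\<close>, \<open>b\<close> and the clause width
  \<open>q\<close> depend on \<epsilon> alone, hence the number \<open>(3 ^ p) ^ q\<close> of
  columns per clause and copy is a constant. Variable names may be exponentially large and are
  replaced by their ranks.

  Values between \<open>2 ^ b\<close> and \<open>3 ^ p\<close>, which encode no further assignment,
  do no harm because only the low \<open>b\<close> bits of a value are read. The factor below 2 lost
  per group is paid by taking \<open>p\<close> with \<open>(3 / a) ^ p > 2\<close>, where
  \<open>a\<close> is the base of the assumed running time, raised to at least 1.\<close>

fun rexp_arrays :: "rexp \<Rightarrow> nat set" where
  "rexp_arrays (Const n) = {}"
| "rexp_arrays (Get a e) = insert a (rexp_arrays e)"
| "rexp_arrays (Add e f) = rexp_arrays e \<union> rexp_arrays f"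
| "rexp_arrays (Sub e f) = rexp_arrays e \<union> rexp_arrays f"
| "rexp_arrays (Mul e f) = rexp_arrays e \<union> rexp_arrays f"
| "rexp_arrays (Div e f) = rexp_arrays e \<union> rexp_arrays f"

fun com_arrays :: "com \<Rightarrow> nat set" where
  "com_arrays (Put a e f) = insert a (rexp_arrays e \<union> rexp_arrays f)"
| "com_arrays (Seq c d) = com_arrays c \<union> com_arrays d"
| "com_arrays (Cond e c d) = rexp_arrays e \<union> com_arrays c \<union> com_arrays d"
| "com_arrays (While e c) = rexp_arrays e \<union> com_arrays c"

lemma finite_rexp_arrays: "finite (rexp_arrays e)"
  by (induction e) auto

lemma finite_com_arrays: "finite (com_arrays c)"
  by (induction c) (auto simp: finite_rexp_arrays)

lemma rexp_cong:
  "(\<And>a. a \<in> rexp_arrays e \<Longrightarrow> s a = r a) \<Longrightarrow> rval e s = rval e r \<and> rcost e s = rcost e r"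
  by (induction e) auto

text \<open>Needed when the given algorithm starts in a memory whose auxiliary arrays still hold
  leftovers of the reduction.\<close>

lemma exec_frame:
  "exec c s T s' \<Longrightarrow> com_arrays c \<subseteq> A \<Longrightarrow> (\<And>a. a \<in> A \<Longrightarrow> s a = r a) \<Longrightarrow>
     \<exists>r'. exec c r T r' \<and> (\<forall>a\<in>A. s' a = r' a)"
proof (induction arbitrary: r rule: exec.induct)
  case (Put a e f s)
  have e: "rval e s = rval e r \<and> rcost e s = rcost e r" "rval f s = rval f r \<and> rcost f s = rcost f r"
    using Put by (intro rexp_cong; auto)+
  then have "\<forall>b\<in>A. (s(a := (s a)(rval e s := rval f s))) b = (r(a := (r a)(rval e r := rval f r))) b"
    using Put by auto
  then show ?case using exec.Put[of a e f r] e by metis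
next
  case (Seq c s T s' d U s'')
  obtain r1 where "exec c r T r1" "\<forall>a\<in>A. s' a = r1 a"
    using Seq.IH(1)[of r] Seq.prems by auto
  moreover then obtain r2 where "exec d r1 U r2" "\<forall>a\<in>A. s'' a = r2 a"
    using Seq.IH(2)[of r1] Seq.prems by auto
  ultimately show ?case by (blast intro: exec.Seq)
next
  case (CondTrue e s c T s' d)
  then have "rval e s = rval e r \<and> rcost e s = rcost e r" by (intro rexp_cong) auto
  moreover obtain r1 where "exec c r T r1" "\<forall>a\<in>A. s' a = r1 a"
    using CondTrue.IH[of r] CondTrue.prems by auto
  ultimately show ?case using CondTrue.hyps by (metis exec.CondTrue)
next
  case (CondFalse e s d T s' c)
  then have "rval e s = rval e r \<and> rcost e s = rcost e r" by (intro rexp_cong) auto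
  moreover obtain r1 where "exec d r T r1" "\<forall>a\<in>A. s' a = r1 a"
    using CondFalse.IH[of r] CondFalse.prems by auto
  ultimately show ?case using CondFalse.hyps by (metis exec.CondFalse)
next
  case (WhileTrue e s c T s' U s'')
  then have "rval e s = rval e r \<and> rcost e s = rcost e r" by (intro rexp_cong) auto
  moreover obtain r1 where r1: "exec c r T r1" "\<forall>a\<in>A. s' a = r1 a"
    using WhileTrue.IH(1)[of r] WhileTrue.prems by auto
  moreover obtain r2 where "exec (While e c) r1 U r2" "\<forall>a\<in>A. s'' a = r2 a"
    using WhileTrue.IH(2)[of r1] WhileTrue.prems r1 by auto
  ultimately show ?case using WhileTrue.hyps by (metis exec.WhileTrue)
next
  case (WhileFalse e s c)
  then have "rval e s = rval e r \<and> rcost e s = rcost e r" by (intro rexp_cong) auto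
  then show ?case using WhileFalse by (metis exec.WhileFalse)
qed

lemma exec_while_for:
  assumes "\<And>i s. i < n \<Longrightarrow> Inv i s \<Longrightarrow> \<exists>T s'. exec c s T s' \<and> Inv (Suc i) s' \<and> T \<le> B"
    and "\<And>i s. i \<le> n \<Longrightarrow> Inv i s \<Longrightarrow> (rval e s \<noteq> 0 \<longleftrightarrow> i < n) \<and> rcost e s \<le> D"
    and "Inv 0 s"
  shows "\<exists>T s'. exec (While e c) s T s' \<and> Inv n s' \<and> T \<le> Suc n * (B + D + 1)"
proof -
  \<comment> \<open>Induction on the number \<open>k\<close> of iterations left; the factor
    \<open>Suc k\<close> also counts the final failing test.\<close>
  have "\<exists>T s'. exec (While e c) s T s' \<and> Inv n s' \<and> T \<le> Suc k * (B + D + 1)"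
    if "k \<le> n" "Inv (n - k) s" for k s
    using that
  proof (induction k arbitrary: s)
    case 0
    then show ?case using assms(2)[of n s] exec.WhileFalse[of e s c]
      by (intro exI[of _ "Suc (rcost e s)"] exI[of _ s]) auto
  next
    case (Suc k)
    have e: "rval e s \<noteq> 0" "rcost e s \<le> D" using assms(2)[of "n - Suc k" s] Suc.prems by auto
    obtain T s1 where 1: "exec c s T s1" "Inv (Suc (n - Suc k)) s1" "T \<le> B"
      using assms(1)[of "n - Suc k" s] Suc.prems by auto
    moreover have "Suc (n - Suc k) = n - k" using Suc.prems by simp
    ultimately obtain U s2 where 2: "exec (While e c) s1 U s2" "Inv n s2" "U \<le> Suc k * (B + D + 1)"
      using Suc.IH[of s1] Suc.prems by auto
    then show ?case using e 1 exec.WhileTrue[OF e(1) 1(1) 2(1)]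
      by (intro exI[of _ "Suc (rcost e s + T + U)"] exI[of _ s2]) auto
  qed
  from this[of n s] show ?thesis using assms(3) by simp
qed

text \<open>Registers will only hold polynomially bounded values, so estimating a length by the
  value itself keeps all costs polynomial.\<close>

lemma log_cost_le: "log_cost x \<le> x + 1"
proof -
  have "floorlog 2 x \<le> x"
    by (intro floorlog_leI) (auto intro: less_exp)
  then show ?thesis by (simp add: log_cost_def)
qed


section \<open>Functions computable in polynomial time\<close>

text \<open>With \<open>Y \<ge> 2\<close> a bare power absorbs constants and sums, so no leading
  coefficient has to be carried along.\<close>

definition poly_bdd :: "(nat \<Rightarrow> nat) \<Rightarrow> bool" where
  "poly_bdd t \<longleftrightarrow> (\<exists>e. \<forall>Y\<ge>2. t Y \<le> Y ^ e)"

lemma poly_bdd_const: "poly_bdd (\<lambda>_. c)"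
  unfolding poly_bdd_def
proof (intro exI[of _ c] allI impI)
  fix Y :: nat assume "2 \<le> Y"
  then have "2 ^ c \<le> Y ^ c" by (rule power_mono) simp
  then show "c \<le> Y ^ c" using less_exp[of c] by linarith
qed

lemma poly_bdd_id: "poly_bdd (\<lambda>Y. Y)"
  unfolding poly_bdd_def by (intro exI[of _ 1]) simp

lemma poly_bdd_mult: "poly_bdd t \<Longrightarrow> poly_bdd u \<Longrightarrow> poly_bdd (\<lambda>Y. t Y * u Y)"
  unfolding poly_bdd_def by (metis mult_le_mono power_add)

lemma poly_bdd_add:
  assumes "poly_bdd t" "poly_bdd u" shows "poly_bdd (\<lambda>Y. t Y + u Y)"
proof -
  obtain d e where de: "\<And>Y. Y \<ge> 2 \<Longrightarrow> t Y \<le> Y ^ d" "\<And>Y. Y \<ge> 2 \<Longrightarrow> u Y \<le> Y ^ e"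
    using assms unfolding poly_bdd_def by auto
  have "t Y + u Y \<le> Y ^ (d + e + 1)" if Y: "Y \<ge> 2" for Y
  proof -
    have "Y ^ d \<le> Y ^ (d + e)" "Y ^ e \<le> Y ^ (d + e)" using Y by (auto intro!: power_increasing)
    moreover have "2 * Y ^ (d + e) \<le> Y * Y ^ (d + e)" using Y by (rule mult_right_mono) simp
    moreover have "Y ^ (d + e + 1) = Y * Y ^ (d + e)" by simp
    ultimately show ?thesis using de[OF Y] by linarith
  qed
  then show ?thesis unfolding poly_bdd_def by blast
qed

lemma poly_bdd_Suc: "poly_bdd t \<Longrightarrow> poly_bdd (\<lambda>Y. Suc (t Y))"
  using poly_bdd_add[OF _ poly_bdd_const[of 1], of t] by simp

lemma poly_bdd_power: "poly_bdd t \<Longrightarrow> poly_bdd (\<lambda>Y. t Y ^ n)"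
  by (induction n) (auto intro: poly_bdd_mult poly_bdd_const[of 1, simplified])

lemma poly_bdd_mono: "poly_bdd u \<Longrightarrow> (\<And>Y. Y \<ge> 2 \<Longrightarrow> t Y \<le> u Y) \<Longrightarrow> poly_bdd t"
  unfolding poly_bdd_def by (meson le_trans)

lemmas poly_bdd_intros =
  poly_bdd_const poly_bdd_id poly_bdd_mult poly_bdd_add poly_bdd_Suc poly_bdd_power

text \<open>\<open>Y\<close> plays the part of the input size. Cell 0 holds the number of clauses
  and serves as a loop bound, so it is bounded itself; of the other cells only the lengths are,
  since variable names may be exponential in \<open>Y\<close>.\<close>

definition admissible :: "nat \<Rightarrow> (nat \<Rightarrow> nat) \<Rightarrow> bool" where
  "admissible Y I \<longleftrightarrow> I 0 \<le> Y \<and> (\<forall>i. log_cost (I i) \<le> Y)"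

lemma admissible_mono: "admissible Y I \<Longrightarrow> Y \<le> Z \<Longrightarrow> admissible Z I"
  unfolding admissible_def by (meson le_trans)

text \<open>
  \<open>pcomp ia ra k f\<close>: the value \<open>f I \<rho>\<close> can be computed in polynomial time from the input \<open>I\<close>
  stored in array \<open>ia\<close> and from the registers \<open>\<rho>\<close> of array \<open>ra\<close> with index below \<open>k\<close>.
  A program is required at every level \<open>l \<ge> k\<close>; it may clobber the registers from \<open>l\<close> on.
\<close>

definition computes_at ::
  "nat \<Rightarrow> nat \<Rightarrow> nat \<Rightarrow> ((nat \<Rightarrow> nat) \<Rightarrow> (nat \<Rightarrow> nat) \<Rightarrow> nat) \<Rightarrow> com \<Rightarrow> (nat \<Rightarrow> nat) \<Rightarrow> bool" where
  "computes_at ia ra l f c t \<longleftrightarrow>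
     (\<forall>s Y. 2 \<le> Y \<longrightarrow> admissible Y (s ia) \<longrightarrow> (\<forall>j<l. s ra j \<le> Y) \<longrightarrow>
        f (s ia) (s ra) \<le> t Y \<and>
        (\<exists>T r. exec c s T (s(ra := r)) \<and> r l = f (s ia) (s ra) \<and> (\<forall>j<l. r j = s ra j) \<and> T \<le> t Y))"

definition pcomp :: "nat \<Rightarrow> nat \<Rightarrow> nat \<Rightarrow> ((nat \<Rightarrow> nat) \<Rightarrow> (nat \<Rightarrow> nat) \<Rightarrow> nat) \<Rightarrow> bool" where
  "pcomp ia ra k f \<longleftrightarrow> ia \<noteq> ra \<and>
     (\<forall>I \<rho> \<rho>'. (\<forall>j<k. \<rho> j = \<rho>' j) \<longrightarrow> f I \<rho> = f I \<rho>') \<and>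
     (\<forall>l\<ge>k. \<exists>c t. poly_bdd t \<and> computes_at ia ra l f c t)"

lemma pcomp_lift: "pcomp ia ra k f \<Longrightarrow> k \<le> k' \<Longrightarrow> pcomp ia ra k' f"
  unfolding pcomp_def by (meson le_trans less_le_trans)

lemma pcomp_cong: "pcomp ia ra k f \<Longrightarrow> (\<And>j. j < k \<Longrightarrow> \<rho> j = \<rho>' j) \<Longrightarrow> f I \<rho> = f I \<rho>'"
  unfolding pcomp_def by blast

lemma pcompE:
  assumes "pcomp ia ra k f" "k \<le> l"
  obtains c e where "computes_at ia ra l f c (\<lambda>Y. Y ^ e)"
proof -
  obtain c t where ct: "poly_bdd t" "computes_at ia ra l f c t"
    using assms unfolding pcomp_def by blast
  then obtain e where e: "\<And>Y. Y \<ge> 2 \<Longrightarrow> t Y \<le> Y ^ e" unfolding poly_bdd_def by blast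
  have "computes_at ia ra l f c (\<lambda>Y. Y ^ e)"
    unfolding computes_at_def
  proof (intro allI impI)
    fix s :: memory and Y :: nat
    assume Y: "2 \<le> Y" "admissible Y (s ia)" "\<forall>j<l. s ra j \<le> Y"
    then obtain T r where "f (s ia) (s ra) \<le> t Y" "exec c s T (s(ra := r))" "r l = f (s ia) (s ra)"
        "\<forall>j<l. r j = s ra j" "T \<le> t Y"
      using ct(2) unfolding computes_at_def by blast
    with e[OF Y(1)] show "f (s ia) (s ra) \<le> Y ^ e \<and> (\<exists>T r. exec c s T (s(ra := r)) \<and>
        r l = f (s ia) (s ra) \<and> (\<forall>j<l. r j = s ra j) \<and> T \<le> Y ^ e)"
      using le_trans by blast
  qed
  then show ?thesis by (rule that)
qed

lemma computes_atE:
  assumes "computes_at ia ra l f c t" "2 \<le> Y" "admissible Y (s ia)" "\<And>j. j < l \<Longrightarrow> s ra j \<le> Y"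
  obtains T r where "f (s ia) (s ra) \<le> t Y" "exec c s T (s(ra := r))" "r l = f (s ia) (s ra)"
    "\<And>j. j < l \<Longrightarrow> r j = s ra j" "T \<le> t Y"
  using assms unfolding computes_at_def by blast

lemma poly_bdd_comp:
  assumes "poly_bdd t" "poly_bdd u" "\<And>Y. Y \<ge> 2 \<Longrightarrow> u Y \<ge> 2"
  shows "poly_bdd (\<lambda>Y. t (u Y))"
proof -
  obtain e where "\<And>Y. Y \<ge> 2 \<Longrightarrow> t Y \<le> Y ^ e" using assms(1) unfolding poly_bdd_def by blast
  then show ?thesis using assms(3) by (intro poly_bdd_mono[OF poly_bdd_power[OF assms(2), of e]]) blast
qed

text \<open>Stack discipline: \<open>f\<close> leaves its value in register \<open>l\<close>,
  \<open>h\<close> runs one level higher and so preserves it, and a single expression merges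
  registers \<open>l\<close> and \<open>l + 1\<close> into \<open>l\<close>.\<close>

lemma pcomp_combine:
  fixes u :: "nat \<Rightarrow> nat \<Rightarrow> nat"
  assumes f: "pcomp ia ra k f" and h: "pcomp ia ra k h"
    and E: "\<And>l s Y. 2 \<le> Y \<Longrightarrow> admissible Y (s ia) \<Longrightarrow> s ra l \<le> Y \<Longrightarrow> s ra (Suc l) \<le> Y \<Longrightarrow>
        rval (E l) s = G (s ia) (s ra l) (s ra (Suc l)) \<and> rcost (E l) s \<le> u l Y \<and>
        G (s ia) (s ra l) (s ra (Suc l)) \<le> u l Y"
    and u: "\<And>l. poly_bdd (u l)"
  shows "pcomp ia ra k (\<lambda>I \<rho>. G I (f I \<rho>) (h I \<rho>))"
  unfolding pcomp_def
proof (intro conjI allI impI)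
  show "ia \<noteq> ra" using f unfolding pcomp_def by blast
  then have ra: "\<And>(s::memory) r. (s(ra := r)) ia = s ia" and neq: "ia \<noteq> ra" by simp_all
  show "G I (f I \<rho>) (h I \<rho>) = G I (f I \<rho>') (h I \<rho>')" if "\<forall>j<k. \<rho> j = \<rho>' j" for I \<rho> \<rho>'
    using pcomp_cong[OF f] pcomp_cong[OF h] that by metis
  fix l assume l: "k \<le> l"
  obtain c d where c: "computes_at ia ra l f c (\<lambda>Y. Y ^ d)" using pcompE[OF f l] .
  obtain c' e where c': "computes_at ia ra (Suc l) h c' (\<lambda>Y. Y ^ e)" using pcompE[OF h, of "Suc l"] l by auto
  \<comment> \<open>After \<open>f\<close> the registers are bounded by \<open>Y + Y ^ d\<close>, so
    the bound of \<open>h\<close> is taken there; \<open>z\<close> dominates all registers that the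
    final expression reads.\<close>
  define z where "z = (\<lambda>Y::nat. (Y + Y ^ d) + (Y + Y ^ d) ^ e)"
  define t where "t = (\<lambda>Y. z Y + z Y + Suc (l + 1 + u l (z Y)) + u l (z Y))"
  have "poly_bdd z" unfolding z_def by (intro poly_bdd_intros)
  then have "poly_bdd t" unfolding t_def
    by (intro poly_bdd_intros poly_bdd_comp[OF u]) (auto simp: z_def)
  moreover have "computes_at ia ra l (\<lambda>I \<rho>. G I (f I \<rho>) (h I \<rho>))
      (Seq c (Seq c' (Put ra (Const l) (E l)))) t"
    unfolding computes_at_def
  proof (intro allI impI)
    fix s :: memory and Y :: nat
    assume Y: "2 \<le> Y" "admissible Y (s ia)" "\<forall>j<l. s ra j \<le> Y"
    obtain T r where r: "f (s ia) (s ra) \<le> Y ^ d" "exec c s T (s(ra := r))" "r l = f (s ia) (s ra)"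
        "\<And>j. j < l \<Longrightarrow> r j = s ra j" "T \<le> Y ^ d"
      using computes_atE[where s = s, OF c Y(1,2)] Y(3) by blast
    let ?Y = "Y + Y ^ d" and ?s = "s(ra := r)"
    have Y': "2 \<le> ?Y" "admissible ?Y (?s ia)" "\<And>j. j < Suc l \<Longrightarrow> ?s ra j \<le> ?Y"
      using Y r(1,3,4) admissible_mono[OF Y(2), of ?Y] by (auto simp: less_Suc_eq neq trans_le_add1)
    obtain T' r' where r': "h (s ia) r \<le> ?Y ^ e" "exec c' ?s T' (?s(ra := r'))" "r' (Suc l) = h (s ia) r"
        "\<And>j. j < Suc l \<Longrightarrow> r' j = r j" "T' \<le> ?Y ^ e"
      using computes_atE[where s = ?s, OF c' Y'] by (auto simp: neq)
    have h_eq: "h (s ia) r = h (s ia) (s ra)"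
      using l r(4) by (intro pcomp_cong[OF h]) auto
    let ?s' = "s(ra := r')"
    have s': "?s' ra l = f (s ia) (s ra)" "?s' ra (Suc l) = h (s ia) (s ra)" "?s' ia = s ia"
      using r r' h_eq ra by auto
    have "2 \<le> z Y" "admissible (z Y) (?s' ia)" "?s' ra l \<le> z Y" "?s' ra (Suc l) \<le> z Y"
      unfolding s' using Y(1) r(1) r'(1) h_eq admissible_mono[OF Y(2), of "z Y"] by (auto simp: z_def)
    from E[OF this] have E'': "rval (E l) ?s' = G (s ia) (f (s ia) (s ra)) (h (s ia) (s ra)) \<and>
        rcost (E l) ?s' \<le> u l (z Y) \<and> G (s ia) (f (s ia) (s ra)) (h (s ia) (s ra)) \<le> u l (z Y)"
      unfolding s' .
    note E' = E''[THEN conjunct1] E''[THEN conjunct2, THEN conjunct1] E''[THEN conjunct2, THEN conjunct2]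
    let ?r = "r'(l := rval (E l) ?s')"
    have "exec (Put ra (Const l) (E l)) ?s' (Suc (rcost (Const l) ?s' + rcost (E l) ?s')) (s(ra := ?r))"
      using exec.Put[of ra "Const l" "E l" ?s'] by simp
    then have ex: "exec (Seq c (Seq c' (Put ra (Const l) (E l)))) s
        (T + (T' + Suc (rcost (Const l) ?s' + rcost (E l) ?s'))) (s(ra := ?r))"
      using r(2) r'(2)[unfolded fun_upd_upd] by (intro exec.Seq)
    have "Y ^ d \<le> z Y" "?Y ^ e \<le> z Y" by (auto simp: z_def)
    then have "T + (T' + Suc (rcost (Const l) ?s' + rcost (E l) ?s')) \<le> t Y"
      using r(5) r'(5) E'(2) log_cost_le[of l] unfolding t_def by simp
    then show "G (s ia) (f (s ia) (s ra)) (h (s ia) (s ra)) \<le> t Y \<and>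
       (\<exists>T r. exec (Seq c (Seq c' (Put ra (Const l) (E l)))) s T (s(ra := r)) \<and>
          r l = G (s ia) (f (s ia) (s ra)) (h (s ia) (s ra)) \<and> (\<forall>j<l. r j = s ra j) \<and> T \<le> t Y)"
      using ex E' r(4) r'(4) unfolding t_def
      by (intro conjI exI[of _ "T + (T' + Suc (rcost (Const l) ?s' + rcost (E l) ?s'))"] exI[of _ ?r]) auto
  qed
  ultimately show "\<exists>c t. poly_bdd t \<and> computes_at ia ra l (\<lambda>I \<rho>. G I (f I \<rho>) (h I \<rho>)) c t" by blast
qed

lemma pcomp_simple:
  fixes u :: "nat \<Rightarrow> nat \<Rightarrow> nat"
  assumes "ia \<noteq> ra" and cong: "\<And>I \<rho> \<rho>'. (\<forall>j<k. \<rho> j = \<rho>' j) \<Longrightarrow> G I \<rho> = G I \<rho>'"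
    and E: "\<And>l s Y. k \<le> l \<Longrightarrow> 2 \<le> Y \<Longrightarrow> admissible Y (s ia) \<Longrightarrow> (\<forall>j<l. s ra j \<le> Y) \<Longrightarrow>
        rval (E l) s = G (s ia) (s ra) \<and> rcost (E l) s \<le> u l Y \<and> G (s ia) (s ra) \<le> u l Y"
    and u: "\<And>l. poly_bdd (u l)"
  shows "pcomp ia ra k G"
  unfolding pcomp_def
proof (intro conjI allI impI)
  show "ia \<noteq> ra" by fact
  show "G I \<rho> = G I \<rho>'" if "\<forall>j<k. \<rho> j = \<rho>' j" for I \<rho> \<rho>' using cong that .
  fix l assume l: "k \<le> l"
  define t where "t = (\<lambda>Y. Suc (l + 1 + u l Y) + u l Y)"
  have "poly_bdd t" unfolding t_def by (intro poly_bdd_intros u)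
  moreover have "computes_at ia ra l G (Put ra (Const l) (E l)) t"
    unfolding computes_at_def
  proof (intro allI impI)
    fix s :: memory and Y :: nat
    assume Y: "2 \<le> Y" "admissible Y (s ia)" "\<forall>j<l. s ra j \<le> Y"
    note E' = E[OF l Y]
    have "exec (Put ra (Const l) (E l)) s (Suc (rcost (Const l) s + rcost (E l) s))
       (s(ra := (s ra)(l := rval (E l) s)))"
      using exec.Put[of ra "Const l" "E l" s] by simp
    moreover have "Suc (rcost (Const l) s + rcost (E l) s) \<le> t Y"
      using E' log_cost_le[of l] by (simp add: t_def)
    ultimately show "G (s ia) (s ra) \<le> t Y \<and>
       (\<exists>T r. exec (Put ra (Const l) (E l)) s T (s(ra := r)) \<and>
          r l = G (s ia) (s ra) \<and> (\<forall>j<l. r j = s ra j) \<and> T \<le> t Y)"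
      using E' unfolding t_def
      by (intro conjI exI[of _ "Suc (rcost (Const l) s + rcost (E l) s)"]
          exI[of _ "(s ra)(l := rval (E l) s)"]) auto
  qed
  ultimately show "\<exists>c t. poly_bdd t \<and> computes_at ia ra l G c t" by blast
qed

lemma pcomp_neq: "pcomp ia ra k f \<Longrightarrow> ia \<noteq> ra"
  unfolding pcomp_def by blast

lemma log_cost_mono: "x \<le> y \<Longrightarrow> log_cost x \<le> log_cost y"
  by (simp add: log_cost_def floorlog_mono)

lemma pcomp_const: "ia \<noteq> ra \<Longrightarrow> pcomp ia ra k (\<lambda>_ _. n)"
  by (rule pcomp_simple[where E = "\<lambda>_. Const n" and u = "\<lambda>_ _. n + 1"])
    (use log_cost_le[of n] in \<open>auto intro: poly_bdd_intros\<close>)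

lemma pcomp_reg:
  assumes "ia \<noteq> ra" "j < k" shows "pcomp ia ra k (\<lambda>_ \<rho>. \<rho> j)"
proof (rule pcomp_simple[where E = "\<lambda>_. Get ra (Const j)" and u = "\<lambda>_ Y. j + 1 + (Y + 1)"])
  fix l Y :: nat and s :: memory
  assume "k \<le> l" "\<forall>j<l. s ra j \<le> Y"
  then have "s ra j \<le> Y" using assms(2) by simp
  then show "rval (Get ra (Const j)) s = s ra j \<and> rcost (Get ra (Const j)) s \<le> j + 1 + (Y + 1) \<and>
      s ra j \<le> j + 1 + (Y + 1)"
    using log_cost_le[of j] log_cost_le[of "s ra j"] by simp
qed (use assms in \<open>auto intro!: poly_bdd_intros\<close>)

lemma pcomp_head:
  assumes "ia \<noteq> ra" shows "pcomp ia ra k (\<lambda>I _. I 0)"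
proof (rule pcomp_simple[where E = "\<lambda>_. Get ia (Const 0)" and u = "\<lambda>_ Y. Y + 1 + (Y + 1)"])
  fix l Y :: nat and s :: memory
  assume "admissible Y (s ia)"
  then have "s ia 0 \<le> Y" by (simp add: admissible_def)
  then show "rval (Get ia (Const 0)) s = s ia 0 \<and> rcost (Get ia (Const 0)) s \<le> Y + 1 + (Y + 1) \<and>
      s ia 0 \<le> Y + 1 + (Y + 1)"
    using log_cost_le[of 0] log_cost_le[of "s ia 0"] by simp
qed (use assms in \<open>auto intro!: poly_bdd_intros\<close>)

text \<open>The square \<open>(x + y + 1) ^ 2\<close> dominates the results of all four machine
  operations, so one estimate serves them all.\<close>

lemma pcomp_arith:
  assumes bop: "\<And>a b s. rval (bop a b) s = g (rval a s) (rval b s)"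
      "\<And>a b s. rcost (bop a b) s = rcost a s + rcost b s + log_cost (g (rval a s) (rval b s))"
    and g: "\<And>x y. g x y \<le> (x + y + 1) ^ 2"
    and f: "pcomp ia ra k f" and h: "pcomp ia ra k h"
  shows "pcomp ia ra k (\<lambda>I \<rho>. g (f I \<rho>) (h I \<rho>))"
proof -
  let ?E = "\<lambda>l. bop (Get ra (Const l)) (Get ra (Const (Suc l)))"
  let ?u = "\<lambda>l Y. (l + 1) + (Y + 1) + (l + 2) + (Y + 1) + (Y + Y + 1) ^ 2 + (Y + Y + 1) ^ 2 + 1"
  show ?thesis
proof (rule pcomp_combine[OF f h, where G = "\<lambda>_. g" and E = ?E and u = ?u])
  fix l Y :: nat and s :: memory
  assume Y: "s ra l \<le> Y" "s ra (Suc l) \<le> Y"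
  have "g (s ra l) (s ra (Suc l)) \<le> (s ra l + s ra (Suc l) + 1) ^ 2" by (rule g)
  also have "\<dots> \<le> (Y + Y + 1) ^ 2" using Y by (intro power_mono) auto
  finally have "g (s ra l) (s ra (Suc l)) \<le> (Y + Y + 1) ^ 2" .
  moreover have "log_cost (g (s ra l) (s ra (Suc l))) \<le> g (s ra l) (s ra (Suc l)) + 1" by (rule log_cost_le)
  ultimately show "rval (?E l) s = g (s ra l) (s ra (Suc l)) \<and> rcost (?E l) s \<le> ?u l Y \<and>
      g (s ra l) (s ra (Suc l)) \<le> ?u l Y"
    using bop Y log_cost_le[of l] log_cost_le[of "Suc l"] log_cost_le[of "s ra l"]
      log_cost_le[of "s ra (Suc l)"] by simp
next
  fix l show "poly_bdd (?u l)" by (intro poly_bdd_intros)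
qed
qed

lemma pcomp_add: "pcomp ia ra k f \<Longrightarrow> pcomp ia ra k h \<Longrightarrow> pcomp ia ra k (\<lambda>I \<rho>. f I \<rho> + h I \<rho>)"
  by (rule pcomp_arith[where bop = Add and g = "(+)"]) (auto simp: power2_eq_square)

lemma pcomp_mult: "pcomp ia ra k f \<Longrightarrow> pcomp ia ra k h \<Longrightarrow> pcomp ia ra k (\<lambda>I \<rho>. f I \<rho> * h I \<rho>)"
  by (rule pcomp_arith[where bop = Mul and g = "\<lambda>x y. x * y"]) (auto simp: power2_eq_square algebra_simps)

lemma pcomp_sub: "pcomp ia ra k f \<Longrightarrow> pcomp ia ra k h \<Longrightarrow> pcomp ia ra k (\<lambda>I \<rho>. f I \<rho> - h I \<rho>)"
  by (rule pcomp_arith[where bop = Sub and g = "(-)"]) (auto simp: power2_eq_square)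

lemma pcomp_div: "pcomp ia ra k f \<Longrightarrow> pcomp ia ra k h \<Longrightarrow> pcomp ia ra k (\<lambda>I \<rho>. f I \<rho> div h I \<rho>)"
proof (rule pcomp_arith[where bop = Div and g = "(div)"])
  fix x y :: nat
  have "x div y \<le> x" by simp
  also have "x \<le> (x + y + 1) ^ 2" by (simp add: power2_eq_square)
  finally show "x div y \<le> (x + y + 1) ^ 2" .
qed auto

lemma pcomp_mod: "pcomp ia ra k f \<Longrightarrow> pcomp ia ra k h \<Longrightarrow> pcomp ia ra k (\<lambda>I \<rho>. f I \<rho> mod h I \<rho>)"
  unfolding minus_div_mult_eq_mod[symmetric] by (intro pcomp_sub pcomp_mult pcomp_div)

text \<open>The machine has no comparisons; truncated subtraction supplies them.\<close>

lemma of_bool_less_eq_sub: "of_bool (x < y) = 1 - (1 - (y - x :: nat))"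
  by auto

lemma of_bool_eq_eq_sub: "of_bool (x = y) = 1 - ((x - y) + (y - x :: nat))"
  by auto

text \<open>
  The cells of the input may hold numbers of exponential size, so they are only accessed through
  comparisons and truncation.
\<close>

lemma pcomp_input:
  fixes g :: "nat \<Rightarrow> nat \<Rightarrow> nat"
  assumes E: "\<And>a b s. rval (E a b) s = g (rval a s) (rval b s)"
    and cost: "\<And>a b s. rcost (E a b) s \<le> 9 * (rcost a s + rcost b s) + C"
    and bound: "\<And>x y. g x y \<le> C"
    and f: "pcomp ia ra k f" and h: "pcomp ia ra k h"
  shows "pcomp ia ra k (\<lambda>I \<rho>. g (I (f I \<rho>)) (I (h I \<rho>)))"
proof -
  let ?a = "\<lambda>l. Get ia (Get ra (Const l))"
  let ?E = "\<lambda>l. E (?a l) (?a (Suc l))"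
  let ?u = "\<lambda>l Y. 9 * (((l + 1) + (Y + 1) + Y) + ((l + 2) + (Y + 1) + Y)) + C"
  show ?thesis
proof (rule pcomp_combine[OF f h, where G = "\<lambda>I x y. g (I x) (I y)" and E = ?E and u = ?u])
  fix l Y :: nat and s :: memory
  assume Y: "s ra l \<le> Y" "s ra (Suc l) \<le> Y" "admissible Y (s ia)"
  then have "log_cost (s ia (s ra l)) \<le> Y" "log_cost (s ia (s ra (Suc l))) \<le> Y"
    by (auto simp: admissible_def)
  then have "rcost (?a l) s \<le> (l + 1) + (Y + 1) + Y" "rcost (?a (Suc l)) s \<le> (l + 2) + (Y + 1) + Y"
    using Y log_cost_le[of l] log_cost_le[of "Suc l"] log_cost_le[of "s ra l"] log_cost_le[of "s ra (Suc l)"]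
    by simp_all
  then have "rcost (?E l) s \<le> ?u l Y"
    by (intro order_trans[OF cost[of "?a l" "?a (Suc l)" s]] add_mono mult_left_mono) auto
  then show "rval (?E l) s = g (s ia (s ra l)) (s ia (s ra (Suc l))) \<and> rcost (?E l) s \<le> ?u l Y \<and>
      g (s ia (s ra l)) (s ia (s ra (Suc l))) \<le> ?u l Y"
    using E bound[of "s ia (s ra l)" "s ia (s ra (Suc l))"] by simp
next
  fix l show "poly_bdd (?u l)" by (intro poly_bdd_intros)
qed
qed

lemma rcost_ge_log_cost: "log_cost (rval e s) \<le> rcost e s"
  by (cases e) auto

lemma rcost_sub_le: "log_cost (rval e s - x) \<le> rcost e s"
  using log_cost_mono[of "rval e s - x" "rval e s"] rcost_ge_log_cost[of e s] by simp

lemma pcomp_input_less: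
  assumes "pcomp ia ra k f" "pcomp ia ra k h"
  shows "pcomp ia ra k (\<lambda>I \<rho>. of_bool (I (f I \<rho>) < I (h I \<rho>)))"
proof (rule pcomp_input[where g = "\<lambda>x y. of_bool (x < y)" and E = "\<lambda>a b. Sub (Const 1) (Sub (Const 1) (Sub b a))" and C = 10, OF _ _ _ assms])
  fix a b s
  show "rval (Sub (Const 1) (Sub (Const 1) (Sub b a))) s = of_bool (rval a s < rval b s)" by auto
  have "log_cost (1 - x) \<le> 2" for x using log_cost_le[of "1 - x"] by linarith
  have aux: "z + (z + (v + u + w) + x) + y \<le> 9 * (u + v) + 10"
    if "x \<le> 2" "y \<le> 2" "z \<le> 2" "w \<le> v" for u v w x y z :: nat
    using that by simp
  note * = \<open>\<And>x. log_cost (1 - x) \<le> 2\<close>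
  note *[of "rval b s - rval a s"] *[of "1 - (rval b s - rval a s)"]
  then show "rcost (Sub (Const 1) (Sub (Const 1) (Sub b a))) s \<le> 9 * (rcost a s + rcost b s) + 10"
    unfolding rcost.simps rval.simps
    using rcost_sub_le[of b s "rval a s"] log_cost_le[of 1] by (intro aux) auto
qed auto

lemma pcomp_input_eq:
  assumes "pcomp ia ra k f" "pcomp ia ra k h"
  shows "pcomp ia ra k (\<lambda>I \<rho>. of_bool (I (f I \<rho>) = I (h I \<rho>)))"
proof (rule pcomp_input[where g = "\<lambda>x y. of_bool (x = y)" and E = "\<lambda>a b. Sub (Const 1) (Add (Sub a b) (Sub b a))" and C = 10, OF _ _ _ assms])
  fix a b s
  show "rval (Sub (Const 1) (Add (Sub a b) (Sub b a))) s = of_bool (rval a s = rval b s)" by auto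
  have "log_cost (1 - x) \<le> 2" for x using log_cost_le[of "1 - x"] by linarith
  have aux: "z + (u + v + w + (v + u + w') + x) + y \<le> 9 * (u + v) + 10"
    if "x \<le> u + v" "y \<le> 2" "z \<le> 2" "w \<le> u" "w' \<le> v" for u v w w' x y z :: nat
    using that by simp
  note * = \<open>\<And>x. log_cost (1 - x) \<le> 2\<close>
  note *[of "(rval a s - rval b s) + (rval b s - rval a s)"]
  moreover have "log_cost ((rval a s - rval b s) + (rval b s - rval a s)) \<le> rcost a s + rcost b s"
    using rcost_sub_le[of a s "rval b s"] rcost_sub_le[of b s "rval a s"]
    by (cases "rval a s \<le> rval b s") auto
  ultimately show "rcost (Sub (Const 1) (Add (Sub a b) (Sub b a))) s \<le> 9 * (rcost a s + rcost b s) + 10"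
    unfolding rcost.simps rval.simps
    using rcost_sub_le[of a s "rval b s"] rcost_sub_le[of b s "rval a s"] log_cost_le[of 1] by (intro aux) auto
qed auto

lemma pcomp_input_min:
  assumes "pcomp ia ra k f"
  shows "pcomp ia ra k (\<lambda>I \<rho>. min (I (f I \<rho>)) q)"
proof (rule pcomp_input[where g = "\<lambda>x y. min x q" and E = "\<lambda>a b. Sub a (Sub a (Const q))" and C = "9 * q + 9", OF _ _ _ assms assms])
  fix a b s
  show "rval (Sub a (Sub a (Const q))) s = min (rval a s) q" by auto
  show "rcost (Sub a (Sub a (Const q))) s \<le> 9 * (rcost a s + rcost b s) + (9 * q + 9)"
    using rcost_sub_le[of a s q] rcost_sub_le[of a s "rval a s - q"] log_cost_le[of q] by simp
qed auto

text \<open>A loop around a polynomial-time step may still square a number again and again, so a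
  polynomial bound \<open>u\<close> on all intermediate values is demanded separately, as in
  Cobham's bounded recursion.\<close>

lemma pcomp_rec:
  fixes b :: "(nat \<Rightarrow> nat) \<Rightarrow> (nat \<Rightarrow> nat) \<Rightarrow> nat \<Rightarrow> nat \<Rightarrow> nat"
  assumes n: "pcomp ia ra k n" and z: "pcomp ia ra k z"
    and b: "\<And>l x y. k \<le> l \<Longrightarrow> pcomp ia ra l x \<Longrightarrow> pcomp ia ra l y \<Longrightarrow>
        pcomp ia ra l (\<lambda>I \<rho>. b I \<rho> (x I \<rho>) (y I \<rho>))"
    and u: "poly_bdd u" "\<And>I \<rho> Y i. 2 \<le> Y \<Longrightarrow> admissible Y I \<Longrightarrow> (\<forall>j<k. \<rho> j \<le> Y) \<Longrightarrow> i \<le> n I \<rho> \<Longrightarrow>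
        rec_nat (z I \<rho>) (b I \<rho>) i \<le> u Y"
  shows "pcomp ia ra k (\<lambda>I \<rho>. rec_nat (z I \<rho>) (b I \<rho>) (n I \<rho>))"
  unfolding pcomp_def
proof (intro conjI allI impI)
  show neq: "ia \<noteq> ra" using n by (rule pcomp_neq)
  \<comment> \<open>Feeding constant functions into the assumption on \<open>b\<close> shows that
    the step itself depends only on the registers below \<open>k\<close>.\<close>
  have b_cong: "b I \<rho> = b I \<rho>'" if "\<And>j. j < k \<Longrightarrow> \<rho> j = \<rho>' j" for I \<rho> \<rho>'
  proof (intro ext)
    fix i a
    show "b I \<rho> i a = b I \<rho>' i a"
      using pcomp_cong[OF b[OF le_refl pcomp_const[OF neq, of k i] pcomp_const[OF neq, of k a]] that] .
  qed
  show "rec_nat (z I \<rho>) (b I \<rho>) (n I \<rho>) = rec_nat (z I \<rho>') (b I \<rho>') (n I \<rho>')"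
    if "\<forall>j<k. \<rho> j = \<rho>' j" for I \<rho> \<rho>'
    using that pcomp_cong[OF n, of \<rho> \<rho>' I] pcomp_cong[OF z, of \<rho> \<rho>' I] b_cong[of \<rho> \<rho>' I] by simp
  fix l assume l: "k \<le> l"
  obtain cz ez where cz: "computes_at ia ra l z cz (\<lambda>Y. Y ^ ez)" using pcompE[OF z l] .
  obtain cn en where cn: "computes_at ia ra (Suc l) n cn (\<lambda>Y. Y ^ en)"
    using pcompE[OF n, of "Suc l"] l by auto
  \<comment> \<open>Register layout: \<open>l\<close> accumulator, \<open>l + 1\<close> number of
    rounds, \<open>l + 2\<close> counter, \<open>l + 3\<close> result of the step.\<close>
  define body where "body = (\<lambda>I \<rho>. b I \<rho> (\<rho> (l + 2)) (\<rho> l))"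
  have "pcomp ia ra (l + 3) body"
    unfolding body_def using l by (intro b pcomp_reg neq) auto
  then obtain cb eb where cb: "computes_at ia ra (l + 3) body cb (\<lambda>Y. Y ^ eb)"
    using pcompE le_refl by metis
  obtain eu where eu: "\<And>Y. Y \<ge> 2 \<Longrightarrow> u Y \<le> Y ^ eu" using u(1) unfolding poly_bdd_def by blast
  define R where "R = (\<lambda>j. Get ra (Const (l + j)))"
  define P where "P = (\<lambda>j e. Put ra (Const (l + j)) e)"
  define step where "step = Seq cb (Seq (P 0 (R 3)) (P 2 (Add (R 2) (Const 1))))"
  define prog where "prog = Seq cz (Seq cn (Seq (P 2 (Const 0)) (While (Sub (R 1) (R 2)) step)))"
  define Z where "Z = (\<lambda>Y::nat. Y + Y ^ ez + (Y + Y ^ ez) ^ en + Y ^ eu)"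
  define B where "B = (\<lambda>Y. Z Y ^ eb + (l + 1 + (l + 4 + Z Y ^ eb + 1) + 1) +
      (l + 3 + (l + 3 + (Z Y + 1) + 2 + (Z Y + 2)) + 1))"
  define t where "t = (\<lambda>Y. Z Y + (Z Y + (l + 5 + Suc (Z Y) * (B Y + (2 * (l + 3 + (Z Y + 1)) + (Z Y + 1)) + 1))) + Z Y)"
  have "poly_bdd Z" unfolding Z_def by (intro poly_bdd_intros)
  then have "poly_bdd t" unfolding t_def B_def by (intro poly_bdd_intros)
  moreover have "computes_at ia ra l (\<lambda>I \<rho>. rec_nat (z I \<rho>) (b I \<rho>) (n I \<rho>)) prog t"
    unfolding computes_at_def
  proof (intro allI impI)
    fix s :: memory and Y :: nat
    assume Y: "2 \<le> Y" "admissible Y (s ia)" "\<forall>j<l. s ra j \<le> Y"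
    define I where "I = s ia"
    define \<rho> where "\<rho> = s ra"
    define g where "g = rec_nat (z I \<rho>) (b I \<rho>)"
    have Yk: "\<forall>j<k. \<rho> j \<le> Y" using Y(3) l by (auto simp: \<rho>_def)
    have g_le: "g i \<le> Y ^ eu" if "i \<le> n I \<rho>" for i
      using u(2)[OF Y(1) Y(2)[folded I_def] Yk that] eu[OF Y(1)] unfolding g_def by (rule le_trans)
    obtain Tz rz where rz: "z I \<rho> \<le> Y ^ ez" "exec cz s Tz (s(ra := rz))" "rz l = z I \<rho>"
        "\<And>j. j < l \<Longrightarrow> rz j = \<rho> j" "Tz \<le> Y ^ ez"
      using computes_atE[where s = s, OF cz Y(1,2)] Y(3) unfolding I_def \<rho>_def by blast
    let ?Y = "Y + Y ^ ez" and ?s = "s(ra := rz)"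
    have Y': "2 \<le> ?Y" "admissible ?Y (?s ia)" "\<And>j. j < Suc l \<Longrightarrow> ?s ra j \<le> ?Y"
      using Y rz(1,3,4) admissible_mono[OF Y(2), of ?Y]
      by (auto simp: less_Suc_eq neq trans_le_add1 \<rho>_def I_def)
    have "n I rz = n I \<rho>" using l rz(4) by (intro pcomp_cong[OF n]) auto
    then obtain Tn rn where rn: "n I \<rho> \<le> ?Y ^ en" "exec cn ?s Tn (s(ra := rn))" "rn (Suc l) = n I \<rho>"
        "\<And>j. j < Suc l \<Longrightarrow> rn j = rz j" "Tn \<le> ?Y ^ en"
      using computes_atE[where s = ?s, OF cn Y'] by (auto simp: neq I_def)
    have Z: "Y \<le> Z Y" "Y ^ ez \<le> Z Y" "?Y ^ en \<le> Z Y" "Y ^ eu \<le> Z Y" by (auto simp: Z_def)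
    have ZY: "2 \<le> Z Y" "admissible (Z Y) (s ia)" "n I \<rho> \<le> Z Y"
      using Y(1) Z rn(1) admissible_mono[OF Y(2) Z(1)] by auto
    define s2 where "s2 = s(ra := rn(l + 2 := 0))"
    have e2: "exec (P 2 (Const 0)) (s(ra := rn)) (Suc (log_cost (l + 2) + log_cost 0)) s2"
      using exec.Put[of ra "Const (l + 2)" "Const 0" "s(ra := rn)"] by (simp add: P_def s2_def)
    define Inv where "Inv = (\<lambda>i s'. \<exists>r. s' = s(ra := r) \<and> (\<forall>j<l. r j = \<rho> j) \<and> r l = g i \<and>
        r (l + 1) = n I \<rho> \<and> r (l + 2) = i)"
    have "\<exists>T s'. exec (While (Sub (R 1) (R 2)) step) s2 T s' \<and> Inv (n I \<rho>) s' \<and>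
        T \<le> Suc (n I \<rho>) * (B Y + (2 * (l + 3 + (Z Y + 1)) + (Z Y + 1)) + 1)"
    proof (rule exec_while_for)
      show "Inv 0 s2"
        unfolding Inv_def s2_def g_def using rn rz by (intro exI[of _ "rn(l + 2 := 0)"]) auto
    next
      fix i s'
      assume "i \<le> n I \<rho>" "Inv i s'"
      then obtain r where r: "s' = s(ra := r)" "r (l + 1) = n I \<rho>" "r (l + 2) = i"
        unfolding Inv_def by auto
      have "rcost (Sub (R 1) (R 2)) s' \<le> 2 * (l + 3 + (Z Y + 1)) + (Z Y + 1)"
        using r ZY(3) \<open>i \<le> n I \<rho>\<close> log_cost_le[of "l + 1"] log_cost_le[of "l + 2"] log_cost_le[of "n I \<rho>"]
          log_cost_le[of i] log_cost_le[of "n I \<rho> - i"] by (simp add: R_def)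
      then show "(rval (Sub (R 1) (R 2)) s' \<noteq> 0 \<longleftrightarrow> i < n I \<rho>) \<and>
          rcost (Sub (R 1) (R 2)) s' \<le> 2 * (l + 3 + (Z Y + 1)) + (Z Y + 1)"
        using r by (simp add: R_def not_le)
    next
      fix i s'
      assume i: "i < n I \<rho>" and "Inv i s'"
      then obtain r where r: "s' = s(ra := r)" "\<And>j. j < l \<Longrightarrow> r j = \<rho> j" "r l = g i"
          "r (l + 1) = n I \<rho>" "r (l + 2) = i"
        unfolding Inv_def by auto
      have le: "s' ra j \<le> Z Y" if "j < l + 3" for j
      proof -
        have "j < l \<or> j = l \<or> j = l + 1 \<or> j = l + 2" using that by auto
        then show ?thesis
          using r Y(3) Z g_le[of i] ZY(3) i unfolding \<rho>_def by (auto intro: le_trans)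
      qed
      have adm: "admissible (Z Y) (s' ia)" using ZY(2) r(1) neq by simp
      obtain T r' where r': "exec cb s' T (s'(ra := r'))" "r' (l + 3) = body (s' ia) (s' ra)"
          "\<And>j. j < l + 3 \<Longrightarrow> r' j = s' ra j" "T \<le> Z Y ^ eb" "body (s' ia) (s' ra) \<le> Z Y ^ eb"
        using computes_atE[where s = s', OF cb ZY(1) adm le] by blast
      have "b I r = b I \<rho>" using r(2) l by (intro b_cong) auto
      then have body_eq: "body (s' ia) (s' ra) = g (Suc i)"
        using r neq by (simp add: body_def g_def I_def)
      define r1 where "r1 = r'(l := g (Suc i))"
      define r2 where "r2 = r1(l + 2 := Suc i)"
      have 1: "exec (P 0 (R 3)) (s(ra := r')) (Suc (rcost (Const (l + 0)) (s(ra := r')) + rcost (R 3) (s(ra := r')))) (s(ra := r1))"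
        using exec.Put[of ra "Const (l + 0)" "R 3" "s(ra := r')"] r'(2) body_eq
        by (simp add: P_def R_def r1_def)
      have 2: "exec (P 2 (Add (R 2) (Const 1))) (s(ra := r1))
          (Suc (rcost (Const (l + 2)) (s(ra := r1)) + rcost (Add (R 2) (Const 1)) (s(ra := r1)))) (s(ra := r2))"
        using exec.Put[of ra "Const (l + 2)" "Add (R 2) (Const 1)" "s(ra := r1)"] r'(3)[of "l + 2"] r
        by (simp add: P_def R_def r1_def r2_def)
      let ?T = "T + (Suc (rcost (Const (l + 0)) (s(ra := r')) + rcost (R 3) (s(ra := r'))) +
          Suc (rcost (Const (l + 2)) (s(ra := r1)) + rcost (Add (R 2) (Const 1)) (s(ra := r1))))"
      have "exec cb s' T (s(ra := r'))" using r'(1) r(1) by simp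
      then have "exec step s' ?T (s(ra := r2))"
        unfolding step_def using 1 2 by (intro exec.Seq)
      moreover have "Inv (Suc i) (s(ra := r2))"
        unfolding Inv_def using r r'(3) by (intro exI[of _ r2]) (auto simp: r2_def r1_def)
      moreover have "?T \<le> B Y"
      proof -
        have "g (Suc i) \<le> Z Y ^ eb" using r'(5) body_eq by simp
        moreover have "rcost (R 3) (s(ra := r')) = log_cost (l + 3) + log_cost (g (Suc i))"
          using r'(2) body_eq by (simp add: R_def)
        moreover have "r1 (l + 2) = i" using r'(3)[of "l + 2"] r by (simp add: r1_def)
        then have "rcost (Add (R 2) (Const 1)) (s(ra := r1)) =
            log_cost (l + 2) + log_cost i + log_cost 1 + log_cost (Suc i)"
          by (simp add: R_def)
        ultimately show ?thesis
          unfolding B_def rcost.simps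
          using r'(4) i ZY(3) log_cost_le[of "l + 0"] log_cost_le[of "l + 2"] log_cost_le[of "l + 3"]
            log_cost_le[of "g (Suc i)"] log_cost_le[of i] log_cost_le[of "Suc i"] log_cost_le[of 1]
          by simp
      qed
      ultimately show "\<exists>T s''. exec step s' T s'' \<and> Inv (Suc i) s'' \<and> T \<le> B Y" by blast
    qed
    then obtain T r where r: "exec (While (Sub (R 1) (R 2)) step) s2 T (s(ra := r))"
        "\<forall>j<l. r j = \<rho> j" "r l = g (n I \<rho>)"
        "T \<le> Suc (n I \<rho>) * (B Y + (2 * (l + 3 + (Z Y + 1)) + (Z Y + 1)) + 1)"
      unfolding Inv_def by auto
    have "T \<le> Suc (Z Y) * (B Y + (2 * (l + 3 + (Z Y + 1)) + (Z Y + 1)) + 1)"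
      using ZY(3) by (intro order_trans[OF r(4)] mult_right_mono) auto
    moreover have "log_cost (l + 2) + log_cost 0 \<le> l + 4"
      using log_cost_le[of "l + 2"] log_cost_le[of 0] by simp
    moreover have "exec prog s (Tz + (Tn + (Suc (log_cost (l + 2) + log_cost 0) + T))) (s(ra := r))"
      unfolding prog_def using rz(2) rn(2) e2 r(1) by (intro exec.Seq)
    moreover have "g (n I \<rho>) \<le> t Y"
      using g_le[of "n I \<rho>"] Z(4) unfolding t_def by simp
    ultimately show "rec_nat (z (s ia) (s ra)) (b (s ia) (s ra)) (n (s ia) (s ra)) \<le> t Y \<and>
      (\<exists>T r. exec prog s T (s(ra := r)) \<and> r l = rec_nat (z (s ia) (s ra)) (b (s ia) (s ra)) (n (s ia) (s ra)) \<and>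
         (\<forall>j<l. r j = s ra j) \<and> T \<le> t Y)"
      using r(2,3) rz(5) rn(5) Z unfolding I_def[symmetric] \<rho>_def[symmetric] g_def[symmetric]
      by (intro conjI exI[of _ "Tz + (Tn + (Suc (log_cost (l + 2) + log_cost 0) + T))"] exI[of _ r])
        (auto simp: t_def)
  qed
  ultimately show "\<exists>c t. poly_bdd t \<and> computes_at ia ra l (\<lambda>I \<rho>. rec_nat (z I \<rho>) (b I \<rho>) (n I \<rho>)) c t"
    by blast
qed

text \<open>The bound in \<open>computes_at\<close> limits the value as well as the time.\<close>

lemma pcomp_poly_bdd:
  assumes "pcomp ia ra k f"
  obtains e where "\<And>Y I \<rho>. 2 \<le> Y \<Longrightarrow> admissible Y I \<Longrightarrow> (\<And>j. j < k \<Longrightarrow> \<rho> j \<le> Y) \<Longrightarrow> f I \<rho> \<le> Y ^ e"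
proof -
  obtain c e where c: "computes_at ia ra k f c (\<lambda>Y. Y ^ e)" using pcompE[OF assms order_refl] .
  have "f I \<rho> \<le> Y ^ e" if "2 \<le> Y" "admissible Y I" "\<And>j. j < k \<Longrightarrow> \<rho> j \<le> Y" for Y I \<rho>
  proof -
    define s where "s = (\<lambda>_. undefined)(ia := I, ra := \<rho>)"
    have "s ia = I" "s ra = \<rho>" using pcomp_neq[OF assms] by (auto simp: s_def)
    then show ?thesis using that computes_atE[where s = s, OF c that(1)] by metis
  qed
  then show ?thesis by (rule that)
qed

lemma pcomp_sum:
  assumes n: "pcomp ia ra k n"
    and b: "\<And>l x. k \<le> l \<Longrightarrow> pcomp ia ra l x \<Longrightarrow> pcomp ia ra l (\<lambda>I \<rho>. b I \<rho> (x I \<rho>))"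
  shows "pcomp ia ra k (\<lambda>I \<rho>. \<Sum>i<n I \<rho>. b I \<rho> i)"
proof -
  have rec: "rec_nat 0 (\<lambda>i a. a + b I \<rho> i) m = (\<Sum>i<m. b I \<rho> i)" for I \<rho> m
    by (induction m) auto
  obtain en where en: "\<And>Y I \<rho>. 2 \<le> Y \<Longrightarrow> admissible Y I \<Longrightarrow> (\<And>j. j < k \<Longrightarrow> \<rho> j \<le> Y) \<Longrightarrow> n I \<rho> \<le> Y ^ en"
    using pcomp_poly_bdd[OF n] by blast
  have neq: "ia \<noteq> ra" using n by (rule pcomp_neq)
  have bk: "pcomp ia ra (Suc k) (\<lambda>I \<rho>. b I \<rho> (\<rho> k))" by (intro b pcomp_reg neq) auto
  then obtain eb where eb: "\<And>Y I \<rho>. 2 \<le> Y \<Longrightarrow> admissible Y I \<Longrightarrow> (\<And>j. j < Suc k \<Longrightarrow> \<rho> j \<le> Y) \<Longrightarrow> b I \<rho> (\<rho> k) \<le> Y ^ eb"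
    using pcomp_poly_bdd[OF bk] by blast
  have "pcomp ia ra k (\<lambda>I \<rho>. rec_nat 0 (\<lambda>i a. a + b I \<rho> i) (n I \<rho>))"
  proof (rule pcomp_rec[OF n, where u = "\<lambda>Y. Y ^ en * (Y + Y ^ en) ^ eb"])
    show "pcomp ia ra k (\<lambda>_ _. 0)" by (intro pcomp_const neq)
    show "pcomp ia ra l (\<lambda>I \<rho>. y I \<rho> + b I \<rho> (x I \<rho>))"
      if "k \<le> l" "pcomp ia ra l x" "pcomp ia ra l y" for l x y
      using that by (intro pcomp_add b)
    show "poly_bdd (\<lambda>Y. Y ^ en * (Y + Y ^ en) ^ eb)" by (intro poly_bdd_intros)
    fix I \<rho> and Y i :: nat
    assume Y: "2 \<le> Y" "admissible Y I" "\<forall>j<k. \<rho> j \<le> Y" "i \<le> n I \<rho>"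
    have i: "i \<le> Y ^ en" using en[OF Y(1,2)] Y(3,4) le_trans by blast
    have "b I \<rho> j \<le> (Y + Y ^ en) ^ eb" if "j < i" for j
    proof -
      \<comment> \<open>Overwriting register \<open>k\<close> with the index turns the bound known
        for a register argument into one for the summand \<open>j\<close>.\<close>
      have "b I (\<rho>(k := j)) j = b I \<rho> j"
        by (rule pcomp_cong[OF b[OF order_refl pcomp_const[OF neq, of k j]]]) simp
      moreover have "b I (\<rho>(k := j)) ((\<rho>(k := j)) k) \<le> (Y + Y ^ en) ^ eb"
        using Y that i admissible_mono[OF Y(2)] by (intro eb) (auto simp: less_Suc_eq trans_le_add1)
      ultimately show ?thesis by simp
    qed
    then have "(\<Sum>j<i. b I \<rho> j) \<le> (\<Sum>j<i. (Y + Y ^ en) ^ eb)" by (intro sum_mono) auto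
    also have "\<dots> \<le> Y ^ en * (Y + Y ^ en) ^ eb" using i by simp
    finally show "rec_nat 0 (\<lambda>i a. a + b I \<rho> i) i \<le> Y ^ en * (Y + Y ^ en) ^ eb"
      unfolding rec .
  qed
  then show ?thesis unfolding rec .
qed

section \<open>Tiles\<close>

definition tile_nbrs :: "nat \<Rightarrow> nat list list" where
  "tile_nbrs \<tau> = [[[6], [5, 12], [4], [11, 12, 15], [2, 5, 7, 8], [1, 4, 8], [0, 7, 9, 10], [4, 6, 8, 10], [4, 5, 7, 10], [6, 10, 13], [6, 7, 8, 9, 11], [3, 10, 12, 15], [1, 3, 11], [9, 14], [13, 15], [3, 11, 14]],
   [[6, 7], [15], [4, 7], [10, 14], [2, 5, 8, 9], [4, 9], [0, 7, 10, 11], [0, 2, 6, 8, 11], [4, 7, 9, 11, 12, 13], [4, 5, 8, 13], [3, 6, 14], [6, 7, 8, 12], [8, 11, 13, 15], [8, 9, 12], [3, 10], [1, 12]],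
   [[10, 14], [6, 13], [5], [12, 13, 15], [5, 7], [2, 4, 7], [1, 9], [4, 5, 8], [7, 9, 11], [6, 8, 11], [0, 11, 14], [8, 9, 10, 14, 15], [3, 13, 15], [1, 3, 12], [0, 10, 11, 15], [3, 11, 12, 14]],
   [[14], [8, 9], [5, 8], [13, 15], [5, 6], [2, 4, 6, 7], [4, 5, 7, 10], [5, 6, 8, 10, 11, 12], [1, 2, 7, 9, 12], [1, 8, 12, 13], [6, 7, 11], [7, 10, 12, 14], [7, 8, 9, 11], [3, 9, 15], [0, 11], [3, 13]],
   [[2, 7], [5, 8, 12], [0, 4, 7], [11, 15], [2, 5], [1, 4, 8], [9, 10], [0, 2, 8, 10], [1, 5, 7], [6, 10, 13, 14], [6, 7, 9, 15], [3, 12, 15], [1, 11], [9, 14], [9, 13, 15], [3, 10, 11, 14]],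
   [[6], [8], [4, 7], [11, 15], [2, 7, 8], [8], [0], [2, 4, 8], [1, 4, 5, 7, 12], [10, 13], [9, 11, 13, 15], [3, 10, 12], [8, 11], [9, 10, 14], [13, 15], [3, 10, 14]]] ! \<tau>"

text \<open>Indexed by tile type, state of the row and signal role, with roles as in
  \<open>tile_sol_spec\<close>. The empty lists mark the impossible roles: turning the signal done
  in a tile of type 0, or on the very digit that the tile excludes.\<close>

definition tile_sol :: "nat \<Rightarrow> nat \<Rightarrow> nat \<Rightarrow> nat list" where
  "tile_sol \<tau> x d = [
   [[[1, 3, 7, 13], [1, 4, 9, 15], []], [[3, 5, 6, 13], [4, 6, 12, 14], []], [[0, 3, 8, 13], [0, 4, 11, 13], []]],
   [[[1, 3, 9, 11], [1, 4, 8, 10], []], [[3, 6, 9, 15], [3, 7, 9, 15], [3, 7, 9, 15]], [[0, 3, 4, 12], [0, 3, 4, 12], [0, 3, 4, 12]]],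
   [[[1, 3, 4, 11], [1, 3, 5, 11], [1, 3, 5, 11]], [[3, 6, 7, 10], [5, 9, 13, 14], []], [[0, 3, 4, 9], [0, 3, 5, 9], [0, 3, 5, 9]]],
   [[[1, 3, 4, 11], [1, 3, 5, 11], [1, 3, 5, 11]], [[3, 6, 8, 14], [3, 6, 8, 14], [3, 6, 8, 14]], [[0, 3, 6, 12], [0, 5, 7, 13], []]],
   [[[1, 2, 3, 9], [0, 5, 9, 11], [0, 5, 9, 11]], [[0, 5, 9, 11], [0, 5, 9, 11], [0, 5, 9, 11]], [[0, 5, 9, 11], [0, 5, 9, 11], [0, 5, 9, 11]]],
   [[[0, 3, 8, 13], [0, 3, 8, 13], [0, 3, 8, 13]], [[0, 3, 8, 13], [0, 3, 8, 13], [0, 3, 8, 13]], [[0, 3, 8, 13], [0, 3, 8, 13], [0, 3, 8, 13]]]] ! \<tau> ! x ! d"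

text \<open>Coordinates of the vertices 4 to 15, on a square grid of mesh 4; the ports are placed
  around that square in \<open>local_pos\<close>.\<close>

definition tile_inner_pos :: "nat \<Rightarrow> (int \<times> int) list" where
  "tile_inner_pos \<tau> = [
   [(8, 0), (12, 0), (0, 4), (4, 4), (8, 4), (0, 8), (4, 8), (8, 8), (12, 8), (0, 12), (4, 12), (8, 12)],
   [(8, 0), (12, 0), (0, 4), (4, 4), (8, 4), (12, 4), (0, 8), (4, 8), (8, 8), (12, 8), (4, 12), (8, 12)],
   [(0, 0), (4, 0), (12, 0), (0, 4), (4, 4), (8, 4), (0, 8), (4, 8), (8, 8), (12, 8), (4, 12), (8, 12)],
   [(0, 0), (4, 0), (0, 4), (4, 4), (8, 4), (12, 4), (0, 8), (4, 8), (8, 8), (12, 8), (4, 12), (8, 12)],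
   [(8, 0), (12, 0), (0, 4), (4, 4), (8, 4), (0, 8), (4, 8), (8, 8), (12, 8), (0, 12), (4, 12), (8, 12)],
   [(8, 0), (12, 0), (0, 4), (4, 4), (8, 4), (0, 8), (4, 8), (8, 8), (12, 8), (0, 12), (4, 12), (8, 12)]] ! \<tau>"

text \<open>
  The vertices 0, 1, 2, 3 of a tile are its west, east, north and south port. They are the only
  ones that may be dominated by a vertex of a neighbouring tile. Tiles of type 0 test
  nothing, tiles of type 1, 2, 3 test that the digit is not 0, 1, 2, tiles of type 4 are at the
  ends of the rows, and a tile of type 5 at the bottom of a column requires the signal done.
  The tables were found by a computer search.
\<close>

definition tile_dom :: "nat \<Rightarrow> nat set \<Rightarrow> nat \<Rightarrow> bool" where
  "tile_dom \<tau> A v \<longleftrightarrow> v \<in> A \<or> (\<exists>u\<in>set (tile_nbrs \<tau> ! v). u \<in> A)"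

definition tile_valid :: "nat \<Rightarrow> nat set \<Rightarrow> bool" where
  "tile_valid \<tau> A \<longleftrightarrow> (\<forall>v\<in>{4..<16}. tile_dom \<tau> A v)"

text \<open>Both states describe the edge between two tiles, seen from its right and from its left
  end: 0 left end chosen, 1 none, 2 right end chosen. A port that nothing in its own tile dominates
  counts as if the opposite end were chosen, because only that end can still dominate it.\<close>

definition west_state :: "nat \<Rightarrow> nat set \<Rightarrow> nat" where
  "west_state \<tau> A = (if 0 \<in> A then 2 else if tile_dom \<tau> A 0 then 1 else 0)"

definition east_state :: "nat \<Rightarrow> nat set \<Rightarrow> nat" where
  "east_state \<tau> A = (if 1 \<in> A then 0 else if tile_dom \<tau> A 1 then 1 else 2)"

text \<open>A chosen south port 3 is the signal done leaving the tile; a north port dominated from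
  inside means that the tile works without done arriving. The restriction on turning done is claimed
  only if the row state does not change across the tile; the repetition of the clauses takes care of
  columns with changes.\<close>

definition tile_spec :: "nat \<Rightarrow> nat set \<Rightarrow> bool" where
  "tile_spec \<tau> A \<longleftrightarrow>
     (\<tau> < 4 \<longrightarrow> west_state \<tau> A \<le> east_state \<tau> A \<and>
        (3 \<in> A \<longrightarrow> tile_dom \<tau> A 2 \<longrightarrow> west_state \<tau> A = east_state \<tau> A \<longrightarrow>
           \<tau> \<noteq> 0 \<and> west_state \<tau> A \<noteq> \<tau> - 1)) \<and>
     (\<tau> = 5 \<longrightarrow> \<not> tile_dom \<tau> A 2)"

lemma nth_list6:
  "[a0, a1, a2, a3, a4, a5] ! 0 = a0"
  "[a0, a1, a2, a3, a4, a5] ! 1 = a1"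
  "[a0, a1, a2, a3, a4, a5] ! 2 = a2"
  "[a0, a1, a2, a3, a4, a5] ! 3 = a3"
  "[a0, a1, a2, a3, a4, a5] ! 4 = a4"
  "[a0, a1, a2, a3, a4, a5] ! 5 = a5"
  by simp_all

lemma nth_list16:
  assumes "xs = [a0, a1, a2, a3, a4, a5, a6, a7, a8, a9, a10, a11, a12, a13, a14, a15]"
  shows "xs ! 0 = a0" "xs ! 1 = a1" "xs ! 2 = a2" "xs ! 3 = a3" "xs ! 4 = a4" "xs ! 5 = a5"
    "xs ! 6 = a6" "xs ! 7 = a7" "xs ! 8 = a8" "xs ! 9 = a9" "xs ! 10 = a10" "xs ! 11 = a11"
    "xs ! 12 = a12" "xs ! 13 = a13" "xs ! 14 = a14" "xs ! 15 = a15"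
  using assms by simp_all

text \<open>Rewrite rules for single table entries, so that the finite checks by \<open>simp\<close>
  touch only the entries they need.\<close>

lemmas tile_nbrs_nth =
  nth_list16[OF tile_nbrs_def[of 0, unfolded nth_list6]]
  nth_list16[OF tile_nbrs_def[of 1, unfolded nth_list6]]
  nth_list16[OF tile_nbrs_def[of 2, unfolded nth_list6]]
  nth_list16[OF tile_nbrs_def[of 3, unfolded nth_list6]]
  nth_list16[OF tile_nbrs_def[of 4, unfolded nth_list6]]
  nth_list16[OF tile_nbrs_def[of 5, unfolded nth_list6]]

text \<open>
  \<open>U\<close> lists the vertices not yet dominated by \<open>A\<close>. Branching over the vertices that dominate
  the first of them visits every valid set with at most \<open>k\<close> further vertices, provided that
  none has fewer.
\<close>

fun tile_search :: "nat \<Rightarrow> nat \<Rightarrow> nat list \<Rightarrow> nat list \<Rightarrow> bool" where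
  "tile_search \<tau> k [] A \<longleftrightarrow> k = 0 \<and> tile_spec \<tau> (set A)"
| "tile_search \<tau> 0 (v # U) A \<longleftrightarrow> True"
| "tile_search \<tau> (Suc k) (v # U) A \<longleftrightarrow>
     list_all (\<lambda>u. tile_search \<tau> k (filter (\<lambda>w. u \<notin> set (w # tile_nbrs \<tau> ! w)) (v # U)) (u # A))
       (v # tile_nbrs \<tau> ! v)"

text \<open>Some member of the closed neighbourhood of the first undominated vertex lies in
  \<open>B\<close>, and one branch of the search adds it to \<open>A\<close>. A leaf with budget
  left makes the search fail, which is why the cardinality comes out exact.\<close>

lemma tile_search_sound:
  assumes "tile_search \<tau> k U A" "set U = {v \<in> {4..<16}. \<not> tile_dom \<tau> (set A) v}"
    "set A \<subseteq> B" "finite B" "card B \<le> card (set A) + k" "tile_valid \<tau> B"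
  shows "card B = card (set A) + k \<and> tile_spec \<tau> B"
  using assms
proof (induction \<tau> k U A rule: tile_search.induct)
  case (1 \<tau> k A)
  then show ?case by (metis add.right_neutral card_seteq tile_search.simps(1))
next
  case (2 \<tau> v U A)
  then have "B = set A" by (metis add.right_neutral card_seteq)
  moreover have "v \<in> {4..<16}" "\<not> tile_dom \<tau> (set A) v" using 2(2) by auto
  ultimately show ?case using 2(6) unfolding tile_valid_def by blast
next
  case (3 \<tau> k v U A)
  have v: "v \<in> {4..<16}" "\<not> tile_dom \<tau> (set A) v" using 3(3) by auto
  then have "tile_dom \<tau> B v" using 3(7) unfolding tile_valid_def by blast
  then obtain u where u: "u \<in> set (v # tile_nbrs \<tau> ! v)" "u \<in> B" unfolding tile_dom_def by auto
  with v have "u \<notin> set A" by (auto simp: tile_dom_def)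
  moreover have "tile_search \<tau> k (filter (\<lambda>w. u \<notin> set (w # tile_nbrs \<tau> ! w)) (v # U)) (u # A)"
    using 3(2) u(1) by (simp only: tile_search.simps list_all_iff)
  moreover have "set (filter (\<lambda>w. u \<notin> set (w # tile_nbrs \<tau> ! w)) (v # U)) =
      {v \<in> {4..<16}. \<not> tile_dom \<tau> (set (u # A)) v}"
    unfolding set_filter 3(3) by (auto simp: tile_dom_def)
  ultimately show ?case using 3(1)[OF u(1)] 3(4-7) u(2) by simp
qed

lemma tile_search_4:
  assumes "\<tau> < 6" shows "tile_search \<tau> 4 [4..<16] []"
proof -
  \<comment> \<open>Successor form of the budget, as the equations of \<open>tile_search\<close>
    match on \<open>Suc\<close>.\<close>
  have "[4..<16] = [4,5,6,7,8,9,10,11,12,13,14,15]" "4 = Suc (Suc (Suc (Suc 0)))"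
    by (simp_all add: upt_rec)
  moreover have "tile_search \<tau> (Suc (Suc (Suc (Suc 0)))) [4,5,6,7,8,9,10,11,12,13,14,15] []"
    if "\<tau> = 0 \<or> \<tau> = 1 \<or> \<tau> = 2 \<or> \<tau> = 3 \<or> \<tau> = 4 \<or> \<tau> = 5"
    using that
    by (elim disjE; simp del: One_nat_def
        add: tile_nbrs_nth tile_spec_def tile_dom_def west_state_def east_state_def)
  moreover have "\<tau> = 0 \<or> \<tau> = 1 \<or> \<tau> = 2 \<or> \<tau> = 3 \<or> \<tau> = 4 \<or> \<tau> = 5"
    using assms by presburger
  ultimately show ?thesis by metis
qed

lemma tile_spec_if_card_le_4:
  assumes "\<tau> < 6" "tile_valid \<tau> A" "finite A" "card A \<le> 4"
  shows "card A = 4" "tile_spec \<tau> A"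
proof -
  have "set [4..<16] = {v \<in> {4..<16}. \<not> tile_dom \<tau> (set []) v}"
    unfolding tile_dom_def set_upt by auto
  from tile_search_sound[OF tile_search_4[OF assms(1)] this _ assms(3) _ assms(2)] assms(4)
  show "card A = 4" "tile_spec \<tau> A" by auto
qed

text \<open>
  Requirements on a set \<open>A\<close> of vertices of a tile of type \<open>\<tau>\<close> whose row carries \<open>x\<close>. A tile of an
  inner column receives the signal done and passes it on if \<open>d = 0\<close>, it passes on undone if
  \<open>d = 1\<close>, and it turns undone into done if \<open>d = 2\<close>. In the tiles of type 4, which end the rows,
  \<open>d = 0\<close> and \<open>d = 1\<close> mean the left and the right end.
\<close>

definition tile_sol_spec :: "nat \<Rightarrow> nat \<Rightarrow> nat \<Rightarrow> nat set \<Rightarrow> bool" where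
  "tile_sol_spec \<tau> x d A \<longleftrightarrow> (let dom = tile_dom \<tau> A in
     (\<forall>v\<in>A. v < 16) \<and> card A = 4 \<and> (\<forall>v\<in>set [4,5,6,7,8,9,10,11,12,13,14,15]. dom v) \<and> dom 3 \<and>
     (\<tau> < 4 \<longrightarrow> (x = 0 \<or> dom 0) \<and> (x = 2 \<or> dom 1) \<and> (x = 0 \<longrightarrow> 1 \<in> A) \<and> (x = 2 \<longrightarrow> 0 \<in> A) \<and>
        (d = 0 \<or> dom 2) \<and> (d = 1 \<or> 3 \<in> A)) \<and>
     (\<tau> = 4 \<longrightarrow> d = 0 \<longrightarrow> dom 2 \<and> dom 0 \<and> (x = 2 \<or> dom 1) \<and> (x = 0 \<longrightarrow> 1 \<in> A)) \<and>
     (\<tau> = 4 \<longrightarrow> d = 1 \<longrightarrow> dom 2 \<and> dom 1 \<and> (x = 0 \<or> dom 0) \<and> (x = 2 \<longrightarrow> 0 \<in> A)) \<and>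
     (\<tau> = 5 \<longrightarrow> dom 0 \<and> dom 1))"

lemma tile_sol_spec:
  assumes "\<tau> < 6" "x < 3" "d < 3" "d = 2 \<Longrightarrow> \<tau> \<noteq> 0 \<and> x \<noteq> \<tau> - 1"
  shows "tile_sol_spec \<tau> x d (set (tile_sol \<tau> x d))"
proof -
  have "\<tau> = 0 \<or> \<tau> = 1 \<or> \<tau> = 2 \<or> \<tau> = 3 \<or> \<tau> = 4 \<or> \<tau> = 5" "x = 0 \<or> x = 1 \<or> x = 2" "d = 0 \<or> d = 1 \<or> d = 2"
    using assms(1-3) by presburger+
  then show ?thesis
    using assms(4) unfolding tile_sol_spec_def
    by (elim disjE; simp del: One_nat_def add: tile_nbrs_nth tile_sol_def tile_dom_def Let_def)
qed

lemma tile_sol_spec_valid: "tile_sol_spec \<tau> x d A \<Longrightarrow> A \<subseteq> {..<16} \<and> card A = 4 \<and> tile_valid \<tau> A"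
proof -
  have "{4..<16} = set [4,5,6,7,8,9,10,11,12,13,14,15::nat]" by (auto simp: numeral_eq_Suc less_Suc_eq)
  then show "tile_sol_spec \<tau> x d A \<Longrightarrow> A \<subseteq> {..<16} \<and> card A = 4 \<and> tile_valid \<tau> A"
    unfolding tile_sol_spec_def tile_valid_def Let_def by blast
qed

lemma tile_nbrs_sym:
  assumes "\<tau> < 6" "u < 16" "v \<in> set (tile_nbrs \<tau> ! u)" shows "v < 16" "v \<noteq> u" "u \<in> set (tile_nbrs \<tau> ! v)"
proof -
  let ?P = "\<lambda>\<tau> u. \<forall>v\<in>set (tile_nbrs \<tau> ! u). v < 16 \<and> v \<noteq> u \<and> u \<in> set (tile_nbrs \<tau> ! v)"
  have "\<tau> = 0 \<or> \<tau> = 1 \<or> \<tau> = 2 \<or> \<tau> = 3 \<or> \<tau> = 4 \<or> \<tau> = 5"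
    using assms(1) by presburger
  then have "\<forall>u\<in>{0,1,2,3,4,5,6,7,8,9,10,11,12,13,14,15}. ?P \<tau> u"
    by (elim disjE; simp del: One_nat_def add: tile_nbrs_nth)
  moreover have "u \<in> {0,1,2,3,4,5,6,7,8,9,10,11,12,13,14,15}" using assms(2) by (auto simp: numeral_eq_Suc less_Suc_eq)
  ultimately have "?P \<tau> u" by blast
  with assms(3) show "v < 16" "v \<noteq> u" "u \<in> set (tile_nbrs \<tau> ! v)" by blast+
qed

section \<open>Graphs built from tiles\<close>

text \<open>
  The cells form an array of \<open>Rt\<close> rows and are numbered column by column. Vertex \<open>a\<close> of the tile
  in cell \<open>c\<close> has the number \<open>16 c + a\<close>.
\<close>

definition tile_arc :: "nat \<Rightarrow> (nat \<Rightarrow> nat) \<Rightarrow> nat \<Rightarrow> nat \<Rightarrow> bool" where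
  "tile_arc Rt ty u v \<longleftrightarrow>
     (u div 16 = v div 16 \<and> v mod 16 \<in> set (tile_nbrs (ty (u div 16)) ! (u mod 16))) \<or>
     (v div 16 = u div 16 + Rt \<and> u mod 16 = 1 \<and> v mod 16 = 0) \<or>
     (v div 16 = u div 16 + 1 \<and> u mod 16 = 3 \<and> v mod 16 = 2 \<and> (v div 16) mod Rt \<noteq> 0)"

definition tile_edges :: "nat \<Rightarrow> (nat \<Rightarrow> nat) \<Rightarrow> nat \<Rightarrow> nat set set" where
  "tile_edges Rt ty n = {{u, v} | u v. u < n \<and> v < n \<and> tile_arc Rt ty u v}"

lemma edge_iff: "u < n \<Longrightarrow> v < n \<Longrightarrow> {u, v} \<in> tile_edges Rt ty n \<longleftrightarrow> tile_arc Rt ty u v \<or> tile_arc Rt ty v u"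
  unfolding tile_edges_def by (auto simp: doubleton_eq_iff)

locale tile_array =
  fixes Rt Ct :: nat and ty :: "nat \<Rightarrow> nat"
  assumes Rt: "0 < Rt" and ty: "\<And>c. ty c < 6"
begin

abbreviation "cells \<equiv> Ct * Rt"
abbreviation "nv \<equiv> 16 * cells"
abbreviation "edges \<equiv> tile_edges Rt ty nv"

lemma simple: "simple_graph {..<nv} edges"
proof -
  have "u \<noteq> v" if "tile_arc Rt ty u v" for u v
    using that tile_nbrs_sym(2)[OF ty, of "u mod 16" "v mod 16" "u div 16"] Rt
    unfolding tile_arc_def by auto
  then show ?thesis unfolding simple_graph_def tile_edges_def by auto
qed

definition part :: "nat set \<Rightarrow> nat \<Rightarrow> nat set" where
  "part S c = {a. a < 16 \<and> 16 * c + a \<in> S}"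

lemma part_bounded: "part S c \<subseteq> {..<16}" "finite (part S c)"
  unfolding part_def by auto

lemma vertex_less: "c < cells \<Longrightarrow> a < 16 \<Longrightarrow> 16 * c + a < nv"
  by linarith

lemma sum_card_part:
  assumes "S \<subseteq> {..<nv}" shows "card S = (\<Sum>c<cells. card (part S c))"
proof -
  have "S = (\<Union>c<cells. (\<lambda>a. 16 * c + a) ` part S c)"
  proof
    show "S \<subseteq> (\<Union>c<cells. (\<lambda>a. 16 * c + a) ` part S c)"
    proof
      fix v assume "v \<in> S"
      moreover then have "v < nv" using assms by auto
      ultimately show "v \<in> (\<Union>c<cells. (\<lambda>a. 16 * c + a) ` part S c)"
        by (intro UN_I[of "v div 16"] image_eqI[of _ _ "v mod 16"]) (auto simp: part_def)
    qed
  qed (auto simp: part_def)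
  also have "card \<dots> = (\<Sum>c<cells. card ((\<lambda>a. 16 * c + a) ` part S c))"
    by (rule card_UN_disjoint) (auto simp: part_bounded part_def)
  also have "\<dots> = (\<Sum>c<cells. card (part S c))"
    by (intro sum.cong refl card_image) (auto simp: inj_on_def)
  finally show ?thesis .
qed

lemma arc_iff:
  assumes "a < 16" "b < 16"
  shows "tile_arc Rt ty (16 * c + a) (16 * d + b) \<longleftrightarrow>
     (c = d \<and> b \<in> set (tile_nbrs (ty c) ! a)) \<or> (d = c + Rt \<and> a = 1 \<and> b = 0) \<or>
     (d = c + 1 \<and> a = 3 \<and> b = 2 \<and> d mod Rt \<noteq> 0)"
  using assms unfolding tile_arc_def by simp

text \<open>Domination read cell by cell, where a port may also be dominated by the facing port of
  the adjacent cell. An arbitrary family \<open>A\<close> is allowed, so the predicate serves both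
  for the parts of a given set and for a set yet to be assembled.\<close>

definition cell_dom :: "(nat \<Rightarrow> nat set) \<Rightarrow> nat \<Rightarrow> nat \<Rightarrow> bool" where
  "cell_dom A c a \<longleftrightarrow> tile_dom (ty c) (A c) a \<or>
     (a = 0 \<and> Rt \<le> c \<and> 1 \<in> A (c - Rt)) \<or>
     (a = 1 \<and> c + Rt < cells \<and> 0 \<in> A (c + Rt)) \<or>
     (a = 2 \<and> c mod Rt \<noteq> 0 \<and> 3 \<in> A (c - 1)) \<or>
     (a = 3 \<and> c + 1 < cells \<and> (c + 1) mod Rt \<noteq> 0 \<and> 2 \<in> A (c + 1))"

lemma dominated_iff:
  assumes "S \<subseteq> {..<nv}" "c < cells" "a < 16"
  shows "(16 * c + a \<in> S \<or> (\<exists>u\<in>S. {u, 16 * c + a} \<in> edges)) \<longleftrightarrow> cell_dom (part S) c a"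
proof -
  have S: "v \<in> S \<longleftrightarrow> v div 16 < cells \<and> v mod 16 \<in> part S (v div 16)" for v
    using assms(1) unfolding part_def by auto
  have arc: "{u, 16 * c + a} \<in> edges \<longleftrightarrow> tile_arc Rt ty u (16 * c + a) \<or> tile_arc Rt ty (16 * c + a) u"
    if "u \<in> S" for u
    using that assms vertex_less[OF assms(2,3)] by (intro edge_iff) auto
  have "(\<exists>u\<in>S. {u, 16 * c + a} \<in> edges) \<longleftrightarrow>
     (\<exists>d<cells. \<exists>b\<in>part S d. tile_arc Rt ty (16 * d + b) (16 * c + a) \<or> tile_arc Rt ty (16 * c + a) (16 * d + b))"
    (is "?L \<longleftrightarrow> ?R")
  proof
    assume ?L
    then obtain u where u: "u \<in> S" "tile_arc Rt ty u (16 * c + a) \<or> tile_arc Rt ty (16 * c + a) u"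
      using arc by blast
    then show ?R using S[of u] by (intro exI[of _ "u div 16"] conjI bexI[of _ "u mod 16"]) auto
  next
    assume ?R
    then obtain d b where "d < cells" "b \<in> part S d"
      "tile_arc Rt ty (16 * d + b) (16 * c + a) \<or> tile_arc Rt ty (16 * c + a) (16 * d + b)" by blast
    moreover then have "16 * d + b \<in> S" by (auto simp: part_def)
    ultimately show ?L using arc by blast
  qed
  also have "\<dots> \<longleftrightarrow> (\<exists>d<cells. \<exists>b\<in>part S d. (c = d \<and> b \<in> set (tile_nbrs (ty c) ! a)) \<or>
      (c = d + Rt \<and> b = 1 \<and> a = 0) \<or> (d = c + Rt \<and> a = 1 \<and> b = 0) \<or>
      (c = d + 1 \<and> b = 3 \<and> a = 2 \<and> c mod Rt \<noteq> 0) \<or> (d = c + 1 \<and> a = 3 \<and> b = 2 \<and> d mod Rt \<noteq> 0))"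
  proof (intro ex_cong1 conj_cong refl bex_cong)
    fix d b assume "b \<in> part S d"
    then have b: "b < 16" by (simp add: part_def)
    show "(tile_arc Rt ty (16 * d + b) (16 * c + a) \<or> tile_arc Rt ty (16 * c + a) (16 * d + b)) \<longleftrightarrow>
      ((c = d \<and> b \<in> set (tile_nbrs (ty c) ! a)) \<or>
      (c = d + Rt \<and> b = 1 \<and> a = 0) \<or> (d = c + Rt \<and> a = 1 \<and> b = 0) \<or>
      (c = d + 1 \<and> b = 3 \<and> a = 2 \<and> c mod Rt \<noteq> 0) \<or> (d = c + 1 \<and> a = 3 \<and> b = 2 \<and> d mod Rt \<noteq> 0))"
      unfolding arc_iff[OF assms(3) b] arc_iff[OF b assms(3)]
      using tile_nbrs_sym(3)[OF ty assms(3), of b c] tile_nbrs_sym(3)[OF ty b, of a c] by blast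
  qed
  also have "\<dots> \<longleftrightarrow> (\<exists>b\<in>part S c. b \<in> set (tile_nbrs (ty c) ! a)) \<or>
     (a = 0 \<and> Rt \<le> c \<and> 1 \<in> part S (c - Rt)) \<or>
     (a = 1 \<and> c + Rt < cells \<and> 0 \<in> part S (c + Rt)) \<or>
     (a = 2 \<and> c mod Rt \<noteq> 0 \<and> 3 \<in> part S (c - 1)) \<or>
     (a = 3 \<and> c + 1 < cells \<and> (c + 1) mod Rt \<noteq> 0 \<and> 2 \<in> part S (c + 1))" (is "?L \<longleftrightarrow> ?R")
  proof
    assume ?L
    then obtain d b where "d < cells" "b \<in> part S d" "(c = d \<and> b \<in> set (tile_nbrs (ty c) ! a)) \<or>
      (c = d + Rt \<and> b = 1 \<and> a = 0) \<or> (d = c + Rt \<and> a = 1 \<and> b = 0) \<or>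
      (c = d + 1 \<and> b = 3 \<and> a = 2 \<and> c mod Rt \<noteq> 0) \<or> (d = c + 1 \<and> a = 3 \<and> b = 2 \<and> d mod Rt \<noteq> 0)" by blast
    then show ?R by (elim disjE conjE; simp) blast
  next
    assume ?R
    then consider b where "b \<in> part S c" "b \<in> set (tile_nbrs (ty c) ! a)"
      | "a = 0" "Rt \<le> c" "1 \<in> part S (c - Rt)" | "a = 1" "c + Rt < cells" "0 \<in> part S (c + Rt)"
      | "a = 2" "c mod Rt \<noteq> 0" "3 \<in> part S (c - 1)"
      | "a = 3" "c + 1 < cells" "(c + 1) mod Rt \<noteq> 0" "2 \<in> part S (c + 1)" by blast
    then show ?L
    proof cases
      case 2
      then obtain d where "c = d + Rt" by (metis le_add_diff_inverse2)
      with 2 show ?thesis using assms(2) by (intro exI[of _ d] conjI bexI[of _ 1]) simp_all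
    next
      case 4
      then have "c \<noteq> 0" by (metis mod_0)
      with 4 show ?thesis using assms(2) by (intro exI[of _ "c - 1"] conjI bexI[of _ 3]) auto
    next
      case 1 then show ?thesis using assms(2) by (intro exI[of _ c] conjI bexI[of _ b]) auto
    next
      case 3 then show ?thesis by (intro exI[of _ "c + Rt"] conjI bexI[of _ 0]) auto
    next
      case 5 then show ?thesis by (intro exI[of _ "c + 1"] conjI bexI[of _ 2]) auto
    qed
  qed
  finally have "(\<exists>u\<in>S. {u, 16 * c + a} \<in> edges) \<longleftrightarrow> (\<exists>b\<in>part S c. b \<in> set (tile_nbrs (ty c) ! a)) \<or>
     (a = 0 \<and> Rt \<le> c \<and> 1 \<in> part S (c - Rt)) \<or>
     (a = 1 \<and> c + Rt < cells \<and> 0 \<in> part S (c + Rt)) \<or>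
     (a = 2 \<and> c mod Rt \<noteq> 0 \<and> 3 \<in> part S (c - 1)) \<or>
     (a = 3 \<and> c + 1 < cells \<and> (c + 1) mod Rt \<noteq> 0 \<and> 2 \<in> part S (c + 1))" .
  moreover have "16 * c + a \<in> S \<longleftrightarrow> a \<in> part S c" using assms(3) by (simp add: part_def)
  ultimately show ?thesis unfolding cell_dom_def tile_dom_def by blast
qed

lemma dominating_iff:
  "dominating_set {..<nv} edges S \<longleftrightarrow>
     S \<subseteq> {..<nv} \<and> (\<forall>c<cells. \<forall>a<16. cell_dom (part S) c a)"
proof (cases "S \<subseteq> {..<nv}")
  case True
  have "(\<forall>v\<in>{..<nv}. P v) \<longleftrightarrow> (\<forall>c<cells. \<forall>a<16. P (16 * c + a))" for P
  proof safe
    fix v assume P: "\<forall>c<cells. \<forall>a<16. P (16 * c + a)" "v < nv"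
    have "v div 16 < cells" using P(2) by (intro less_mult_imp_div_less) (simp add: mult.commute)
    then have "P (16 * (v div 16) + v mod 16)" by (intro P(1)[rule_format]) simp_all
    then show "P v" unfolding mult_div_mod_eq .
  next
    fix c a assume "\<forall>v\<in>{..<nv}. P v" "c < cells" "a < (16::nat)"
    then show "P (16 * c + a)" using vertex_less by blast
  qed
  then show ?thesis unfolding dominating_set_def using dominated_iff[OF True] True by auto
qed (auto simp: dominating_set_def)

text \<open>Only ports have neighbours in other cells, so each part dominates the inner vertices of
  its tile unaided and has at least 4 elements. The total \<open>4 * cells\<close> then forces
  exactly 4 everywhere, which is the situation covered by
  \<open>tile_spec_if_card_le_4\<close>.\<close>

lemma ex_dominating_set_iff:
  "(\<exists>S. dominating_set {..<nv} edges S \<and> card S = 4 * cells) \<longleftrightarrow>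
   (\<exists>A. (\<forall>c<cells. A c \<subseteq> {..<16} \<and> card (A c) = 4 \<and> tile_spec (ty c) (A c) \<and>
       (\<forall>a<16. cell_dom A c a)))" (is "?L \<longleftrightarrow> ?R")
proof
  assume ?L
  then obtain S where S: "S \<subseteq> {..<nv}" "\<And>c a. c < cells \<Longrightarrow> a < 16 \<Longrightarrow> cell_dom (part S) c a" "card S = 4 * cells"
    unfolding dominating_iff by auto
  have valid: "tile_valid (ty c) (part S c)" if "c < cells" for c
    unfolding tile_valid_def
  proof
    fix a :: nat assume "a \<in> {4..<16}"
    then show "tile_dom (ty c) (part S c) a" using S(2)[OF that, of a] by (auto simp: cell_dom_def)
  qed
  have ge: "4 \<le> card (part S c)" if "c < cells" for c
    using tile_spec_if_card_le_4(1)[OF ty valid[OF that] part_bounded(2)] by linarith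
  have "(\<Sum>c<cells. card (part S c)) = (\<Sum>c<cells. 4)"
    using S(3) sum_card_part[OF S(1)] by simp
  then have eq: "card (part S c) = 4" if "c < cells" for c
    using sum_mono_inv[of "\<lambda>_. 4" "{..<cells}" "\<lambda>c. card (part S c)" c] ge that by auto
  show ?R
    using part_bounded S(2) eq tile_spec_if_card_le_4(2)[OF ty valid] by (intro exI[of _ "part S"]) auto
next
  assume ?R
  then obtain A where A: "\<And>c. c < cells \<Longrightarrow> A c \<subseteq> {..<16} \<and> card (A c) = 4"
      "\<And>c a. c < cells \<Longrightarrow> a < 16 \<Longrightarrow> cell_dom A c a" by blast
  define S where "S = {v. v < nv \<and> v mod 16 \<in> A (v div 16)}"
  have part: "part S c = A c" if "c < cells" for c
    using A(1)[OF that] vertex_less[OF that] unfolding part_def S_def by auto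
  have "cell_dom (part S) c a" if "c < cells" "a < 16" for c a
  proof -
    \<comment> \<open>Outside the array \<open>A\<close> is arbitrary, so the cells to the left and
      above must be known to exist before \<open>part\<close> may replace \<open>A\<close>.\<close>
    have "c - Rt < cells" "c - 1 < cells" using that by auto
    then show ?thesis using A(2)[OF that] part that unfolding cell_dom_def by (auto simp: part)
  qed
  moreover have S: "S \<subseteq> {..<nv}" by (auto simp: S_def)
  moreover have "card S = 4 * cells"
    unfolding sum_card_part[OF S] using A(1) part by simp
  ultimately show ?L unfolding dominating_iff by blast
qed

end

section \<open>Straight-line drawings\<close>

text \<open>The functional \<open>L\<close> puts the first segment below the second one except at a
  shared endpoint \<open>w\<close>. A common point then has \<open>L\<close>-value both at most and
  at least that of \<open>w\<close>, and on the first segment only \<open>w\<close> attains it. The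
  case \<open>v1 = v2\<close> lets a single vertex act as second segment.\<close>

lemma closed_segments_meet:
  fixes p :: "'a \<Rightarrow> complex" and \<alpha> \<beta> :: real
  defines "L \<equiv> \<lambda>z. \<alpha> * Re z + \<beta> * Im z"
  assumes sep: "\<And>u v. u \<in> {u1, u2} \<Longrightarrow> v \<in> {v1, v2} \<Longrightarrow> u = v \<or> L (p u) < L (p v)"
    and ne: "v1 \<noteq> v2 \<or> {u1, u2} \<inter> {v1, v2} = {}" "{u1, u2} \<noteq> {v1, v2}" "u1 \<noteq> u2"
    and z: "z \<in> closed_segment (p u1) (p u2)" "z \<in> closed_segment (p v1) (p v2)"
  shows "z \<in> p ` ({u1, u2} \<inter> {v1, v2})"
proof -
  obtain s where s: "0 \<le> s" "s \<le> 1" "z = (1 - s) *\<^sub>R p u1 + s *\<^sub>R p u2"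
    using z(1) unfolding in_segment by blast
  obtain t where t: "0 \<le> t" "t \<le> 1" "z = (1 - t) *\<^sub>R p v1 + t *\<^sub>R p v2"
    using z(2) unfolding in_segment by blast
  have Ls: "L z = (1 - s) * L (p u1) + s * L (p u2)"
    unfolding s(3) L_def by (simp add: algebra_simps)
  have Lt: "L z = (1 - t) * L (p v1) + t * L (p v2)"
    unfolding t(3) L_def by (simp add: algebra_simps)
  show ?thesis
  proof (cases "{u1, u2} \<inter> {v1, v2} = {}")
    case True
    then have lt: "L (p u) < L (p v)" if "u \<in> {u1, u2}" "v \<in> {v1, v2}" for u v using sep that by blast
    define M where "M = max (L (p u1)) (L (p u2))"
    have "(1 - s) * L (p u1) + s * L (p u2) \<le> (1 - s) * M + s * M"
      using s by (intro add_mono mult_left_mono) (auto simp: M_def)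
    moreover have "(1 - t) * M + t * M < (1 - t) * L (p v1) + t * L (p v2)"
    proof (cases "t = 0")
      case False
      then show ?thesis using lt t
        by (intro add_le_less_mono mult_left_mono mult_strict_left_mono) (auto simp: M_def intro: less_imp_le)
    qed (use lt in \<open>auto simp: M_def\<close>)
    ultimately have "L z < L z" using Ls Lt by (simp add: algebra_simps)
    then show ?thesis by simp
  next
    case False
    then obtain w where w: "w \<in> {u1, u2}" "w \<in> {v1, v2}" by blast
    \<comment> \<open>The other end of the first segment lies strictly below \<open>w\<close>, so
      moving away from \<open>p w\<close> strictly decreases \<open>L\<close>.\<close>
    have zw: "z = p w \<or> L z < L (p w)"
    proof (cases "w = u1")
      case True
      then have "L (p u2) < L (p w)" using sep[of u2 w] w ne by auto
      then have "s = 0 \<or> s * L (p u2) < s * L (p w)" using s by (simp add: mult_less_cancel_left)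
      then show ?thesis
      proof
        assume "s = 0" then show ?thesis using s(3) True by simp
      next
        assume "s * L (p u2) < s * L (p w)"
        then have "L z < L (p w)" unfolding Ls True left_diff_distrib by linarith
        then show ?thesis ..
      qed
    next
      case False
      then have eq: "w = u2" using w by auto
      then have "L (p u1) < L (p w)" using sep[of u1 w] w ne by auto
      then have "s = 1 \<or> (1 - s) * L (p u1) < (1 - s) * L (p w)" using s by (simp add: mult_less_cancel_left)
      then show ?thesis
      proof
        assume "s = 1" then show ?thesis using s(3) eq by simp
      next
        assume "(1 - s) * L (p u1) < (1 - s) * L (p w)"
        then have "L z < L (p w)" unfolding Ls eq left_diff_distrib by linarith
        then show ?thesis ..
      qed
    qed
    have v: "L (p w) \<le> L (p v1)" "L (p w) \<le> L (p v2)" using sep[of w v1] sep[of w v2] w by auto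
    have "(1 - t) * L (p w) + t * L (p w) \<le> (1 - t) * L (p v1) + t * L (p v2)"
      using t v by (intro add_mono mult_left_mono) auto
    then have "L (p w) \<le> L z" using Lt by (simp add: algebra_simps)
    then show ?thesis using zw w by auto
  qed
qed

text \<open>Turns planarity into linear inequalities between integers, which can be decided tile by
  tile.\<close>

lemma planar_straight_line:
  fixes x y :: "'a \<Rightarrow> int"
  assumes G: "simple_graph V E"
    and inj: "inj_on (\<lambda>v. (x v, y v)) V"
    and edges: "\<And>e f. e \<in> E \<Longrightarrow> f \<in> E \<Longrightarrow> e \<noteq> f \<Longrightarrow>
        \<exists>\<alpha> \<beta>. \<forall>u\<in>e. \<forall>v\<in>f. u = v \<or> \<alpha> * x u + \<beta> * y u < \<alpha> * x v + \<beta> * y v"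
    and vertices: "\<And>e w. e \<in> E \<Longrightarrow> w \<in> V \<Longrightarrow> w \<notin> e \<Longrightarrow>
        \<exists>\<alpha> \<beta>. \<forall>u\<in>e. \<alpha> * x u + \<beta> * y u < \<alpha> * x w + \<beta> * y w"
  shows "planar V E"
proof -
  define p where "p = (\<lambda>v. Complex (x v) (y v))"
  have "\<exists>u v. e = {u, v} \<and> u \<noteq> v" if "e \<in> E" for e
    using G that unfolding simple_graph_def card_2_iff by metis
  then obtain a b where ab: "\<And>e. e \<in> E \<Longrightarrow> e = {a e, b e} \<and> a e \<noteq> b e" by metis
  have V: "a e \<in> V" "b e \<in> V" if "e \<in> E" for e
    using G ab[OF that] that unfolding simple_graph_def by blast+
  have injp: "inj_on p V" using inj unfolding p_def inj_on_def by auto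
  define \<gamma> where "\<gamma> = (\<lambda>e. linepath (p (a e)) (p (b e)))"
  have L: "real_of_int \<alpha> * Re (p u) + real_of_int \<beta> * Im (p u) < real_of_int \<alpha> * Re (p v) + real_of_int \<beta> * Im (p v)
      \<longleftrightarrow> \<alpha> * x u + \<beta> * y u < \<alpha> * x v + \<beta> * y v" for \<alpha> \<beta> u v
    unfolding p_def by (simp flip: of_int_mult of_int_add)
  show ?thesis unfolding planar_def
  proof (intro exI[of _ p] exI[of _ \<gamma>] conjI ballI impI)
    show "inj_on p V" by fact
  next
    fix e assume e: "e \<in> E"
    show "arc (\<gamma> e)"
      unfolding \<gamma>_def using ab[OF e] V[OF e] injp by (intro arc_linepath) (auto dest: inj_onD)
    show "{pathstart (\<gamma> e), pathfinish (\<gamma> e)} = p ` e"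
      using ab[OF e] unfolding \<gamma>_def by simp (metis image_empty image_insert)
  next
    fix e w assume e: "e \<in> E" and w: "w \<in> V" "p w \<in> path_image (\<gamma> e)"
    show "w \<in> e"
    proof (rule ccontr)
      assume "w \<notin> e"
      then obtain \<alpha> \<beta> where "\<forall>u\<in>e. \<alpha> * x u + \<beta> * y u < \<alpha> * x w + \<beta> * y w" using vertices e w by blast
      moreover have "w \<noteq> a e" "w \<noteq> b e" using \<open>w \<notin> e\<close> ab[OF e] by auto
      ultimately have "p w \<in> p ` ({a e, b e} \<inter> {w, w})"
        using ab[OF e] w(2) unfolding \<gamma>_def
        by (intro closed_segments_meet[where \<alpha> = \<alpha> and \<beta> = \<beta>]) (auto simp: L)
      then show False using \<open>w \<noteq> a e\<close> \<open>w \<noteq> b e\<close> by auto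
    qed
  next
    fix e f assume ef: "e \<in> E" "f \<in> E" "e \<noteq> f"
    then obtain \<alpha> \<beta> where sep: "\<forall>u\<in>e. \<forall>v\<in>f. u = v \<or> \<alpha> * x u + \<beta> * y u < \<alpha> * x v + \<beta> * y v"
      using edges by blast
    show "path_image (\<gamma> e) \<inter> path_image (\<gamma> f) \<subseteq> p ` (e \<inter> f)"
    proof
      fix z assume "z \<in> path_image (\<gamma> e) \<inter> path_image (\<gamma> f)"
      then have "z \<in> p ` ({a e, b e} \<inter> {a f, b f})"
        using ab[OF ef(1)] ab[OF ef(2)] ef(3) sep unfolding \<gamma>_def path_image_linepath
        by (intro closed_segments_meet[where \<alpha> = \<alpha> and \<beta> = \<beta>]) (auto simp: L)
      then show "z \<in> p ` (e \<inter> f)" using ab[OF ef(1)] ab[OF ef(2)] by simp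
    qed
  qed
qed

text \<open>
  In the local drawing of a tile, 16 and 17 stand for the west port of the tile to the right and
  for the north port of the tile below.
\<close>

definition local_pos :: "nat \<Rightarrow> nat \<Rightarrow> int \<times> int" where
  "local_pos \<tau> a = ([(-8, 2), (24, -2), (5, -8), (9, 16)] @ tile_inner_pos \<tau> @ [(32, 2), (5, 32)]) ! a"

text \<open>Inner edges are listed once, from the smaller end. A link between tiles belongs to the
  tile at its left or upper end, so every edge of the array is drawn by one tile.\<close>

definition local_edges :: "nat \<Rightarrow> (nat \<times> nat) list" where
  "local_edges \<tau> = concat (map (\<lambda>a. map (Pair a) (filter ((<) a) (tile_nbrs \<tau> ! a)))
     [0,1,2,3,4,5,6,7,8,9,10,11,12,13,14,15]) @ [(1, 16), (3, 17)]"

definition local_point :: "nat \<Rightarrow> nat \<Rightarrow> nat \<times> int \<times> int" where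
  "local_point \<tau> a = (a, local_pos \<tau> a)"

text \<open>Equality is decided on labels, not on coordinates. Nested conditionals here and below
  let \<open>simp\<close> settle one comparison at a time and skip the rest.\<close>

fun point_less :: "int \<Rightarrow> int \<Rightarrow> nat \<times> int \<times> int \<Rightarrow> nat \<times> int \<times> int \<Rightarrow> bool" where
  "point_less \<alpha> \<beta> (a, x, y) (b, x', y') \<longleftrightarrow> (if a = b then True else \<alpha> * x + \<beta> * y < \<alpha> * x' + \<beta> * y')"

fun segment_less :: "int \<Rightarrow> int \<Rightarrow> (nat \<times> int \<times> int) \<times> (nat \<times> int \<times> int) \<Rightarrow>
    (nat \<times> int \<times> int) \<times> (nat \<times> int \<times> int) \<Rightarrow> bool" where
  "segment_less \<alpha> \<beta> (P, Q) (P', Q') \<longleftrightarrow>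
     (if point_less \<alpha> \<beta> P P' then if point_less \<alpha> \<beta> P Q' then
      if point_less \<alpha> \<beta> Q P' then point_less \<alpha> \<beta> Q Q' else False else False else False)"

fun segments_separated :: "(int \<times> int) list \<Rightarrow> (nat \<times> int \<times> int) \<times> (nat \<times> int \<times> int) \<Rightarrow>
    (nat \<times> int \<times> int) \<times> (nat \<times> int \<times> int) \<Rightarrow> bool" where
  "segments_separated [] e f \<longleftrightarrow> False"
| "segments_separated ((\<alpha>, \<beta>) # cs) e f \<longleftrightarrow>
     (if segment_less \<alpha> \<beta> e f then True else if segment_less \<alpha> \<beta> f e then True
      else segments_separated cs e f)"

text \<open>
  A finite set of directions, found by computer search, that suffices to separate any two edges of
  a tile by a line (through the common endpoint, if there is one).
\<close>

definition separators :: "(int \<times> int) list" where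
  "separators = [(25, 13), (11, -13), (11, -1), (7, 17), (6, -25), (17, -3), (16, 17), (3, 13),
     (1, -24), (19, -21), (13, -16)]"

lemma segments_separatedD:
  assumes "segments_separated cs ((a1, P1), (a2, P2)) ((b1, Q1), (b2, Q2))"
  shows "\<exists>\<alpha> \<beta>. (\<forall>(a, x, y)\<in>{(a1, P1), (a2, P2)}. \<forall>(b, x', y')\<in>{(b1, Q1), (b2, Q2)}.
    a = b \<or> \<alpha> * x + \<beta> * y < \<alpha> * x' + \<beta> * y')"
  using assms
proof (induction cs)
  case (Cons c cs)
  obtain \<alpha> \<beta> where c: "c = (\<alpha>, \<beta>)" by force
  obtain x1 y1 x2 y2 x3 y3 x4 y4 where P: "P1 = (x1, y1)" "P2 = (x2, y2)" "Q1 = (x3, y3)" "Q2 = (x4, y4)"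
    by (metis surj_pair)
  consider "segment_less \<alpha> \<beta> ((a1, P1), (a2, P2)) ((b1, Q1), (b2, Q2))"
    | "segment_less \<alpha> \<beta> ((b1, Q1), (b2, Q2)) ((a1, P1), (a2, P2))"
    | "segments_separated cs ((a1, P1), (a2, P2)) ((b1, Q1), (b2, Q2))"
    using Cons.prems unfolding c by (auto split: if_splits)
  then show ?case
  proof cases
    case 1
    then show ?thesis unfolding P by (intro exI[of _ \<alpha>] exI[of _ \<beta>]) (auto split: if_splits)
  next
    case 2
    \<comment> \<open>Separation in the opposite order is separation by the negated
      direction.\<close>
    then show ?thesis unfolding P by (intro exI[of _ "- \<alpha>"] exI[of _ "- \<beta>"]) (auto split: if_splits)
  next
    case 3
    then show ?thesis by (rule Cons.IH)
  qed
qed simp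

lemma sorted_wrt_distinct_elems:
  "sorted_wrt P xs \<Longrightarrow> x \<in> set xs \<Longrightarrow> y \<in> set xs \<Longrightarrow> x \<noteq> y \<Longrightarrow> P x y \<or> P y x"
  by (induction xs) auto

definition local_segment :: "nat \<Rightarrow> nat \<times> nat \<Rightarrow> (nat \<times> int \<times> int) \<times> (nat \<times> int \<times> int)" where
  "local_segment \<tau> e = (local_point \<tau> (fst e), local_point \<tau> (snd e))"

text \<open>Everything lies in the box from 0 to 24 horizontally and from -2 to 16 vertically,
  except for the west and north ports and the two borrowed vertices, which stick out at points
  common to all tile types.\<close>

fun in_tile_box :: "nat \<Rightarrow> int \<times> int \<Rightarrow> bool" where
  "in_tile_box a (x, y) \<longleftrightarrow>
     (if a = 16 then x = 32 \<and> y = 2 else x \<le> 24) \<and> (if a = 0 then x = -8 \<and> y = 2 else 0 \<le> x) \<and>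
     (if a = 17 then x = 5 \<and> y = 32 else y \<le> 16) \<and> (if a = 2 then x = 5 \<and> y = -8 else -2 \<le> y)"

definition local_drawing_ok :: "nat \<Rightarrow> bool" where
  "local_drawing_ok \<tau> \<longleftrightarrow>
     sorted_wrt (segments_separated separators) (map (local_segment \<tau>) (local_edges \<tau>)) \<and>
     (\<forall>v\<in>set [0,1,2,3,4,5,6,7,8,9,10,11,12,13,14,15]. tile_nbrs \<tau> ! v \<noteq> []) \<and>
     (\<forall>a\<in>set [0,1,2,3,4,5,6,7,8,9,10,11,12,13,14,15,16,17]. in_tile_box a (local_pos \<tau> a)) \<and>
     distinct (map (local_pos \<tau>) [0,1,2,3,4,5,6,7,8,9,10,11,12,13,14,15])"

lemma local_drawing_ok:
  assumes "\<tau> < 6" shows "local_drawing_ok \<tau>"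
proof -
  have "\<tau> = 0 \<or> \<tau> = 1 \<or> \<tau> = 2 \<or> \<tau> = 3 \<or> \<tau> = 4 \<or> \<tau> = 5"
    using assms by presburger
  then show ?thesis unfolding local_drawing_ok_def
    by (elim disjE; simp del: One_nat_def add: local_edges_def tile_nbrs_nth local_point_def local_pos_def
        tile_inner_pos_def separators_def local_segment_def)
qed

lemma set_vertices: "set [0,1,2,3,4,5,6,7,8,9,10,11,12,13,14,15::nat] = {..<16}"
  by (auto simp: numeral_eq_Suc less_Suc_eq)

lemma local_edges_iff:
  "(a, b) \<in> set (local_edges \<tau>) \<longleftrightarrow>
     (a < 16 \<and> a < b \<and> b \<in> set (tile_nbrs \<tau> ! a)) \<or> (a, b) = (1, 16) \<or> (a, b) = (3, 17)"
  unfolding local_edges_def set_append set_concat set_map set_vertices by auto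

lemma local_pos_bounds:
  assumes "\<tau> < 6" "a < 18" shows "in_tile_box a (local_pos \<tau> a)"
proof -
  have "a \<in> set [0,1,2,3,4,5,6,7,8,9,10,11,12,13,14,15,16,17]"
    using assms(2) by (auto simp: numeral_eq_Suc less_Suc_eq)
  then show ?thesis using local_drawing_ok[OF assms(1)] unfolding local_drawing_ok_def by blast
qed

lemma local_pos_inj:
  assumes "\<tau> < 6" "a < 16" "b < 16" "local_pos \<tau> a = local_pos \<tau> b" shows "a = b"
proof -
  have "inj_on (local_pos \<tau>) {..<16}"
    using local_drawing_ok[OF assms(1)] unfolding local_drawing_ok_def distinct_map set_vertices by blast
  then show ?thesis using assms by (auto dest: inj_onD)
qed

lemma local_edges_separated:
  assumes "\<tau> < 6" "(a1, a2) \<in> set (local_edges \<tau>)" "(b1, b2) \<in> set (local_edges \<tau>)" "(a1, a2) \<noteq> (b1, b2)"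
  shows "\<exists>\<alpha> \<beta>. \<forall>a\<in>{a1, a2}. \<forall>b\<in>{b1, b2}. a = b \<or>
    \<alpha> * fst (local_pos \<tau> a) + \<beta> * snd (local_pos \<tau> a) < \<alpha> * fst (local_pos \<tau> b) + \<beta> * snd (local_pos \<tau> b)"
proof -
  let ?ls = "local_segment \<tau>"
  have *: "\<exists>\<alpha> \<beta>. \<forall>a\<in>{a1, a2}. \<forall>b\<in>{b1, b2}. a = b \<or>
    \<alpha> * fst (local_pos \<tau> a) + \<beta> * snd (local_pos \<tau> a) < \<alpha> * fst (local_pos \<tau> b) + \<beta> * snd (local_pos \<tau> b)"
    if "segments_separated separators (?ls (a1, a2)) (?ls (b1, b2))" for a1 a2 b1 b2
    using segments_separatedD[OF that[unfolded local_segment_def fst_conv snd_conv local_point_def]]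
    by (auto simp: case_prod_beta)
  have "?ls (a1, a2) \<noteq> ?ls (b1, b2)" using assms(4) by (auto simp: local_segment_def local_point_def)
  with sorted_wrt_distinct_elems[OF local_drawing_ok[OF assms(1), unfolded local_drawing_ok_def, THEN conjunct1], of "?ls (a1, a2)" "?ls (b1, b2)"] assms(2,3)
  consider "segments_separated separators (?ls (a1, a2)) (?ls (b1, b2))"
    | "segments_separated separators (?ls (b1, b2)) (?ls (a1, a2))" by auto
  then show ?thesis
  proof cases
    case 1
    then show ?thesis by (rule *)
  next
    case 2
    obtain \<alpha> \<beta> where ab: "\<forall>a\<in>{b1, b2}. \<forall>b\<in>{a1, a2}. a = b \<or>
      \<alpha> * fst (local_pos \<tau> a) + \<beta> * snd (local_pos \<tau> a) < \<alpha> * fst (local_pos \<tau> b) + \<beta> * snd (local_pos \<tau> b)"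
      using *[OF 2] by blast
    show ?thesis by (rule exI[of _ "- \<alpha>"], rule exI[of _ "- \<beta>"]) (use ab in auto)
  qed
qed

text \<open>No vertex of a tile is isolated, so \<open>v\<close> is an end of some edge, and the
  line separating that edge from the given one keeps \<open>v\<close> strictly on its side.\<close>

lemma local_vertices_separated:
  assumes "\<tau> < 6" "(a1, a2) \<in> set (local_edges \<tau>)" "v < 16" "v \<notin> {a1, a2}"
  shows "\<exists>\<alpha> \<beta>. \<forall>a\<in>{a1, a2}.
    \<alpha> * fst (local_pos \<tau> a) + \<beta> * snd (local_pos \<tau> a) < \<alpha> * fst (local_pos \<tau> v) + \<beta> * snd (local_pos \<tau> v)"
proof -
  have "tile_nbrs \<tau> ! v \<noteq> []"
    using local_drawing_ok[OF assms(1)] assms(3) unfolding local_drawing_ok_def set_vertices by blast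
  then obtain w where w: "w \<in> set (tile_nbrs \<tau> ! v)" using hd_in_set by blast
  note sym = tile_nbrs_sym[OF assms(1,3) w]
  define b1 b2 where "b1 = min v w" "b2 = max v w"
  have "(b1, b2) \<in> set (local_edges \<tau>)"
    using w sym assms(3) unfolding local_edges_iff b1_b2_def by (cases "v < w") (auto simp: min_def max_def)
  moreover have v: "v \<in> {b1, b2}" unfolding b1_b2_def by (auto simp: min_def max_def)
  then have "(a1, a2) \<noteq> (b1, b2)" using assms(4) by auto
  ultimately obtain \<alpha> \<beta> where "\<forall>a\<in>{a1, a2}. \<forall>b\<in>{b1, b2}. a = b \<or>
      \<alpha> * fst (local_pos \<tau> a) + \<beta> * snd (local_pos \<tau> a) < \<alpha> * fst (local_pos \<tau> b) + \<beta> * snd (local_pos \<tau> b)"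
    using local_edges_separated[OF assms(1,2)] by blast
  with v assms(4) show ?thesis by metis
qed

section \<open>Gluing the local drawings into a drawing of the array\<close>

context tile_array
begin

definition vtx :: "nat \<Rightarrow> nat \<Rightarrow> nat" where
  "vtx c a = (if a < 16 then 16 * c + a else if a = 16 then 16 * (c + Rt) else 16 * (c + 1) + 2)"

definition present :: "nat \<Rightarrow> nat \<Rightarrow> bool" where
  "present c a \<longleftrightarrow> a < 17 \<or> (a = 17 \<and> (c + 1) mod Rt \<noteq> 0)"

definition pos_x :: "nat \<Rightarrow> int" where
  "pos_x v = 40 * int (v div 16 div Rt) + fst (local_pos (ty (v div 16)) (v mod 16))"

definition pos_y :: "nat \<Rightarrow> int" where
  "pos_y v = 40 * int (v div 16 mod Rt) + snd (local_pos (ty (v div 16)) (v mod 16))"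

lemma local_pos_ports:
  assumes "\<tau> < 6"
  shows "local_pos \<tau> 0 = (-8, 2)" "local_pos \<tau> 2 = (5, -8)" "local_pos \<tau> 16 = (32, 2)" "local_pos \<tau> 17 = (5, 32)"
proof -
  have *: "(a = 0 \<longrightarrow> z = (-8, 2)) \<and> (a = 2 \<longrightarrow> z = (5, -8)) \<and> (a = 16 \<longrightarrow> z = (32, 2)) \<and> (a = 17 \<longrightarrow> z = (5, 32))"
    if "in_tile_box a z" for a z
    using that by (cases z) (auto split: if_splits)
  from *[OF local_pos_bounds[OF assms, of 0]] *[OF local_pos_bounds[OF assms, of 2]]
    *[OF local_pos_bounds[OF assms, of 16]] *[OF local_pos_bounds[OF assms, of 17]]
  show "local_pos \<tau> 0 = (-8, 2)" "local_pos \<tau> 2 = (5, -8)" "local_pos \<tau> 16 = (32, 2)" "local_pos \<tau> 17 = (5, 32)"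
    by simp_all
qed

text \<open>Cells have pitch 40, and a borrowed port sits exactly where its own tile draws it: 32 =
  40 - 8 in both directions.\<close>

lemma pos_vtx:
  assumes "present c a"
  shows "pos_x (vtx c a) = 40 * int (c div Rt) + fst (local_pos (ty c) a)"
    "pos_y (vtx c a) = 40 * int (c mod Rt) + snd (local_pos (ty c) a)"
proof -
  consider "a < 16" | "a = 16" | "a = 17" "(c + 1) mod Rt \<noteq> 0"
    using assms unfolding present_def by linarith
  then have "pos_x (vtx c a) = 40 * int (c div Rt) + fst (local_pos (ty c) a) \<and>
    pos_y (vtx c a) = 40 * int (c mod Rt) + snd (local_pos (ty c) a)"
  proof cases
    case 1
    then show ?thesis by (simp add: vtx_def pos_x_def pos_y_def)
  next
    case 2
    then show ?thesis using Rt by (simp add: vtx_def pos_x_def pos_y_def local_pos_ports[OF ty])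
  next
    case 3
    have "vtx c a = 16 * (c + 1) + 2" using 3(1) by (simp add: vtx_def)
    then have v: "vtx c a div 16 = c + 1" "vtx c a mod 16 = 2" by presburger+
    have "(c + 1) div Rt = c div Rt" "(c + 1) mod Rt = c mod Rt + 1"
      using 3(2) by (auto simp: div_Suc mod_Suc split: if_splits)
    then show ?thesis unfolding pos_x_def pos_y_def v using 3(1)
      by (simp add: local_pos_ports[OF ty])
  qed
  then show "pos_x (vtx c a) = 40 * int (c div Rt) + fst (local_pos (ty c) a)"
    "pos_y (vtx c a) = 40 * int (c mod Rt) + snd (local_pos (ty c) a)" by auto
qed

text \<open>The boxes of different cells are disjoint, and a port sticking out reaches another
  cell's drawing only where both draw the same vertex. Hence one direction separates all labels of
  two cells at once.\<close>

lemma cells_separated_less: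
  assumes "c < d"
  shows "\<exists>\<alpha> \<beta>. \<forall>a b. present c a \<longrightarrow> present d b \<longrightarrow> vtx c a = vtx d b \<or>
    \<alpha> * pos_x (vtx c a) + \<beta> * pos_y (vtx c a) < \<alpha> * pos_x (vtx d b) + \<beta> * pos_y (vtx d b)"
proof -
  define jc ic jd id where "jc = int (c div Rt)" "ic = int (c mod Rt)" "jd = int (d div Rt)" "id = int (d mod Rt)"
  note defs = this
  have cd: "c = c div Rt * Rt + c mod Rt" "d = d div Rt * Rt + d mod Rt" by simp_all
  have le: "jc \<le> jd" unfolding defs using assms by (simp add: div_le_mono)
  have lt: "ic < id" if "jc = jd"
  proof -
    have "c div Rt = d div Rt" using that unfolding defs by simp
    then show ?thesis using assms cd unfolding defs by (metis nat_add_left_cancel_less of_nat_less_iff)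
  qed
  have *: "\<exists>x y x' y'.
     pos_x (vtx c a) = 40 * jc + x \<and> pos_y (vtx c a) = 40 * ic + y \<and>
     pos_x (vtx d b) = 40 * jd + x' \<and> pos_y (vtx d b) = 40 * id + y' \<and>
     (x = 32 \<and> y = 2 \<and> a = 16 \<or> x \<le> 24) \<and> (x' = -8 \<and> y' = 2 \<and> b = 0 \<or> 0 \<le> x') \<and>
     (y = 32 \<and> a = 17 \<or> y \<le> 16) \<and> (y' = -8 \<and> b = 2 \<or> -2 \<le> y') \<and>
     -8 \<le> y \<and> y \<le> 32 \<and> -8 \<le> y' \<and> y' \<le> 32" if "present c a" "present d b" for a b
  proof -
    obtain x y x' y' where xy: "local_pos (ty c) a = (x, y)" "local_pos (ty d) b = (x', y')" by force
    have "a < 18" "b < 18" using that by (auto simp: present_def)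
    note A = local_pos_bounds[OF ty \<open>a < 18\<close>, of c, unfolded xy in_tile_box.simps]
    note B = local_pos_bounds[OF ty \<open>b < 18\<close>, of d, unfolded xy in_tile_box.simps]
    have "x = 32 \<and> y = 2 \<and> a = 16 \<or> x \<le> 24" using A by (cases "a = 16") simp_all
    moreover have "x' = -8 \<and> y' = 2 \<and> b = 0 \<or> 0 \<le> x'" using B by (cases "b = 0") simp_all
    moreover have "y = 32 \<and> a = 17 \<or> y \<le> 16" using A by (cases "a = 17") simp_all
    moreover have "y' = -8 \<and> b = 2 \<or> -2 \<le> y'" using B by (cases "b = 2") simp_all
    moreover have "-8 \<le> y" "y \<le> 32" "-8 \<le> y'" "y' \<le> 32"
      using A B by (simp_all split: if_splits)
    ultimately have "(x = 32 \<and> y = 2 \<and> a = 16 \<or> x \<le> 24) \<and> (x' = -8 \<and> y' = 2 \<and> b = 0 \<or> 0 \<le> x') \<and>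
     (y = 32 \<and> a = 17 \<or> y \<le> 16) \<and> (y' = -8 \<and> b = 2 \<or> -2 \<le> y') \<and>
     -8 \<le> y \<and> y \<le> 32 \<and> -8 \<le> y' \<and> y' \<le> 32"
      by blast
    then show ?thesis
      using xy pos_vtx[OF that(1)] pos_vtx[OF that(2)] unfolding defs
      by (intro exI[of _ x] exI[of _ y] exI[of _ x'] exI[of _ y']) simp
  qed
  have 16: "vtx c 16 = vtx d 0" if "jd = jc + 1" "ic = id"
  proof -
    have "d div Rt = c div Rt + 1" "d mod Rt = c mod Rt" using that unfolding defs by auto
    then have "d = (c div Rt + 1) * Rt + c mod Rt" using cd(2) by metis
    then have "d = c + Rt" using cd(1) by simp
    then show ?thesis by (simp add: vtx_def)
  qed
  have 17: "vtx c 17 = vtx d 2" if "jd = jc" "id = ic + 1"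
  proof -
    have "d div Rt = c div Rt" "d mod Rt = c mod Rt + 1" using that unfolding defs by auto
    then have "d = c div Rt * Rt + (c mod Rt + 1)" using cd(2) by metis
    then have "d = c + 1" using cd(1) by simp
    then show ?thesis by (simp add: vtx_def)
  qed
  \<comment> \<open>Within a column y decides, within a row x does. Otherwise the x ranges may touch
    (32 against 40 - 8), but the rows differ by at least one pitch, so adding y or -y to 5x breaks
    the tie: the offsets lose at most 200, the cells gain at least 240.\<close>
  define \<alpha> \<beta> :: int where "\<alpha> = (if jc = jd then 0 else if ic = id then 1 else 5)"
    "\<beta> = (if jc = jd then 1 else if ic = id then 0 else if ic < id then 1 else -1)"
  show ?thesis
  proof (rule exI[of _ \<alpha>], rule exI[of _ \<beta>], intro allI impI)
    fix a b assume pr: "present c a" "present d b"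
    obtain x y x' y' where h: "pos_x (vtx c a) = 40 * jc + x" "pos_y (vtx c a) = 40 * ic + y"
      "pos_x (vtx d b) = 40 * jd + x'" "pos_y (vtx d b) = 40 * id + y'"
      "x = 32 \<and> y = 2 \<and> a = 16 \<or> x \<le> 24" "x' = -8 \<and> y' = 2 \<and> b = 0 \<or> 0 \<le> x'"
      "y = 32 \<and> a = 17 \<or> y \<le> 16" "y' = -8 \<and> b = 2 \<or> -2 \<le> y'"
      "-8 \<le> y" "y \<le> 32" "-8 \<le> y'" "y' \<le> 32"
      using *[OF pr] by blast
    consider "jc = jd" | "jc < jd" "ic = id" | "jc < jd" "ic < id" | "jc < jd" "id < ic" using le by linarith
    then show "vtx c a = vtx d b \<or>
        \<alpha> * pos_x (vtx c a) + \<beta> * pos_y (vtx c a) < \<alpha> * pos_x (vtx d b) + \<beta> * pos_y (vtx d b)"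
    proof cases
      case 1
      have "a = 17 \<and> b = 2 \<and> id = ic + 1 \<or> 40 * ic + y < 40 * id + y'"
        using h(7-12) lt[OF 1] by linarith
      then show ?thesis unfolding h \<alpha>_\<beta>_def using 17 1 by auto
    next
      case 2
      have "a = 16 \<and> b = 0 \<and> jd = jc + 1 \<or> 40 * jc + x < 40 * jd + x'"
        using h(5,6) 2 by linarith
      then show ?thesis unfolding h \<alpha>_\<beta>_def using 16 2 by auto
    next
      case 3
      have "5 * x + y \<le> 162" "-38 \<le> 5 * x' + y'" using h(5-12) by linarith+
      then show ?thesis unfolding h \<alpha>_\<beta>_def using 3 by (intro disjI2) (simp add: algebra_simps)
    next
      case 4
      have "5 * x - y \<le> 158" "-42 \<le> 5 * x' - y'" using h(5-12) by linarith+
      then show ?thesis unfolding h \<alpha>_\<beta>_def using 4 by (intro disjI2) (simp add: algebra_simps)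
    qed
  qed
qed

lemma cells_separated:
  assumes "c \<noteq> d"
  shows "\<exists>\<alpha> \<beta>. \<forall>a b. present c a \<longrightarrow> present d b \<longrightarrow> vtx c a = vtx d b \<or>
    \<alpha> * pos_x (vtx c a) + \<beta> * pos_y (vtx c a) < \<alpha> * pos_x (vtx d b) + \<beta> * pos_y (vtx d b)"
proof (cases "c < d")
  case True
  then show ?thesis by (rule cells_separated_less)
next
  case False
  then have "d < c" using assms by simp
  then obtain \<alpha> \<beta> where ab: "\<And>a b. present d a \<Longrightarrow> present c b \<Longrightarrow> vtx d a = vtx c b \<or>
    \<alpha> * pos_x (vtx d a) + \<beta> * pos_y (vtx d a) < \<alpha> * pos_x (vtx c b) + \<beta> * pos_y (vtx c b)"
    using cells_separated_less by blast
  show ?thesis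
    by (rule exI[of _ "- \<alpha>"], rule exI[of _ "- \<beta>"]) (use ab in force)
qed

lemma edgeE:
  assumes "e \<in> edges"
  obtains c a b where "(a, b) \<in> set (local_edges (ty c))" "present c a" "present c b" "e = {vtx c a, vtx c b}"
proof -
  obtain u v where uv: "e = {u, v}" "tile_arc Rt ty u v" using assms unfolding tile_edges_def by blast
  let ?c = "u div 16" and ?d = "v div 16" and ?a = "u mod 16" and ?b = "v mod 16"
  have u: "u = 16 * ?c + ?a" and v: "v = 16 * ?d + ?b" by simp_all
  consider "?c = ?d" "?b \<in> set (tile_nbrs (ty ?c) ! ?a)" | "?d = ?c + Rt" "?a = 1" "?b = 0"
    | "?d = ?c + 1" "?a = 3" "?b = 2" "?d mod Rt \<noteq> 0"
    using uv(2) unfolding tile_arc_def by (elim disjE conjE) metis+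
  then show ?thesis
  proof cases
    case 1
    note sym = tile_nbrs_sym[OF ty _ 1(2)]
    have vt: "u = vtx ?c ?a" "v = vtx ?c ?b" unfolding vtx_def using u v[folded 1(1)] by simp_all
    have e: "e = {vtx ?c ?a, vtx ?c ?b}" unfolding vt[symmetric] by (rule uv(1))
    have pr: "present ?c ?a" "present ?c ?b"
      using mod_less_divisor[of 16 u] mod_less_divisor[of 16 v] unfolding present_def by linarith+
    show ?thesis
    proof (cases "?a < ?b")
      case True
      then have "(?a, ?b) \<in> set (local_edges (ty ?c))" unfolding local_edges_iff using 1(2) by auto
      then show ?thesis using pr e by (rule that)
    next
      case False
      then have "?b < ?a" using sym(2) by simp
      then have "(?b, ?a) \<in> set (local_edges (ty ?c))" unfolding local_edges_iff using sym(3) by auto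
      then show ?thesis using pr(2,1) e[unfolded insert_commute[of "vtx ?c ?a"]] by (rule that)
    qed
  next
    case 2
    have "u = vtx ?c 1" using u 2(2) by (simp add: vtx_def)
    moreover have "v = vtx ?c 16" unfolding vtx_def using v 2(1,3) by simp
    moreover have "(1, 16) \<in> set (local_edges (ty ?c))" unfolding local_edges_iff by auto
    ultimately show ?thesis using uv(1) by (intro that[of 1 16 ?c]) (auto simp: present_def)
  next
    case 3
    have "u = vtx ?c 3" using u 3(2) by (simp add: vtx_def)
    moreover have "v = vtx ?c 17" unfolding vtx_def using v 3(1,3) by simp
    moreover have "(3, 17) \<in> set (local_edges (ty ?c))" unfolding local_edges_iff by auto
    ultimately show ?thesis using uv(1) 3(1,4) by (intro that[of 3 17 ?c]) (auto simp: present_def)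
  qed
qed

lemma vtx_div_mod: "v = vtx (v div 16) (v mod 16)" "present (v div 16) (v mod 16)"
  using mod_less_divisor[of 16 v] unfolding vtx_def present_def by auto

text \<open>Edges of one cell are separated by the translated table of directions; edges of
  different cells by a line between the cells, which passes at most through a shared port.\<close>

lemma planar_edges: "planar {..<nv} edges"
proof (rule planar_straight_line[OF simple, where x = pos_x and y = pos_y])
  show "inj_on (\<lambda>v. (pos_x v, pos_y v)) {..<nv}"
  proof (rule inj_onI)
    fix u v assume "(pos_x u, pos_y u) = (pos_x v, pos_y v)"
    then have eq: "pos_x u = pos_x v" "pos_y u = pos_y v" by auto
    show "u = v"
    proof (cases "u div 16 = v div 16")
      case True
      have "local_pos (ty (u div 16)) (u mod 16) = local_pos (ty (u div 16)) (v mod 16)"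
        using eq unfolding pos_x_def pos_y_def True by (simp add: prod_eq_iff)
      then have "u mod 16 = v mod 16" by (intro local_pos_inj[OF ty]) auto
      with True show ?thesis by (metis mult_div_mod_eq)
    next
      case False
      from cells_separated[OF this] vtx_div_mod[of u] vtx_div_mod[of v] eq show ?thesis by (metis less_irrefl)
    qed
  qed
next
  fix e f assume "e \<in> edges" "f \<in> edges" "e \<noteq> f"
  obtain c a1 a2 where e: "(a1, a2) \<in> set (local_edges (ty c))" "present c a1" "present c a2" "e = {vtx c a1, vtx c a2}"
    using edgeE[OF \<open>e \<in> edges\<close>] .
  obtain d b1 b2 where f: "(b1, b2) \<in> set (local_edges (ty d))" "present d b1" "present d b2" "f = {vtx d b1, vtx d b2}"
    using edgeE[OF \<open>f \<in> edges\<close>] .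
  show "\<exists>\<alpha> \<beta>. \<forall>u\<in>e. \<forall>v\<in>f. u = v \<or> \<alpha> * pos_x u + \<beta> * pos_y u < \<alpha> * pos_x v + \<beta> * pos_y v"
  proof (cases "c = d")
    case True
    with e f \<open>e \<noteq> f\<close> have "(a1, a2) \<noteq> (b1, b2)" by auto
    from local_edges_separated[OF ty e(1) f(1)[folded True] this]
    obtain \<alpha> \<beta> where ab: "\<forall>a\<in>{a1, a2}. \<forall>b\<in>{b1, b2}. a = b \<or>
      \<alpha> * fst (local_pos (ty c) a) + \<beta> * snd (local_pos (ty c) a) <
      \<alpha> * fst (local_pos (ty c) b) + \<beta> * snd (local_pos (ty c) b)" by blast
    show ?thesis
    proof (rule exI[of _ \<alpha>], rule exI[of _ \<beta>], intro ballI)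
      fix u v assume "u \<in> e" "v \<in> f"
      then obtain a b where "a \<in> {a1, a2}" "b \<in> {b1, b2}" "u = vtx c a" "v = vtx c b" using e(4) f(4) True by blast
      moreover then have "present c a" "present c b" using e f True by auto
      ultimately show "u = v \<or> \<alpha> * pos_x u + \<beta> * pos_y u < \<alpha> * pos_x v + \<beta> * pos_y v"
        using ab by (auto simp: pos_vtx algebra_simps)
    qed
  next
    case False
    from cells_separated[OF this] e f show ?thesis by blast
  qed
next
  fix e w assume "e \<in> edges" "w \<notin> e"
  obtain c a1 a2 where e: "(a1, a2) \<in> set (local_edges (ty c))" "present c a1" "present c a2" "e = {vtx c a1, vtx c a2}"
    using edgeE[OF \<open>e \<in> edges\<close>] .
  show "\<exists>\<alpha> \<beta>. \<forall>u\<in>e. \<alpha> * pos_x u + \<beta> * pos_y u < \<alpha> * pos_x w + \<beta> * pos_y w"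
  proof (cases "c = w div 16")
    case True
    with \<open>w \<notin> e\<close> vtx_div_mod[of w] e(4) have "w mod 16 \<notin> {a1, a2}" by auto
    from local_vertices_separated[OF ty e(1) _ this]
    obtain \<alpha> \<beta> where ab: "\<forall>a\<in>{a1, a2}.
      \<alpha> * fst (local_pos (ty c) a) + \<beta> * snd (local_pos (ty c) a) <
      \<alpha> * fst (local_pos (ty c) (w mod 16)) + \<beta> * snd (local_pos (ty c) (w mod 16))" by auto
    have "pos_x w = 40 * int (c div Rt) + fst (local_pos (ty c) (w mod 16))"
      "pos_y w = 40 * int (c mod Rt) + snd (local_pos (ty c) (w mod 16))"
      using True by (simp_all add: pos_x_def pos_y_def)
    then show ?thesis
      using ab e(2-4) by (intro exI[of _ \<alpha>] exI[of _ \<beta>]) (auto simp: pos_vtx algebra_simps)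
  next
    case False
    obtain \<alpha> \<beta> where ab: "\<And>a b. present c a \<Longrightarrow> present (w div 16) b \<Longrightarrow> vtx c a = vtx (w div 16) b \<or>
      \<alpha> * pos_x (vtx c a) + \<beta> * pos_y (vtx c a) <
      \<alpha> * pos_x (vtx (w div 16) b) + \<beta> * pos_y (vtx (w div 16) b)"
      using cells_separated[OF False] by blast
    have "\<alpha> * pos_x (vtx c a) + \<beta> * pos_y (vtx c a) < \<alpha> * pos_x w + \<beta> * pos_y w"
      if "present c a" "vtx c a \<in> e" for a
      using ab[OF that(1) vtx_div_mod(2), folded vtx_div_mod(1)[of w]] that(2) \<open>w \<notin> e\<close> by auto
    then show ?thesis using e by blast
  qed
qed

end

section \<open>Cutwidth of the column by column layout\<close>

context tile_array
begin

lemma linear_layout_Suc: "linear_layout {..<nv} Suc"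
  unfolding linear_layout_def by (intro bij_betw_imageI) (auto simp: image_Suc_lessThan)

text \<open>The cut lies at cell \<open>c = i div 16\<close>. It meets at most 256 pairs inside this
  cell, the row edges starting in one of the \<open>Rt + 1\<close> cells \<open>c - Rt\<close> to
  \<open>c\<close>, and at most 2 edges running down a column.\<close>

lemma card_cut_le:
  "card {e \<in> edges. \<exists>u v. e = {u, v} \<and> Suc u \<le> i \<and> i < Suc v} \<le> Rt + 259"
proof -
  define c where "c = i div 16"
  define X1 where "X1 = (\<lambda>(a, b). {16 * c + a, 16 * c + b}) ` ({..<16::nat} \<times> {..<16::nat})"
  define X2 where "X2 = (\<lambda>d. {16 * d + 1, 16 * (d + Rt)}) ` {c - Rt..c}"
  define X3 where "X3 = (\<lambda>d. {16 * d + 3, 16 * (d + 1) + 2}) ` {c - 1..c}"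
  have "{e \<in> edges. \<exists>u v. e = {u, v} \<and> Suc u \<le> i \<and> i < Suc v} \<subseteq> X1 \<union> X2 \<union> X3"
  proof
    fix e assume "e \<in> {e \<in> edges. \<exists>u v. e = {u, v} \<and> Suc u \<le> i \<and> i < Suc v}"
    then obtain u v where e: "e = {u, v}" "e \<in> edges" and i: "u < i" "i \<le> v" by auto
    then have "tile_arc Rt ty u v \<or> tile_arc Rt ty v u"
      unfolding tile_edges_def by (auto simp: doubleton_eq_iff)
    then consider "u div 16 = v div 16"
      | "v div 16 = u div 16 + Rt" "u mod 16 = 1" "v mod 16 = 0"
      | "v div 16 = u div 16 + 1" "u mod 16 = 3" "v mod 16 = 2"
      | "u div 16 = v div 16 + Rt" | "u div 16 = v div 16 + 1"
      unfolding tile_arc_def by auto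
    then show "e \<in> X1 \<union> X2 \<union> X3"
    proof cases
      case 1
      then have "u div 16 = c" "v div 16 = c"
        using i div_le_mono[of u i 16] div_le_mono[of i v 16] unfolding c_def by auto
      then have "u = 16 * c + u mod 16" "v = 16 * c + v mod 16" by (metis mult_div_mod_eq)+
      then have "e = (\<lambda>(a, b). {16 * c + a, 16 * c + b}) (u mod 16, v mod 16)" using e(1) by simp
      then have "e \<in> X1" unfolding X1_def by (rule image_eqI) auto
      then show ?thesis by blast
    next
      case 2
      have "e = {16 * (u div 16) + 1, 16 * (u div 16 + Rt)}"
        using e(1) 2 mult_div_mod_eq[of 16 u] mult_div_mod_eq[of 16 v] by simp
      moreover have "u div 16 \<in> {c - Rt..c}"
        using i 2(1) div_le_mono[of u i 16] div_le_mono[of i v 16] unfolding c_def by auto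
      ultimately have "e \<in> X2" unfolding X2_def by blast
      then show ?thesis by blast
    next
      case 3
      have "e = {16 * (u div 16) + 3, 16 * (u div 16 + 1) + 2}"
        using e(1) 3 mult_div_mod_eq[of 16 u] mult_div_mod_eq[of 16 v] by simp
      moreover have "u div 16 \<in> {c - 1..c}"
        using i 3(1) div_le_mono[of u i 16] div_le_mono[of i v 16] unfolding c_def by auto
      ultimately have "e \<in> X3" unfolding X3_def by blast
      then show ?thesis by blast
    next
      case 4
      then show ?thesis using i div_le_mono[of u v 16] Rt by linarith
    next
      case 5
      then show ?thesis using i div_le_mono[of u v 16] by linarith
    qed
  qed
  then have "card {e \<in> edges. \<exists>u v. e = {u, v} \<and> Suc u \<le> i \<and> i < Suc v} \<le> card (X1 \<union> X2 \<union> X3)"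
    by (rule card_mono[rotated]) (simp add: X1_def X2_def X3_def)
  also have "\<dots> \<le> card X1 + card X2 + card X3"
    using card_Un_le[of "X1 \<union> X2" X3] card_Un_le[of X1 X2] by linarith
  also have "card X1 \<le> 256"
    unfolding X1_def by (rule order_trans[OF card_image_le]) auto
  also have "card X2 \<le> Rt + 1"
    unfolding X2_def by (rule order_trans[OF card_image_le]) auto
  also have "card X3 \<le> 2"
    unfolding X3_def by (rule order_trans[OF card_image_le]) auto
  finally show ?thesis by simp
qed

lemma cutwidth_le: "cutwidth {..<nv} edges Suc \<le> Rt + 259"
  unfolding cutwidth_def using card_cut_le by (intro Max.boundedI) auto

end

section \<open>Satisfiability as a tile array\<close>

lemma digit_sum_less:
  fixes f :: "nat \<Rightarrow> nat"
  shows "(\<And>k. k < n \<Longrightarrow> f k < b) \<Longrightarrow> (\<Sum>k<n. f k * b ^ k) < b ^ n"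
proof (induction n)
  case (Suc n)
  have "Suc (f n) * b ^ n \<le> b * b ^ n" using Suc.prems[of n] by (intro mult_right_mono) auto
  moreover have "(\<Sum>k<n. f k * b ^ k) < b ^ n" using Suc by simp
  ultimately show ?case unfolding sum.lessThan_Suc power_Suc mult_Suc by linarith
qed simp

lemma digit_sum_digit:
  fixes f :: "nat \<Rightarrow> nat"
  shows "(\<And>k. k < n \<Longrightarrow> f k < b) \<Longrightarrow> k < n \<Longrightarrow> (\<Sum>k<n. f k * b ^ k) div b ^ k mod b = f k"
proof (induction n)
  case (Suc n)
  have b: "0 < b" using Suc.prems(1)[of k] Suc.prems(2) by auto
  show ?case
  proof (cases "k = n")
    case True
    have "(\<Sum>k<n. f k * b ^ k) < b ^ n"
      using Suc.prems(1) by (intro digit_sum_less) auto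
    then show ?thesis using True b Suc.prems(1)[of n] by simp
  next
    case False
    then have k: "k < n" using Suc.prems by simp
    then obtain d where d: "n = Suc (k + d)" using less_imp_Suc_add by blast
    have "(\<Sum>k<n. f k * b ^ k) + f n * b ^ n = (\<Sum>k<n. f k * b ^ k) + b ^ k * (b * (b ^ d * f n))"
      unfolding d by (simp add: power_add ac_simps)
    also have "\<dots> div b ^ k mod b = ((\<Sum>k<n. f k * b ^ k) div b ^ k + b * (b ^ d * f n)) mod b"
      using b by simp
    also have "\<dots> = f k" using Suc k by simp
    finally show ?thesis by simp
  qed
qed simp

lemma eq_if_digits_eq:
  fixes M N b :: nat
  assumes "M < b ^ n" "N < b ^ n" "\<And>k. k < n \<Longrightarrow> M div b ^ k mod b = N div b ^ k mod b"
  shows "M = N"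
  using assms
proof (induction n arbitrary: M N)
  case (Suc n)
  have "M div b div b ^ k mod b = N div b div b ^ k mod b" if "k < n" for k
    using Suc.prems(3)[of "Suc k"] that by (simp add: div_mult2_eq)
  moreover have "M div b < b ^ n" "N div b < b ^ n"
    using Suc.prems(1,2) by (auto intro: less_mult_imp_div_less simp: mult.commute)
  ultimately have "M div b = N div b" using Suc.IH by blast
  moreover have "M mod b = N mod b" using Suc.prems(3)[of 0] by simp
  ultimately show ?case by (metis mult_div_mod_eq)
qed simp

text \<open>
  Literal \<open>l\<close> of clause \<open>c\<close> asks that bit \<open>bit c l\<close> of the number assigned to group \<open>grp c l\<close> is
  \<open>sgn c l\<close>. The \<open>p\<close> ternary digits of that number are carried by \<open>p\<close> rows. A column belongs to
  a clause and a number \<open>\<beta>\<close> whose base \<open>3 ^ p\<close> digits give a value to the group of each literal;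
  if these values falsify the clause, the column forbids them. Since the state of a row can only
  increase, and at most twice, all clauses are repeated \<open>2 R + 1\<close> times, so that no state changes
  throughout one of the copies.
\<close>

locale clause_data =
  fixes m G p q :: nat and len :: "nat \<Rightarrow> nat" and grp bit sgn :: "nat \<Rightarrow> nat \<Rightarrow> nat"
begin

definition R :: nat where "R = p * G"
definition Q :: nat where "Q = (3 ^ p) ^ q"
definition C :: nat where "C = (2 * R + 1) * (m * Q)"

text \<open>Truncating the exponent at \<open>q\<close> bounds the power by a constant, so that
  \<open>pcomp_block\<close> can take it from a finite table; literal positions are below
  \<open>q\<close> anyway.\<close>

definition block :: "nat \<Rightarrow> nat \<Rightarrow> nat" where
  "block \<beta> l = \<beta> div (3 ^ p) ^ min l q mod 3 ^ p"

text \<open>A block per literal rather than per group makes \<beta> decodable without looking at the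
  groups; the second conjunct discards those \<beta> that give two values to one group.\<close>

definition relevant :: "nat \<Rightarrow> nat \<Rightarrow> bool" where
  "relevant c \<beta> \<longleftrightarrow> (\<forall>l<len c. block \<beta> l div 2 ^ bit c l mod 2 \<noteq> sgn c l) \<and>
     (\<forall>l<len c. \<forall>l'<len c. grp c l = grp c l' \<longrightarrow> block \<beta> l = block \<beta> l')"

text \<open>Counting the thresholds \<open>t\<close> up to the digit gives the digit plus 1, the
  type of the tile that excludes it, and 0 for a row outside the groups of the clause. No literal
  has to be selected, and the value stays at most 3 even if the blocks disagree.\<close>

definition row_test :: "nat \<Rightarrow> nat \<Rightarrow> nat \<Rightarrow> nat" where
  "row_test c \<beta> i = (\<Sum>t<3. of_bool (\<exists>l<len c. grp c l = i div p \<and> t \<le> block \<beta> l div 3 ^ (i mod p) mod 3))"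

text \<open>For an inner column, \<open>j - 1\<close> is decoded into copy, clause and \<beta>;
  \<open>mod m\<close> forgets the copy. Row \<open>R\<close> is the extra bottom row: it insists on
  done only if \<beta> is relevant.\<close>

definition cell_type :: "nat \<Rightarrow> nat \<Rightarrow> nat" where
  "cell_type i j =
     (if j = 0 \<or> C < j then 4
      else if i = R then (if relevant ((j - 1) div Q mod m) ((j - 1) mod Q) then 5 else 0)
      else row_test ((j - 1) div Q mod m) ((j - 1) mod Q) i)"

definition ty :: "nat \<Rightarrow> nat" where
  "ty c = cell_type (c mod (R + 1)) (c div (R + 1))"

lemma Q: "0 < Q" by (simp add: Q_def)

lemma row_test_le: "row_test c \<beta> i \<le> 3"
proof -
  have "row_test c \<beta> i \<le> (\<Sum>t<3::nat. 1)" unfolding row_test_def by (intro sum_mono) auto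
  then show ?thesis by simp
qed

lemma row_test_eq:
  assumes "relevant c \<beta>" "l < len c" "grp c l = i div p"
  shows "row_test c \<beta> i = Suc (block \<beta> l div 3 ^ (i mod p) mod 3)"
proof -
  let ?d = "block \<beta> l div 3 ^ (i mod p) mod 3"
  have "(\<exists>l'<len c. grp c l' = i div p \<and> t \<le> block \<beta> l' div 3 ^ (i mod p) mod 3) \<longleftrightarrow> t \<le> ?d" for t
    using assms unfolding relevant_def by metis
  then have "row_test c \<beta> i = (\<Sum>t<3. of_bool (t \<le> ?d))" unfolding row_test_def by simp
  also have "\<dots> = card {t \<in> {..<3}. t \<le> ?d}" by (simp add: Int_def)
  also have "{t \<in> {..<3}. t \<le> ?d} = {..?d}" by auto
  finally show ?thesis by simp
qed

lemma row_testD: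
  assumes "row_test c \<beta> i \<noteq> 0" shows "\<exists>l<len c. grp c l = i div p"
proof (rule ccontr)
  assume "\<not> ?thesis"
  then show False using assms unfolding row_test_def by auto
qed

lemma cell_type_less_6: "cell_type i j < 6"
  unfolding cell_type_def using row_test_le[of "(j - 1) div Q mod m" "(j - 1) mod Q" i] by simp

lemma cell_type_less_4: "i < R \<Longrightarrow> 0 < j \<Longrightarrow> j \<le> C \<Longrightarrow> cell_type i j < 4"
  unfolding cell_type_def using row_test_le[of "(j - 1) div Q mod m" "(j - 1) mod Q" i] by simp

end

section \<open>Small dominating sets against satisfying group values\<close>

locale clause_tiles = clause_data +
  assumes p: "0 < p" and G: "0 < G"
    and len: "\<And>c. c < m \<Longrightarrow> len c \<le> q"
    and grp: "\<And>c l. c < m \<Longrightarrow> l < len c \<Longrightarrow> grp c l < G"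
begin

lemma R: "0 < R" using p G by (simp add: R_def)

sublocale tile_array "R + 1" "C + 2" ty
proof
  fix c show "ty c < 6" unfolding ty_def by (rule cell_type_less_6)
qed simp

lemma cell_coords:
  assumes "i \<le> R" shows "(j * (R + 1) + i) mod (R + 1) = i" "(j * (R + 1) + i) div (R + 1) = j"
proof -
  have "i < R + 1" using assms by simp
  then show "(j * (R + 1) + i) mod (R + 1) = i" by (simp only: mod_mult_self3 mod_less)
  have "R + 1 \<noteq> 0" by simp
  from div_mult_self3[OF this, of j i] show "(j * (R + 1) + i) div (R + 1) = j"
    unfolding div_less[OF \<open>i < R + 1\<close>] add_0_right .
qed

lemma ty_cell:
  assumes "i \<le> R" shows "ty (j * (R + 1) + i) = cell_type i j"
  unfolding ty_def cell_coords[OF assms] ..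

lemma cell_less: "i \<le> R \<Longrightarrow> j < C + 2 \<Longrightarrow> j * (R + 1) + i < cells"
proof -
  assume "i \<le> R" "j < C + 2"
  then have "j * (R + 1) + i < Suc j * (R + 1)" by simp
  also have "\<dots> \<le> cells" using \<open>j < C + 2\<close> by (intro mult_right_mono) auto
  finally show ?thesis .
qed

lemma column_less: "k < 2 * R + 1 \<Longrightarrow> c < m \<Longrightarrow> \<beta> < Q \<Longrightarrow> k * (m * Q) + c * Q + \<beta> < Suc k * (m * Q)"
proof -
  assume "c < m" "\<beta> < Q"
  then have "c * Q + \<beta> < Suc c * Q" by simp
  also have "\<dots> \<le> m * Q" using \<open>c < m\<close> by (intro mult_right_mono) auto
  finally show ?thesis by simp
qed

lemma column_coords:
  assumes "c < m" "\<beta> < Q" "j = Suc (k * (m * Q) + c * Q + \<beta>)"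
  shows "(j - 1) div Q mod m = c" "(j - 1) mod Q = \<beta>"
proof -
  have "j - 1 = \<beta> + Q * (k * m + c)" using assms(3) by (simp add: algebra_simps)
  then show "(j - 1) div Q mod m = c" "(j - 1) mod Q = \<beta>" using assms(1,2) Q by auto
qed

definition sat :: bool where
  "sat \<longleftrightarrow> (\<exists>N. (\<forall>g<G. N g < 3 ^ p) \<and> (\<forall>c<m. \<exists>l<len c. N (grp c l) div 2 ^ bit c l mod 2 = sgn c l))"

text \<open>A potential argument finds a copy in which no row changes, and the digits read there
  satisfy every clause: for a violated clause, the column belonging to exactly these values tests in
  each row of its groups the digit that the row carries, so its signal could nowhere become
  done.\<close>

lemma solution_imp_sat:
  assumes A: "\<And>c. c < cells \<Longrightarrow> tile_spec (ty c) (A c) \<and> (\<forall>a<16. cell_dom A c a)"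
  shows sat
proof -
  define B where "B = (\<lambda>i j. A (j * (R + 1) + i))"
  define W where "W = (\<lambda>i j. west_state (cell_type i j) (B i j))"
  define E where "E = (\<lambda>i j. east_state (cell_type i j) (B i j))"
  have spec: "tile_spec (cell_type i j) (B i j)" if "i \<le> R" "j < C + 2" for i j
    using A[OF cell_less[OF that]] ty_cell[OF that(1)] unfolding B_def by metis
  have dom: "tile_dom (cell_type i j) (B i j) a \<or>
     (a = 0 \<and> 0 < j \<and> 1 \<in> B i (j - 1)) \<or>
     (a = 1 \<and> 0 \<in> B i (j + 1)) \<or>
     (a = 2 \<and> i \<noteq> 0 \<and> 3 \<in> B (i - 1) j) \<or> a = 3"
    if "i \<le> R" "j < C + 2" "a < 16" for i j a
  proof -
    let ?c = "j * (R + 1) + i"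
    have "?c mod (R + 1) = i" using that(1) by (rule cell_coords)
    moreover have "0 < j \<and> ?c - (R + 1) = (j - 1) * (R + 1) + i" if "R + 1 \<le> ?c"
      using that \<open>i \<le> R\<close> by (cases j) auto
    moreover have "?c + (R + 1) = (j + 1) * (R + 1) + i" by simp
    moreover have "?c - 1 = j * (R + 1) + (i - 1)" if "i \<noteq> 0" using that by simp
    moreover have "cell_dom A ?c a" using A[OF cell_less[OF that(1,2)]] that(3) by blast
    ultimately show ?thesis
      unfolding cell_dom_def B_def ty_cell[OF that(1)] by (metis (no_types, lifting))
  qed
  have WE: "W i j \<le> E i j" if "i < R" "1 \<le> j" "j \<le> C" for i j
  proof -
    have "cell_type i j < 4" using that by (intro cell_type_less_4) auto
    then show ?thesis using spec[of i j] that unfolding tile_spec_def W_def E_def by auto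
  qed
  \<comment> \<open>East state 2 means that port 1 still needs the port across, which makes the next
    west state 2; west state 0 likewise forces the previous east state 0.\<close>
  have EW: "E i j \<le> W i (j + 1)" if "i < R" "j \<le> C" for i j
    using dom[of i j 1] dom[of i "j + 1" 0] that
    unfolding W_def E_def west_state_def east_state_def by auto
  have W2: "W i j \<le> 2" for i j unfolding W_def west_state_def by simp
  have step: "W i j \<le> W i (j + 1)" if "i < R" "1 \<le> j" "j \<le> C" for i j
    using WE[OF that] EW that by (meson le_trans)
  have mono: "W i j \<le> W i j'" if "i < R" "1 \<le> j" "j \<le> j'" "j' \<le> C + 1" for i j j'
    using that(3,4)
  proof (induction j' rule: dec_induct)
    case (step n)
    then show ?case using \<open>\<And>i j. i < R \<Longrightarrow> 1 \<le> j \<Longrightarrow> j \<le> C \<Longrightarrow> W i j \<le> W i (j + 1)\<close>[of i n] that by auto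
  qed simp
  \<comment> \<open>First column of copy \<open>k\<close>; the offset 1 skips the column of left
    ends.\<close>
  define S where "S = (\<lambda>k. 1 + k * (m * Q))"
  have S: "1 \<le> S k" "S k \<le> S (Suc k)" for k by (auto simp: S_def)
  have SC: "S k \<le> C + 1" if "k \<le> 2 * R + 1" for k
    unfolding S_def C_def using mult_right_mono[OF that, of "m * Q"] by simp
  \<comment> \<open>Each row contributes at most 2 and never decreases, so the total cannot grow in
    all \<open>2 * R + 1\<close> copies.\<close>
  define \<Phi> where "\<Phi> = (\<lambda>k. \<Sum>i<R. W i (S k))"
  have "\<exists>k<2 * R + 1. \<Phi> (Suc k) \<le> \<Phi> k"
  proof (rule ccontr)
    assume "\<not> ?thesis"
    then have less: "\<Phi> k < \<Phi> (Suc k)" if "k < 2 * R + 1" for k using that by (meson not_le)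
    have "k \<le> 2 * R + 1 \<Longrightarrow> k \<le> \<Phi> k" for k
    proof (induction k)
      case (Suc k)
      then show ?case using less[of k] by simp
    qed simp
    moreover have "\<Phi> (2 * R + 1) \<le> (\<Sum>i<R. 2)" unfolding \<Phi>_def by (intro sum_mono W2)
    ultimately show False by (metis Suc_eq_plus1 card_lessThan le_trans mult.commute not_less_eq_eq order_refl sum_constant of_nat_id)
  qed
  then obtain k where k: "k < 2 * R + 1" "\<Phi> (Suc k) \<le> \<Phi> k" by blast
  have SS: "S (Suc k) \<le> C + 1" using SC k(1) by simp
  define x where "x = (\<lambda>i. W i (S k))"
  have x_eq: "W i (S (Suc k)) = x i" if "i < R" for i
  proof (rule antisym)
    show "x i \<le> W i (S (Suc k))" unfolding x_def using that S SS by (intro mono) auto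
    show "W i (S (Suc k)) \<le> x i"
    proof (rule ccontr)
      assume "\<not> W i (S (Suc k)) \<le> x i"
      then have "\<Phi> k < \<Phi> (Suc k)" unfolding \<Phi>_def x_def using that S SS
        by (intro sum_strict_mono_ex1 ballI mono) (auto simp: not_le)
      then show False using k(2) by simp
    qed
  qed
  have const: "W i j = x i \<and> E i j = x i" if "i < R" "S k \<le> j" "j < S (Suc k)" for i j
  proof -
    have "1 \<le> j" "j \<le> C" using that S(1)[of k] SS by auto
    then have "x i \<le> W i j" "W i j \<le> E i j" "E i j \<le> W i (j + 1)" "W i (j + 1) \<le> W i (S (Suc k))"
      using that SS S unfolding x_def by (auto intro!: mono WE EW[simplified])
    then show ?thesis using x_eq[OF that(1)] by simp
  qed
  have x3: "x i < 3" for i using W2 unfolding x_def by (simp add: le_imp_less_Suc numeral_3_eq_3 numeral_2_eq_2)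
  define N where "N = (\<lambda>g. \<Sum>r<p. x (g * p + r) * 3 ^ r)"
  have N: "N g < 3 ^ p" "r < p \<Longrightarrow> N g div 3 ^ r mod 3 = x (g * p + r)" for g r
    unfolding N_def using digit_sum_less[of p "\<lambda>r. x (g * p + r)" 3]
      digit_sum_digit[of p "\<lambda>r. x (g * p + r)" 3] x3 by auto
  have "\<exists>l<len c. N (grp c l) div 2 ^ bit c l mod 2 = sgn c l" if c: "c < m" for c
  proof (rule ccontr)
    assume unsat: "\<not> ?thesis"
    \<comment> \<open>The blocks are the actual values of the groups, so the violated clause makes
      this column relevant.\<close>
    define \<beta> where "\<beta> = (\<Sum>l<len c. N (grp c l) * (3 ^ p) ^ l)"
    have block: "block \<beta> l = N (grp c l)" if "l < len c" for l
      unfolding block_def \<beta>_def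
      using digit_sum_digit[of "len c" "\<lambda>l. N (grp c l)" "3 ^ p" l] N(1) that len[OF c] by (simp add: min_def)
    have "\<beta> < (3 ^ p) ^ len c" unfolding \<beta>_def by (rule digit_sum_less) (rule N(1))
    also have "\<dots> \<le> Q" unfolding Q_def using len[OF c] by (intro power_increasing) auto
    finally have \<beta>: "\<beta> < Q" .
    have rel: "relevant c \<beta>" unfolding relevant_def using unsat by (auto simp: block)
    define j where "j = Suc (k * (m * Q) + c * Q + \<beta>)"
    note coords = column_coords[OF c \<beta> j_def]
    have j: "S k \<le> j" "j < S (Suc k)" "1 \<le> j" "j \<le> C" "j < C + 2"
      using column_less[OF k(1) c \<beta>] SS unfolding j_def S_def by auto
    have "cell_type R j = 5" unfolding cell_type_def coords using j rel by simp
    then have "\<not> tile_dom (cell_type R j) (B R j) 2"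
      using spec[of R j] j unfolding tile_spec_def by simp
    then have "3 \<in> B (R - 1) j" using dom[of R j 2] j by auto
    then have ex: "3 \<in> B (R - 1) j \<and> R - 1 < R" using R by simp
    \<comment> \<open>The topmost tile that sends done: none arrives from above, so it dominates its
      north port itself and has to be a switching tile.\<close>
    define i where "i = (LEAST i. 3 \<in> B i j \<and> i < R)"
    have i: "3 \<in> B i j" "i < R" using LeastI[of "\<lambda>i. 3 \<in> B i j \<and> i < R", OF ex] unfolding i_def by auto
    have "\<not> 3 \<in> B (i - 1) j" if "i \<noteq> 0"
      using not_less_Least[of "i - 1" "\<lambda>i. 3 \<in> B i j \<and> i < R", folded i_def] that i(2) by auto
    then have "tile_dom (cell_type i j) (B i j) 2" using dom[of i j 2] i j by auto
    moreover have ct: "cell_type i j = row_test c \<beta> i" unfolding cell_type_def coords using j i by simp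
    moreover have "W i j = E i j" "W i j = x i" using const[OF i(2) j(1,2)] by auto
    ultimately have t: "row_test c \<beta> i \<noteq> 0" "x i \<noteq> row_test c \<beta> i - 1"
      using spec[of i j] i j row_test_le[of c \<beta> i] unfolding tile_spec_def W_def E_def by auto
    obtain l where l: "l < len c" "grp c l = i div p" using row_testD[OF t(1)] by blast
    have "row_test c \<beta> i = Suc (N (i div p) div 3 ^ (i mod p) mod 3)"
      using row_test_eq[OF rel l] block[OF l(1)] l(2) by simp
    also have "N (i div p) div 3 ^ (i mod p) mod 3 = x i" using N(2)[of "i mod p" "i div p"] p by simp
    finally show False using t(2) by simp
  qed
  then show sat unfolding sat_def using N(1) by blast
qed

text \<open>Each row keeps its digit throughout, and in every inner column the topmost row able to
  switch the signal does so. The tables then supply each tile, leaving open only ports that the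
  adjacent tile dominates.\<close>

lemma sat_imp_solution:
  assumes sat
  shows "\<exists>A. \<forall>c<cells. A c \<subseteq> {..<16} \<and> card (A c) = 4 \<and> tile_spec (ty c) (A c) \<and> (\<forall>a<16. cell_dom A c a)"
proof -
  obtain N where N: "\<And>g. g < G \<Longrightarrow> N g < 3 ^ p"
    and sat: "\<And>c. c < m \<Longrightarrow> \<exists>l<len c. N (grp c l) div 2 ^ bit c l mod 2 = sgn c l"
    using assms unfolding sat_def by blast
  \<comment> \<open>The bottom row gets state 1: its tiles dominate their west and east ports
    themselves, so it carries no information.\<close>
  define x where "x = (\<lambda>i. if i = R then 1 else N (i div p) div 3 ^ (i mod p) mod 3)"
  have x3: "x i < 3" for i by (simp add: x_def)
  define pass where "pass = (\<lambda>i j. i < R \<and> cell_type i j \<noteq> 0 \<and> x i \<noteq> cell_type i j - 1)"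
  \<comment> \<open>Above the switching row the signal is undone (1), there it turns (2), below it
    is done (0). The left and right ends use roles 0 and 1, and the bottom row uses 1.\<close>
  define d where "d = (\<lambda>i j. if j = 0 then 0 else if C < j \<or> i = R then 1
      else if \<exists>i'<i. pass i' j then 0 else if pass i j then 2 else 1 :: nat)"
  define B where "B = (\<lambda>i j. set (tile_sol (cell_type i j) (x i) (d i j)))"
  define A where "A = (\<lambda>c. B (c mod (R + 1)) (c div (R + 1)))"
  have AB: "A (j * (R + 1) + i) = B i j" if "i \<le> R" for i j
    unfolding A_def cell_coords[OF that] ..
  have d3: "d i j < 3" for i j by (simp add: d_def)
  have d2: "d i j = 2 \<Longrightarrow> cell_type i j \<noteq> 0 \<and> x i \<noteq> cell_type i j - 1" for i j
    unfolding d_def pass_def by (auto split: if_splits)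
  have spec: "tile_sol_spec (cell_type i j) (x i) (d i j) (B i j)" for i j
    unfolding B_def using d2 by (intro tile_sol_spec cell_type_less_6 x3 d3) auto
  have props: "B i j \<subseteq> {..<16}" "card (B i j) = 4" "tile_valid (cell_type i j) (B i j)"
    "tile_dom (cell_type i j) (B i j) 3"
    "cell_type i j < 4 \<Longrightarrow> (x i = 0 \<or> tile_dom (cell_type i j) (B i j) 0) \<and>
       (x i = 2 \<or> tile_dom (cell_type i j) (B i j) 1) \<and> (x i = 0 \<longrightarrow> 1 \<in> B i j) \<and> (x i = 2 \<longrightarrow> 0 \<in> B i j) \<and>
       (d i j = 0 \<or> tile_dom (cell_type i j) (B i j) 2) \<and> (d i j = 1 \<or> 3 \<in> B i j)"
    "cell_type i j = 4 \<Longrightarrow> d i j = 0 \<Longrightarrow> tile_dom (cell_type i j) (B i j) 2 \<and> tile_dom (cell_type i j) (B i j) 0 \<and>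
       (x i = 2 \<or> tile_dom (cell_type i j) (B i j) 1) \<and> (x i = 0 \<longrightarrow> 1 \<in> B i j)"
    "cell_type i j = 4 \<Longrightarrow> d i j = 1 \<Longrightarrow> tile_dom (cell_type i j) (B i j) 2 \<and> tile_dom (cell_type i j) (B i j) 1 \<and>
       (x i = 0 \<or> tile_dom (cell_type i j) (B i j) 0) \<and> (x i = 2 \<longrightarrow> 0 \<in> B i j)"
    "cell_type i j = 5 \<Longrightarrow> tile_dom (cell_type i j) (B i j) 0 \<and> tile_dom (cell_type i j) (B i j) 1" for i j
    using spec[of i j] tile_sol_spec_valid[OF spec[of i j]] unfolding tile_sol_spec_def Let_def by blast+
  note ct4 = cell_type_less_4
  \<comment> \<open>The block of a true literal differs from the value of its group, hence in some
    ternary digit, and the row carrying that digit can switch.\<close>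
  have passes: "\<exists>i<R. pass i j" if j: "0 < j" "j \<le> C" and 5: "cell_type R j = 5" for j
  proof -
    define c \<beta> where "c = (j - 1) div Q mod m" "\<beta> = (j - 1) mod Q"
    have rel: "relevant c \<beta>" using 5 j unfolding cell_type_def c_\<beta>_def by (simp split: if_splits)
    have "m \<noteq> 0" using j unfolding C_def by (cases m) auto
    then have c: "c < m" unfolding c_\<beta>_def by simp
    then obtain l where l: "l < len c" "N (grp c l) div 2 ^ bit c l mod 2 = sgn c l" using sat by blast
    then have "block \<beta> l \<noteq> N (grp c l)" using rel unfolding relevant_def by metis
    moreover have "block \<beta> l < 3 ^ p" unfolding block_def by simp
    moreover have g: "grp c l < G" using grp[OF c l(1)] .
    ultimately obtain r where r: "r < p" "block \<beta> l div 3 ^ r mod 3 \<noteq> N (grp c l) div 3 ^ r mod 3"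
      using eq_if_digits_eq[of "block \<beta> l" 3 p "N (grp c l)"] N by blast
    define i where "i = grp c l * p + r"
    have i: "i div p = grp c l" "i mod p = r" using r(1) unfolding i_def by auto
    have "i < Suc (grp c l) * p" using r(1) by (simp add: i_def)
    also have "\<dots> \<le> R" unfolding R_def using g by (subst mult.commute) (intro mult_left_mono; simp)
    finally have "i < R" .
    moreover have "cell_type i j = Suc (block \<beta> l div 3 ^ r mod 3)"
      using row_test_eq[OF rel l(1), of i] i \<open>i < R\<close> j unfolding cell_type_def c_\<beta>_def[symmetric] by simp
    ultimately have "pass i j" unfolding pass_def x_def using r(2) i by auto
    with \<open>i < R\<close> show ?thesis by blast
  qed
  have dom: "tile_dom (cell_type i j) (B i j) a \<or>
     (a = 0 \<and> 0 < j \<and> 1 \<in> B i (j - 1)) \<or>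
     (a = 1 \<and> j < C + 1 \<and> 0 \<in> B i (j + 1)) \<or>
     (a = 2 \<and> i \<noteq> 0 \<and> 3 \<in> B (i - 1) j)"
    if i: "i \<le> R" and j: "j < C + 2" and a: "a < 16" for i j a
  proof -
    have end1: "cell_type i 0 = 4" "d i 0 = 0" for i unfolding cell_type_def d_def by auto
    have end2: "cell_type i j = 4" "d i j = 1" if "C < j" for i j using that unfolding cell_type_def d_def by auto
    consider "4 \<le> a" | "a = 3" | "a = 0" | "a = 1" | "a = 2" using a by linarith
    then show ?thesis
    proof cases
      case 1
      then show ?thesis using props(3)[of i j] a unfolding tile_valid_def by auto
    next
      case 2
      then show ?thesis using props(4)[of i j] by simp
    next
      case 3
      have "0 < j \<and> 1 \<in> B i (j - 1)" if "\<not> tile_dom (cell_type i j) (B i j) 0"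
      proof -
        have j0: "j \<noteq> 0" using that props(6)[of i j] end1 by metis
        have "i \<noteq> R"
        proof
          assume "i = R"
          then have "x i = 1" by (simp add: x_def)
          then show False using that props(5)[of i j] props(7)[of i j] props(8)[of i j] end2[of j i] j0 \<open>i = R\<close>
            unfolding cell_type_def by (auto split: if_splits)
        qed
        then have iR: "i < R" using i by simp
        have x0: "x i = 0"
          using that props(5)[of i j] props(7)[of i j] end2[of j i] ct4[OF iR, of j] j0 by (cases "C < j") auto
        have "1 \<in> B i (j - 1)"
          using x0 props(5)[of i "j - 1"] props(6)[of i "j - 1"] end1[of i] ct4[OF iR, of "j - 1"] j j0
          by (cases "j = 1") auto
        with j0 show ?thesis by simp
      qed
      with 3 show ?thesis by blast
    next
      case 4
      have "j < C + 1 \<and> 0 \<in> B i (j + 1)" if "\<not> tile_dom (cell_type i j) (B i j) 1"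
      proof -
        have jC: "j \<le> C" using that props(7)[of i j] end2 by (metis not_le)
        have "i \<noteq> R"
        proof
          assume "i = R"
          then have "x i = 1" by (simp add: x_def)
          then show False using that props(5)[of i j] props(6)[of i j] props(8)[of i j] end1[of i] jC \<open>i = R\<close>
            unfolding cell_type_def by (auto split: if_splits)
        qed
        then have iR: "i < R" using i by simp
        have x2: "x i = 2"
          using that props(5)[of i j] props(6)[of i j] end1[of i] ct4[OF iR, of j] jC by (cases "j = 0") auto
        have "0 \<in> B i (j + 1)"
          using x2 props(5)[of i "j + 1"] props(7)[of i "j + 1"] end2[of "j + 1" i] ct4[OF iR, of "j + 1"] jC
          by (cases "j = C") auto
        with jC show ?thesis by simp
      qed
      with 4 show ?thesis by blast
    next
      case 5
      have "i \<noteq> 0 \<and> 3 \<in> B (i - 1) j" if nd: "\<not> tile_dom (cell_type i j) (B i j) 2"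
      proof -
        have j0: "0 < j" "j \<le> C"
          using nd props(6)[of i j] props(7)[of i j] end1[of i] end2[of j i] by (metis neq0_conv, metis not_le)
        have "\<exists>i'<i. pass i' j"
        proof (cases "i = R")
          case True
          then have "d i j = 1" using j0 by (simp add: d_def)
          then have "cell_type R j = 5"
            using nd props(5)[of i j] True j0 unfolding cell_type_def by (auto split: if_splits)
          then show ?thesis using passes[OF j0] True by blast
        next
          case False
          then have "d i j = 0" using nd props(5)[of i j] ct4[of i j] i j0 by auto
          then show ?thesis using j0 False unfolding d_def by (auto split: if_splits)
        qed
        then obtain i' where i': "i' < i" "pass i' j" by blast
        \<comment> \<open>Row \<open>i - 1\<close> is the switching row or lies below it, so its
          role is 2 or 0 and its south port is chosen.\<close>
        have "d (i - 1) j \<noteq> 1"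
        proof (cases "i' = i - 1")
          case True
          then show ?thesis using i' i j0 by (auto simp: d_def)
        next
          case False
          then have "i' < i - 1" using i' by simp
          then show ?thesis using i' i j0 by (auto simp: d_def)
        qed
        moreover have "i - 1 < R" using i' i by simp
        ultimately show ?thesis using props(5)[of "i - 1" j] ct4[of "i - 1" j] j0 i' by auto
      qed
      with 5 show ?thesis by blast
    qed
  qed
  have "A c \<subseteq> {..<16} \<and> card (A c) = 4 \<and> tile_spec (ty c) (A c) \<and> (\<forall>a<16. cell_dom A c a)" if c: "c < cells" for c
  proof -
    define i j where "i = c mod (R + 1)" "j = c div (R + 1)"
    have c_eq: "c = j * (R + 1) + i" unfolding i_j_def by (rule div_mult_mod_eq[symmetric])
    have "i < R + 1" unfolding i_j_def by (rule mod_less_divisor) simp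
    then have i: "i \<le> R" by simp
    have j: "j < C + 2" unfolding i_j_def using c by (intro less_mult_imp_div_less) (simp add: mult.commute)
    have Ac: "A c = B i j" unfolding A_def i_j_def ..
    \<comment> \<open>This holds for every valid set of four vertices, so the table entries need no
      check of their own.\<close>
    have "tile_spec (cell_type i j) (B i j)"
      using props(2,3)[of i j] cell_type_less_6 by (intro tile_spec_if_card_le_4) (auto simp: B_def)
    moreover have "cell_dom A c a" if a: "a < 16" for a
    proof -
      have 0: "R + 1 \<le> c \<and> A (c - (R + 1)) = B i (j - 1)" if "0 < j"
      proof -
        have "c - (R + 1) = (j - 1) * (R + 1) + i" "R + 1 \<le> c" using that unfolding c_eq by (cases j; simp)+
        then show ?thesis using AB[OF i] by metis
      qed
      have 1: "c + (R + 1) < cells \<and> A (c + (R + 1)) = B i (j + 1)" if "j < C + 1"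
      proof -
        have "c + (R + 1) = (j + 1) * (R + 1) + i" unfolding c_eq by simp
        moreover have "j + 1 < C + 2" using that by simp
        ultimately show ?thesis using AB[OF i, of "j + 1"] cell_less[OF i, of "j + 1"] by metis
      qed
      have 2: "c mod (R + 1) \<noteq> 0 \<and> A (c - 1) = B (i - 1) j" if "i \<noteq> 0"
      proof -
        have "c - 1 = j * (R + 1) + (i - 1)" using that unfolding c_eq by simp
        then have "A (c - 1) = B (i - 1) j" using AB[of "i - 1" j] i by simp
        with that show ?thesis unfolding i_j_def by simp
      qed
      have "ty c = cell_type i j" unfolding ty_def i_j_def ..
      then show ?thesis using dom[OF i j a] 0 1 2 unfolding cell_dom_def Ac by metis
    qed
    ultimately show ?thesis
      using props(1,2)[of i j] unfolding Ac ty_def i_j_def[symmetric] by blast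
  qed
  then show ?thesis by blast
qed

theorem dominating_set_iff_sat:
  "(\<exists>S. dominating_set {..<nv} edges S \<and> card S = 4 * cells) \<longleftrightarrow> sat"
  unfolding ex_dominating_set_iff using solution_imp_sat sat_imp_solution by blast

end

section \<open>Computing the reduction\<close>

abbreviation pdec :: "nat \<Rightarrow> nat \<Rightarrow> nat \<Rightarrow> ((nat \<Rightarrow> nat) \<Rightarrow> (nat \<Rightarrow> nat) \<Rightarrow> bool) \<Rightarrow> bool" where
  "pdec ia ra k P \<equiv> pcomp ia ra k (\<lambda>I \<rho>. of_bool (P I \<rho>))"

lemma pdec_not: "pdec ia ra k P \<Longrightarrow> pdec ia ra k (\<lambda>I \<rho>. \<not> P I \<rho>)"
proof -
  assume P: "pdec ia ra k P"
  have "of_bool (\<not> P I \<rho>) = 1 - (of_bool (P I \<rho>) :: nat)" for I \<rho> by simp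
  then show ?thesis using P by (simp only:) (intro pcomp_sub pcomp_const; auto dest: pcomp_neq)
qed

lemma pdec_conj: "pdec ia ra k P \<Longrightarrow> pdec ia ra k P' \<Longrightarrow> pdec ia ra k (\<lambda>I \<rho>. P I \<rho> \<and> P' I \<rho>)"
  unfolding of_bool_conj by (rule pcomp_mult)

lemma pdec_disj: "pdec ia ra k P \<Longrightarrow> pdec ia ra k P' \<Longrightarrow> pdec ia ra k (\<lambda>I \<rho>. P I \<rho> \<or> P' I \<rho>)"
  using pdec_not[OF pdec_conj[OF pdec_not pdec_not]] by simp

lemma pdec_imp: "pdec ia ra k P \<Longrightarrow> pdec ia ra k P' \<Longrightarrow> pdec ia ra k (\<lambda>I \<rho>. P I \<rho> \<longrightarrow> P' I \<rho>)"
  unfolding imp_conv_disj by (intro pdec_disj pdec_not)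

lemma pdec_less: "pcomp ia ra k f \<Longrightarrow> pcomp ia ra k h \<Longrightarrow> pdec ia ra k (\<lambda>I \<rho>. f I \<rho> < h I \<rho>)"
  unfolding of_bool_less_eq_sub by (intro pcomp_sub pcomp_const) (auto dest: pcomp_neq)

lemma pdec_le: "pcomp ia ra k f \<Longrightarrow> pcomp ia ra k h \<Longrightarrow> pdec ia ra k (\<lambda>I \<rho>. f I \<rho> \<le> h I \<rho>)"
  unfolding not_less[symmetric] by (intro pdec_not pdec_less)

lemma pdec_eq: "pcomp ia ra k f \<Longrightarrow> pcomp ia ra k h \<Longrightarrow> pdec ia ra k (\<lambda>I \<rho>. f I \<rho> = h I \<rho>)"
  unfolding of_bool_eq_eq_sub by (intro pcomp_sub pcomp_add pcomp_const) (auto dest: pcomp_neq)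

lemma pcomp_if:
  assumes "pdec ia ra k P" "pcomp ia ra k f" "pcomp ia ra k h"
  shows "pcomp ia ra k (\<lambda>I \<rho>. if P I \<rho> then f I \<rho> else h I \<rho>)"
proof -
  have "(if P I \<rho> then f I \<rho> else h I \<rho>) = of_bool (P I \<rho>) * f I \<rho> + of_bool (\<not> P I \<rho>) * h I \<rho>" for I \<rho>
    by simp
  then show ?thesis using assms by (simp only:) (intro pcomp_add pcomp_mult pdec_not)
qed

lemma pdec_ex:
  assumes "pcomp ia ra k n"
    and "\<And>l x. k \<le> l \<Longrightarrow> pcomp ia ra l x \<Longrightarrow> pdec ia ra l (\<lambda>I \<rho>. P I \<rho> (x I \<rho>))"
  shows "pdec ia ra k (\<lambda>I \<rho>. \<exists>i<n I \<rho>. P I \<rho> i)"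
proof -
  have "(\<exists>i<n I \<rho>. P I \<rho> i) \<longleftrightarrow> 0 < (\<Sum>i<n I \<rho>. of_bool (P I \<rho> i) :: nat)" for I \<rho>
    by (auto simp: zero_less_iff_neq_zero)
  then show ?thesis
    using assms by (simp only:) (intro pdec_less pcomp_const pcomp_sum; auto dest: pcomp_neq)
qed

lemma pdec_all:
  assumes "pcomp ia ra k n"
    and "\<And>l x. k \<le> l \<Longrightarrow> pcomp ia ra l x \<Longrightarrow> pdec ia ra l (\<lambda>I \<rho>. P I \<rho> (x I \<rho>))"
  shows "pdec ia ra k (\<lambda>I \<rho>. \<forall>i<n I \<rho>. P I \<rho> i)"
proof -
  have "(\<forall>i<n I \<rho>. P I \<rho> i) \<longleftrightarrow> \<not> (\<exists>i<n I \<rho>. \<not> P I \<rho> i)" for I \<rho> by blast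
  then show ?thesis using assms by (simp only:) (intro pdec_not pdec_ex)
qed

text \<open>A value below a constant admits any function \<open>g\<close> by finite case
  distinction; this yields powers with bounded exponents and the adjacency table of the
  tiles.\<close>

lemma pcomp_table:
  assumes "pcomp ia ra k f" "\<And>I \<rho>. f I \<rho> < K"
  shows "pcomp ia ra k (\<lambda>I \<rho>. g (f I \<rho>))"
proof -
  have neq: "ia \<noteq> ra" using assms(1) by (rule pcomp_neq)
  have "pcomp ia ra k (\<lambda>I \<rho>. if f I \<rho> < K then g (f I \<rho>) else 0)"
  proof (induction K)
    case (Suc K)
    have "(if n < Suc K then g n else 0) = (if n < K then g n else 0) + of_bool (n = K) * g K" for n
      by (auto simp: less_Suc_eq)
    then show ?case using Suc by (simp only:) (intro pcomp_add pcomp_mult pdec_eq pcomp_const neq assms)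
  qed (simp add: pcomp_const neq)
  then show ?thesis using assms(2) by simp
qed

section \<open>Reading a CNF from its encoding\<close>

definition start :: "nat \<Rightarrow> (nat \<Rightarrow> nat) \<Rightarrow> nat \<Rightarrow> nat" where
  "start q I c = rec_nat 1 (\<lambda>_ r. r + 1 + 2 * min (I r) q) c"

text \<open>Truncation at \<open>q\<close>, here and in \<open>start\<close>, is exact on formulas
  of width at most \<open>q\<close>, and it keeps positions and lengths small enough for registers
  whatever the memory holds.\<close>

definition clause_len :: "nat \<Rightarrow> (nat \<Rightarrow> nat) \<Rightarrow> nat \<Rightarrow> nat" where
  "clause_len q I c = min (I (start q I c)) q"

definition lit_pos :: "nat \<Rightarrow> (nat \<Rightarrow> nat) \<Rightarrow> nat \<Rightarrow> nat \<Rightarrow> nat" where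
  "lit_pos q I c l = start q I c + 1 + 2 * l"

text \<open>Literal \<open>l\<close> of clause \<open>c\<close> has slot \<open>c * q + l\<close>;
  each clause owns \<open>q\<close> slots, those beyond its length staying empty.\<close>

definition occurs :: "nat \<Rightarrow> (nat \<Rightarrow> nat) \<Rightarrow> nat \<Rightarrow> bool" where
  "occurs q I k \<longleftrightarrow> k mod q < clause_len q I (k div q)"

definition occ_pos :: "nat \<Rightarrow> (nat \<Rightarrow> nat) \<Rightarrow> nat \<Rightarrow> nat" where
  "occ_pos q I k = lit_pos q I (k div q) (k mod q)"

definition first_occ :: "nat \<Rightarrow> (nat \<Rightarrow> nat) \<Rightarrow> nat \<Rightarrow> bool" where
  "first_occ q I k \<longleftrightarrow> occurs q I k \<and> \<not> (\<exists>k'<k. occurs q I k' \<and> I (occ_pos q I k') = I (occ_pos q I k))"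

definition num_vars :: "nat \<Rightarrow> (nat \<Rightarrow> nat) \<Rightarrow> nat" where
  "num_vars q I = (\<Sum>k<I 0 * q. of_bool (first_occ q I k))"

text \<open>The rank of a variable among all variables, obtained by comparing names only. Ranks are
  small enough for arithmetic, names need not be.\<close>

definition var_index :: "nat \<Rightarrow> (nat \<Rightarrow> nat) \<Rightarrow> nat \<Rightarrow> nat" where
  "var_index q I x = (\<Sum>k<I 0 * q. of_bool (first_occ q I k \<and> I (occ_pos q I k) < I x))"

definition input_fun :: "nat list \<Rightarrow> nat \<Rightarrow> nat" where
  "input_fun xs i = (if i < length xs then xs ! i else 0)"

lemma concat_nth:
  "c < length xss \<Longrightarrow> r < length (xss ! c) \<Longrightarrow>
     (\<Sum>d<c. length (xss ! d)) + r < length (concat xss) \<and>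
     concat xss ! ((\<Sum>d<c. length (xss ! d)) + r) = xss ! c ! r"
proof (induction xss arbitrary: c)
  case (Cons xs xss)
  show ?case
  proof (cases c)
    case (Suc b)
    then show ?thesis
      using Cons.IH[of b] Cons.prems by (simp add: sum.lessThan_Suc_shift nth_append del: sum.lessThan_Suc)
  qed (use Cons.prems in \<open>simp add: nth_append\<close>)
qed simp

definition enc_lit :: "literal \<Rightarrow> nat list" where
  "enc_lit = (\<lambda>(v, b). [v, of_bool b])"

definition enc_clause :: "literal list \<Rightarrow> nat list" where
  "enc_clause c = length c # concat (map enc_lit c)"

lemma length_concat_enc_lit: "length (concat (map enc_lit c)) = 2 * length c"
  by (induction c) (auto simp: enc_lit_def split: prod.splits)

lemma length_enc_clause: "length (enc_clause c) = 1 + 2 * length c"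
  by (simp add: enc_clause_def length_concat_enc_lit)

lemma enc_clause_nth:
  assumes "l < length c"
  shows "enc_clause c ! (1 + 2 * l) = fst (c ! l)" "enc_clause c ! (2 + 2 * l) = of_bool (snd (c ! l))"
proof -
  have "(\<Sum>d<l. length (map enc_lit c ! d)) = (\<Sum>d<l. 2)"
    using assms by (intro sum.cong) (auto simp: enc_lit_def split: prod.splits)
  then have "(\<Sum>d<l. length (map enc_lit c ! d)) = 2 * l" by simp
  with concat_nth[of l "map enc_lit c" 0] concat_nth[of l "map enc_lit c" 1] assms
  show "enc_clause c ! (1 + 2 * l) = fst (c ! l)" "enc_clause c ! (2 + 2 * l) = of_bool (snd (c ! l))"
    by (auto simp: enc_clause_def enc_lit_def split: prod.splits)
qed

lemma enc_cnf_eq: "enc_cnf F = length F # concat (map enc_clause F)"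
  by (simp add: enc_cnf_def enc_clause_def[abs_def] enc_lit_def)

locale encoded_cnf =
  fixes F :: cnf and q :: nat
  assumes F: "F \<in> q_cnf q" and q: "0 < q"
begin

definition I :: "nat \<Rightarrow> nat" where "I = input_fun (enc_cnf F)"

lemma length_le: "c < length F \<Longrightarrow> length (F ! c) \<le> q"
  using F by (auto simp: q_cnf_def)

lemma I_0: "I 0 = length F"
  by (simp add: I_def input_fun_def enc_cnf_eq)

lemma I_clause:
  assumes "c < length F" "r < 1 + 2 * length (F ! c)"
  shows "I (1 + (\<Sum>d<c. 1 + 2 * length (F ! d)) + r) = enc_clause (F ! c) ! r"
proof -
  have "(\<Sum>d<c. length (map enc_clause F ! d)) = (\<Sum>d<c. 1 + 2 * length (F ! d))"
    using assms(1) by (intro sum.cong) (auto simp: length_enc_clause)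
  with concat_nth[of c "map enc_clause F" r] assms
  show ?thesis by (simp add: I_def input_fun_def enc_cnf_eq length_enc_clause)
qed

lemma start_eq: "c \<le> length F \<Longrightarrow> start q I c = 1 + (\<Sum>d<c. 1 + 2 * length (F ! d))"
proof (induction c)
  case (Suc c)
  then have "start q I c = 1 + (\<Sum>d<c. 1 + 2 * length (F ! d))" by simp
  moreover have "I (1 + (\<Sum>d<c. 1 + 2 * length (F ! d))) = length (F ! c)"
    using I_clause[of c 0] Suc.prems by (simp add: enc_clause_def)
  ultimately have "start q I (Suc c) = 1 + (\<Sum>d<c. 1 + 2 * length (F ! d)) + 1 + 2 * length (F ! c)"
    using length_le[of c] Suc.prems by (simp add: start_def min_def)
  then show ?case by simp
qed (simp add: start_def)

lemma start_length: "start q I (length F) = length (enc_cnf F)"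
proof -
  have "length (concat (map enc_clause F)) = (\<Sum>c\<leftarrow>F. 1 + 2 * length c)"
    by (simp add: length_concat comp_def length_enc_clause)
  also have "\<dots> = (\<Sum>d<length F. 1 + 2 * length (F ! d))"
    by (simp add: sum_list_sum_nth atLeast0LessThan)
  finally show ?thesis using start_eq[of "length F"] by (simp add: enc_cnf_eq)
qed

lemma clause_len_eq: "c < length F \<Longrightarrow> clause_len q I c = length (F ! c)"
  using I_clause[of c 0] start_eq[of c] length_le[of c]
  by (simp add: clause_len_def enc_clause_def min_def)

lemma lit_pos_eq:
  assumes "c < length F" "l < length (F ! c)"
  shows "I (lit_pos q I c l) = fst (F ! c ! l)" "I (lit_pos q I c l + 1) = of_bool (snd (F ! c ! l))"
  using I_clause[of c "1 + 2 * l"] I_clause[of c "2 + 2 * l"] enc_clause_nth[OF assms(2)] start_eq[of c] assms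
  by (simp_all add: lit_pos_def ac_simps)

definition val :: "nat \<Rightarrow> nat" where "val k = I (occ_pos q I k)"

lemma val_occurrences: "val ` {k. k < length F * q \<and> occurs q I k} = cnf_vars F"
proof -
  have occ: "occurs q I k \<longleftrightarrow> k mod q < length (F ! (k div q))" "occurs q I k \<Longrightarrow> val k = fst (F ! (k div q) ! (k mod q))"
    if "k < length F * q" for k
  proof -
    have "k div q < length F" using that by (rule less_mult_imp_div_less)
    then show "occurs q I k \<longleftrightarrow> k mod q < length (F ! (k div q))"
      "occurs q I k \<Longrightarrow> val k = fst (F ! (k div q) ! (k mod q))"
      using clause_len_eq lit_pos_eq by (auto simp: occurs_def val_def occ_pos_def)
  qed
  show ?thesis
  proof
    show "val ` {k. k < length F * q \<and> occurs q I k} \<subseteq> cnf_vars F"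
    proof (clarify)
      fix k assume k: "k < length F * q" "occurs q I k"
      have "k div q < length F" using k(1) by (rule less_mult_imp_div_less)
      then show "val k \<in> cnf_vars F" using occ[OF k(1)] k(2) unfolding cnf_vars_def by (auto intro!: bexI[of _ "F ! (k div q)"])
    qed
    show "cnf_vars F \<subseteq> val ` {k. k < length F * q \<and> occurs q I k}"
    proof
      fix v assume "v \<in> cnf_vars F"
      then obtain c l where c: "c < length F" "l < length (F ! c)" "v = fst (F ! c ! l)"
        unfolding cnf_vars_def by (auto simp: in_set_conv_nth)
      define k where "k = c * q + l"
      have l: "l < q" using c length_le[of c] by simp
      then have k: "k div q = c" "k mod q = l" by (auto simp: k_def)
      have "k < Suc c * q" using l by (simp add: k_def)
      also have "\<dots> \<le> length F * q" using c(1) by (intro mult_right_mono) auto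
      finally have "k < length F * q" .
      with occ[OF this] k c show "v \<in> val ` {k. k < length F * q \<and> occurs q I k}" by (intro image_eqI[of _ _ k]) auto
    qed
  qed
qed

text \<open>Every variable has exactly one first slot, so \<open>val\<close> is a bijection from
  first occurrences to variables.\<close>

lemma card_vars:
  "(\<Sum>k<I 0 * q. of_bool (first_occ q I k \<and> P (val k))) = card {w \<in> cnf_vars F. P w}"
proof -
  let ?S = "{k. k < length F * q \<and> first_occ q I k \<and> P (val k)}"
  have inj: "inj_on val ?S"
    by (intro linorder_inj_onI) (auto simp: first_occ_def val_def)
  have img: "val ` ?S = {w \<in> cnf_vars F. P w}"
  proof
    show "val ` ?S \<subseteq> {w \<in> cnf_vars F. P w}"
      using val_occurrences by (auto simp: first_occ_def)
    show "{w \<in> cnf_vars F. P w} \<subseteq> val ` ?S"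
    proof
      fix w assume w: "w \<in> {w \<in> cnf_vars F. P w}"
      then obtain k where k: "k < length F * q \<and> occurs q I k \<and> val k = w"
        using val_occurrences by (auto simp: image_iff set_eq_iff) metis
      define k0 where "k0 = (LEAST k. k < length F * q \<and> occurs q I k \<and> val k = w)"
      have k0: "k0 < length F * q \<and> occurs q I k0 \<and> val k0 = w" unfolding k0_def by (rule LeastI[of _ k]) (rule k)
      have "\<not> (k' < length F * q \<and> occurs q I k' \<and> val k' = w)" if "k' < k0" for k'
        using not_less_Least that unfolding k0_def by blast
      then have "first_occ q I k0" using k0 unfolding first_occ_def val_def by auto
      then show "w \<in> val ` ?S" using k0 w by auto
    qed
  qed
  have "card {w \<in> cnf_vars F. P w} = card ?S"
    unfolding img[symmetric] by (rule card_image) (rule inj)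
  also have "?S = {k \<in> {..<I 0 * q}. first_occ q I k \<and> P (val k)}" unfolding I_0 by auto
  also have "card \<dots> = (\<Sum>k<I 0 * q. of_bool (first_occ q I k \<and> P (val k)))" by (simp add: Int_def)
  finally show ?thesis ..
qed

lemma num_vars_eq: "num_vars q I = card (cnf_vars F)"
  using card_vars[of "\<lambda>_. True"] by (simp add: num_vars_def)

lemma var_index_eq: "var_index q I x = card {w \<in> cnf_vars F. w < I x}"
  using card_vars[of "\<lambda>w. w < I x"] by (simp add: var_index_def val_def)

lemma finite_cnf_vars: "finite (cnf_vars F)"
  by (simp add: cnf_vars_def)

end

section \<open>Polynomial-time parsing\<close>

lemma pcomp_start:
  assumes "pcomp ia ra k a" shows "pcomp ia ra k (\<lambda>I \<rho>. start q I (a I \<rho>))"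
proof -
  obtain e where e: "\<And>Y I \<rho>. 2 \<le> Y \<Longrightarrow> admissible Y I \<Longrightarrow> (\<And>j. j < k \<Longrightarrow> \<rho> j \<le> Y) \<Longrightarrow> a I \<rho> \<le> Y ^ e"
    using pcomp_poly_bdd[OF assms] by blast
  have neq: "ia \<noteq> ra" using assms by (rule pcomp_neq)
  have le: "rec_nat 1 (\<lambda>_ r. r + 1 + 2 * min (I r) q) i \<le> 1 + i * (1 + 2 * q)" for I :: "nat \<Rightarrow> nat" and i
  proof (induction i)
    case (Suc i)
    have "min (I r) q \<le> q" for r by simp
    from this[of "rec_nat 1 (\<lambda>_ r. r + 1 + 2 * min (I r) q) i"] Suc show ?case by simp
  qed simp
  show ?thesis unfolding start_def
  proof (rule pcomp_rec[OF assms, where u = "\<lambda>Y. 1 + Y ^ e * (1 + 2 * q)"])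
    fix I \<rho> and Y i :: nat
    assume Y: "2 \<le> Y" "admissible Y I" "\<forall>j<k. \<rho> j \<le> Y" "i \<le> a I \<rho>"
    have "i \<le> Y ^ e" using e[OF Y(1,2)] Y(3,4) le_trans by blast
    then have "1 + i * (1 + 2 * q) \<le> 1 + Y ^ e * (1 + 2 * q)" by (intro add_left_mono mult_right_mono) auto
    with le show "rec_nat 1 (\<lambda>_ r. r + 1 + 2 * min (I r) q) i \<le> 1 + Y ^ e * (1 + 2 * q)"
      by (rule le_trans)
  qed (intro pcomp_const pcomp_add pcomp_mult pcomp_input_min poly_bdd_intros neq; assumption)+
qed

lemma pcomp_clause_len: "pcomp ia ra k a \<Longrightarrow> pcomp ia ra k (\<lambda>I \<rho>. clause_len q I (a I \<rho>))"
  unfolding clause_len_def by (intro pcomp_input_min pcomp_start)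

lemma pcomp_lit_pos:
  "pcomp ia ra k a \<Longrightarrow> pcomp ia ra k b \<Longrightarrow> pcomp ia ra k (\<lambda>I \<rho>. lit_pos q I (a I \<rho>) (b I \<rho>))"
  unfolding lit_pos_def by (intro pcomp_add pcomp_mult pcomp_start pcomp_const; (assumption | erule pcomp_neq))

lemma pdec_occurs: "pcomp ia ra k a \<Longrightarrow> pdec ia ra k (\<lambda>I \<rho>. occurs q I (a I \<rho>))"
  unfolding occurs_def
  by (intro pdec_less pcomp_mod pcomp_div pcomp_clause_len pcomp_const; (assumption | erule pcomp_neq))

lemma pcomp_occ_pos: "pcomp ia ra k a \<Longrightarrow> pcomp ia ra k (\<lambda>I \<rho>. occ_pos q I (a I \<rho>))"
  unfolding occ_pos_def
  by (intro pcomp_lit_pos pcomp_mod pcomp_div pcomp_const; (assumption | erule pcomp_neq))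

lemma pdec_first_occ: "pcomp ia ra k a \<Longrightarrow> pdec ia ra k (\<lambda>I \<rho>. first_occ q I (a I \<rho>))"
  unfolding first_occ_def
  by (intro pdec_conj pdec_not pdec_ex pdec_occurs pcomp_input_eq pcomp_occ_pos;
      (assumption | erule pcomp_lift, assumption))

lemma pcomp_num_vars: "ia \<noteq> ra \<Longrightarrow> pcomp ia ra k (\<lambda>I \<rho>. num_vars q I)"
  unfolding num_vars_def by (intro pcomp_sum pcomp_mult pcomp_head pcomp_const pdec_first_occ)

lemma pcomp_var_index:
  assumes "pcomp ia ra k a" shows "pcomp ia ra k (\<lambda>I \<rho>. var_index q I (a I \<rho>))"
proof -
  have neq: "ia \<noteq> ra" using assms by (rule pcomp_neq)
  show ?thesis unfolding var_index_def
    by (intro pcomp_sum pcomp_mult pcomp_head pcomp_const pdec_conj pdec_first_occ pcomp_input_less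
        pcomp_occ_pos pcomp_lift[OF assms] neq)
qed

lemma var_index_le: "var_index q I x \<le> num_vars q I"
  unfolding var_index_def num_vars_def by (intro sum_mono) auto

section \<open>The reduction for fixed parameters\<close>

locale reduction =
  fixes p b q :: nat
  assumes p: "0 < p" and b: "0 < b" and q: "0 < q" and bp: "2 ^ b \<le> (3 :: nat) ^ p"
begin

text \<open>The summand 1 makes room for an incomplete last group; it costs only \<open>p\<close>
  rows.\<close>

definition groups :: "(nat \<Rightarrow> nat) \<Rightarrow> nat" where
  "groups I = num_vars q I div b + 1"

definition lit_grp :: "(nat \<Rightarrow> nat) \<Rightarrow> nat \<Rightarrow> nat \<Rightarrow> nat" where
  "lit_grp I c l = var_index q I (lit_pos q I c l) div b"

definition lit_bit :: "(nat \<Rightarrow> nat) \<Rightarrow> nat \<Rightarrow> nat \<Rightarrow> nat" where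
  "lit_bit I c l = var_index q I (lit_pos q I c l) mod b"

definition lit_sgn :: "(nat \<Rightarrow> nat) \<Rightarrow> nat \<Rightarrow> nat \<Rightarrow> nat" where
  "lit_sgn I c l = min (I (lit_pos q I c l + 1)) 1"

definition rows :: "(nat \<Rightarrow> nat) \<Rightarrow> nat" where
  "rows I = clause_data.R (groups I) p"

definition cols :: "(nat \<Rightarrow> nat) \<Rightarrow> nat" where
  "cols I = clause_data.C (I 0) (groups I) p q"

definition cell_ty :: "(nat \<Rightarrow> nat) \<Rightarrow> nat \<Rightarrow> nat" where
  "cell_ty I = clause_data.ty (I 0) (groups I) p q (clause_len q I) (lit_grp I) (lit_bit I) (lit_sgn I)"

definition num_cells :: "(nat \<Rightarrow> nat) \<Rightarrow> nat" where
  "num_cells I = (cols I + 2) * (rows I + 1)"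

text \<open>Entry \<open>k\<close> of the encoded instance as a function of \<open>k\<close>, so the
  output can be written cell by cell without storing a graph. As the layout is \<open>Suc\<close>,
  its values are just \<open>k - n * n\<close>.\<close>

definition word :: "(nat \<Rightarrow> nat) \<Rightarrow> nat \<Rightarrow> nat" where
  "word I k = (let n = 16 * num_cells I; arc = tile_arc (rows I + 1) (cell_ty I) in
     if k = 0 then n
     else if k \<le> n * n then of_bool (arc ((k - 1) div n) ((k - 1) mod n) \<or> arc ((k - 1) mod n) ((k - 1) div n))
     else if k \<le> n * n + n then k - n * n
     else if k = n * n + n + 1 then 4 * num_cells I
     else 0)"

text \<open>Valid for every memory content, encoding or not: clause lengths are truncated at
  \<open>q\<close>, and ranks never exceed the number of variables.\<close>

lemma clause_tiles: "clause_tiles (I 0) (groups I) p q (clause_len q I) (lit_grp I)"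
proof
  fix c l
  have "lit_grp I c l \<le> num_vars q I div b"
    unfolding lit_grp_def by (intro div_le_mono var_index_le)
  then show "lit_grp I c l < groups I" unfolding groups_def by simp
qed (auto simp: p groups_def clause_len_def)


lemma pcomp_groups: "ia \<noteq> ra \<Longrightarrow> pcomp ia ra k (\<lambda>I \<rho>. groups I)"
  unfolding groups_def by (intro pcomp_add pcomp_div pcomp_num_vars pcomp_const)

lemma pcomp_rows: "ia \<noteq> ra \<Longrightarrow> pcomp ia ra k (\<lambda>I \<rho>. rows I)"
  unfolding rows_def clause_data.R_def by (intro pcomp_mult pcomp_groups pcomp_const)

lemma pcomp_cols: "ia \<noteq> ra \<Longrightarrow> pcomp ia ra k (\<lambda>I \<rho>. cols I)"
  unfolding cols_def clause_data.C_def rows_def[symmetric]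
  by (intro pcomp_mult pcomp_add pcomp_head pcomp_rows pcomp_const)

lemma pcomp_num_cells: "ia \<noteq> ra \<Longrightarrow> pcomp ia ra k (\<lambda>I \<rho>. num_cells I)"
  unfolding num_cells_def by (intro pcomp_mult pcomp_add pcomp_rows pcomp_cols pcomp_const)

lemma pcomp_lit_grp:
  "pcomp ia ra k x \<Longrightarrow> pcomp ia ra k y \<Longrightarrow> pcomp ia ra k (\<lambda>I \<rho>. lit_grp I (x I \<rho>) (y I \<rho>))"
  unfolding lit_grp_def
  by (intro pcomp_div pcomp_var_index pcomp_lit_pos pcomp_const; (assumption | erule pcomp_neq))

lemma pcomp_pow_lit_bit:
  "pcomp ia ra k x \<Longrightarrow> pcomp ia ra k y \<Longrightarrow> pcomp ia ra k (\<lambda>I \<rho>. 2 ^ lit_bit I (x I \<rho>) (y I \<rho>))"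
  unfolding lit_bit_def
  by (rule pcomp_table[where K = b and g = "\<lambda>n. 2 ^ n"], intro pcomp_mod pcomp_var_index pcomp_lit_pos pcomp_const;
      (assumption | erule pcomp_neq)?) (simp add: b)

lemma pcomp_lit_sgn:
  "pcomp ia ra k x \<Longrightarrow> pcomp ia ra k y \<Longrightarrow> pcomp ia ra k (\<lambda>I \<rho>. lit_sgn I (x I \<rho>) (y I \<rho>))"
  unfolding lit_sgn_def
  by (intro pcomp_input_min pcomp_add pcomp_lit_pos pcomp_const; (assumption | erule pcomp_neq))

lemma pcomp_block:
  assumes "pcomp ia ra k x" "pcomp ia ra k y"
  shows "pcomp ia ra k (\<lambda>I \<rho>. clause_data.block p q (x I \<rho>) (y I \<rho>))"
proof -
  have neq: "ia \<noteq> ra" using assms(1) by (rule pcomp_neq)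
  have "min n q = n - (n - q)" for n by simp
  then have "pcomp ia ra k (\<lambda>I \<rho>. min (y I \<rho>) q)"
    using assms by (simp only:) (intro pcomp_sub pcomp_const neq)
  then have "pcomp ia ra k (\<lambda>I \<rho>. (3 ^ p) ^ min (y I \<rho>) q)"
    by (rule pcomp_table[where K = "Suc q" and g = "\<lambda>n. (3 ^ p) ^ n"]) (simp add: min_def)
  then show ?thesis
    unfolding clause_data.block_def using assms by (intro pcomp_mod pcomp_div pcomp_const neq)
qed

lemma pdec_relevant:
  assumes "pcomp ia ra k x" "pcomp ia ra k y"
  shows "pdec ia ra k (\<lambda>I \<rho>. clause_data.relevant p q (clause_len q I) (lit_grp I) (lit_bit I) (lit_sgn I) (x I \<rho>) (y I \<rho>))"
proof -
  have neq: "ia \<noteq> ra" using assms(1) by (rule pcomp_neq)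
  show ?thesis
    unfolding clause_data.relevant_def
    by (intro pdec_conj pdec_all pdec_not pdec_imp pdec_eq pcomp_mod pcomp_div pcomp_block pcomp_pow_lit_bit
        pcomp_lit_sgn pcomp_lit_grp pcomp_clause_len pcomp_const neq;
        (assumption | rule pcomp_lift[OF assms(1)] pcomp_lift[OF assms(2)] | erule pcomp_lift)?; simp?)
qed

lemma pcomp_row_test:
  assumes "pcomp ia ra k x" "pcomp ia ra k y" "pcomp ia ra k z"
  shows "pcomp ia ra k (\<lambda>I \<rho>. clause_data.row_test p q (clause_len q I) (lit_grp I) (x I \<rho>) (y I \<rho>) (z I \<rho>))"
proof -
  have neq: "ia \<noteq> ra" using assms(1) by (rule pcomp_neq)
  have pow: "pcomp ia ra k (\<lambda>I \<rho>. 3 ^ (z I \<rho> mod p))"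
    by (rule pcomp_table[where K = p and g = "\<lambda>n. 3 ^ n"])
      (use p in \<open>auto intro!: pcomp_mod pcomp_const neq assms\<close>)
  show ?thesis
    unfolding clause_data.row_test_def
    by (intro pcomp_sum pdec_ex pdec_conj pdec_eq pdec_le pcomp_mod pcomp_div pcomp_block
        pcomp_lit_grp pcomp_clause_len pcomp_const neq;
        (assumption | rule pcomp_lift[OF assms(1)] pcomp_lift[OF assms(2)] pcomp_lift[OF assms(3)] pcomp_lift[OF pow] | erule pcomp_lift)?; simp?)
qed

lemma pcomp_cell_ty:
  assumes "pcomp ia ra k x" shows "pcomp ia ra k (\<lambda>I \<rho>. cell_ty I (x I \<rho>))"
proof -
  have neq: "ia \<noteq> ra" using assms(1) by (rule pcomp_neq)
  show ?thesis
    unfolding cell_ty_def clause_data.ty_def clause_data.cell_type_def rows_def[symmetric] cols_def[symmetric]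
    by (intro pcomp_if pdec_disj pdec_eq pdec_less pdec_relevant pcomp_row_test pcomp_mod pcomp_div pcomp_sub
        pcomp_add pcomp_head pcomp_rows pcomp_cols pcomp_const neq assms)
qed

lemma pdec_arc:
  assumes "pcomp ia ra k x" "pcomp ia ra k y"
  shows "pdec ia ra k (\<lambda>I \<rho>. tile_arc (rows I + 1) (cell_ty I) (x I \<rho>) (y I \<rho>))"
proof -
  have neq: "ia \<noteq> ra" using assms(1) by (rule pcomp_neq)
  \<comment> \<open>Tile type and both local vertex numbers packed into one number below 1536 = 6 *
    16 * 16, so that adjacency inside a tile becomes a table lookup.\<close>
  let ?code = "\<lambda>I \<rho>. (cell_ty I (x I \<rho> div 16) * 16 + x I \<rho> mod 16) * 16 + y I \<rho> mod 16"
  let ?P = "\<lambda>n. n mod 16 \<in> set (tile_nbrs (n div 16 div 16) ! (n div 16 mod 16))"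
  have aux: "(x * 16 + w mod 16) mod 16 = w mod 16" "(x * 16 + w mod 16) div 16 = x" for x w :: nat
    by simp_all
  have decode: "((t * 16 + u mod 16) * 16 + v mod 16) mod 16 = v mod 16"
    "((t * 16 + u mod 16) * 16 + v mod 16) div 16 div 16 = t"
    "((t * 16 + u mod 16) * 16 + v mod 16) div 16 mod 16 = u mod 16" for t u v :: nat
    unfolding aux by (rule refl)+
  have less: "cell_ty I c < 6" for I c
    unfolding cell_ty_def clause_data.ty_def by (rule clause_data.cell_type_less_6)
  have "(t * 16 + u) * 16 + v < 1536" if "t < 6" "u < 16" "v < 16" for t u v :: nat
    using that by presburger
  from this[OF less] have "?code I \<rho> < 1536" for I \<rho>
    by (meson mod_less_divisor zero_less_numeral)
  moreover have "pcomp ia ra k ?code"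
    by (intro pcomp_add pcomp_mult pcomp_cell_ty pcomp_div pcomp_mod pcomp_const neq assms)
  ultimately have "pdec ia ra k (\<lambda>I \<rho>. ?P (?code I \<rho>))"
    by (intro pcomp_table[where K = 1536 and g = "\<lambda>n. of_bool (?P n)"])
  then have "pdec ia ra k (\<lambda>I \<rho>. y I \<rho> mod 16 \<in> set (tile_nbrs (cell_ty I (x I \<rho> div 16)) ! (x I \<rho> mod 16)))"
    by (simp only: decode)
  then show ?thesis
    unfolding tile_arc_def
    by (intro pdec_disj pdec_conj pdec_eq pdec_not pcomp_add pcomp_div pcomp_mod pcomp_rows pcomp_const neq assms)
qed

lemma pcomp_word:
  assumes "pcomp ia ra k x" shows "pcomp ia ra k (\<lambda>I \<rho>. word I (x I \<rho>))"
proof -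
  have neq: "ia \<noteq> ra" using assms by (rule pcomp_neq)
  show ?thesis
    unfolding word_def Let_def
    by (intro pcomp_if pdec_eq pdec_le pdec_disj pdec_arc pcomp_add pcomp_sub pcomp_mult pcomp_div pcomp_mod
        pcomp_num_cells pcomp_const neq assms)
qed

end

section \<open>The encoded instance, entry by entry\<close>

lemma concat_map_upt_nth:
  assumes "k < n * n"
  shows "concat (map (\<lambda>u. map (f u) [0..<n]) [0..<n]) ! k = f (k div n) (k mod n)"
proof -
  let ?xss = "map (\<lambda>u. map (f u) [0..<n]) [0..<n]"
  have n: "0 < n" using assms by (cases n) auto
  have u: "k div n < n" using assms by (rule less_mult_imp_div_less)
  have "(\<Sum>d<k div n. length (?xss ! d)) = (\<Sum>d<k div n. n)" using u by (intro sum.cong) auto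
  then have "(\<Sum>d<k div n. length (?xss ! d)) + k mod n = k" by simp
  then show ?thesis
    using concat_nth[of "k div n" ?xss "k mod n"] u n by simp
qed

lemma length_enc_ds: "length (enc_ds (n, E, \<pi>, t)) = n * n + n + 2"
proof -
  have "(\<Sum>u\<leftarrow>[0..<n]. n) = n * n" by (simp add: sum_list_triv)
  then show ?thesis by (simp add: length_concat comp_def)
qed

lemma enc_ds_nth:
  assumes "k < n * n + n + 2"
  shows "enc_ds (n, E, \<pi>, t) ! k =
    (if k = 0 then n else if k \<le> n * n then of_bool ({(k - 1) div n, (k - 1) mod n} \<in> E)
     else if k \<le> n * n + n then \<pi> (k - 1 - n * n) else t)"
proof -
  define M :: "nat list" where "M = concat (map (\<lambda>u. map (\<lambda>v. of_bool ({u, v} \<in> E)) [0..<n]) [0..<n])"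
  have enc: "enc_ds (n, E, \<pi>, t) = n # M @ map \<pi> [0..<n] @ [t]" by (simp add: M_def)
  have len: "length M = n * n"
    by (simp add: M_def length_concat comp_def sum_list_triv)
  have M: "M ! j = of_bool ({j div n, j mod n} \<in> E)" if "j < n * n" for j
    unfolding M_def using that by (rule concat_map_upt_nth)
  show ?thesis
  proof (cases k)
    case (Suc j)
    consider "j < n * n" | "n * n \<le> j" "j < n * n + n" | "j = n * n + n"
      using assms Suc by linarith
    then show ?thesis unfolding enc Suc
      by cases (auto simp: nth_append len M)
  qed (simp add: enc)
qed

context reduction
begin

definition instance_of :: "(nat \<Rightarrow> nat) \<Rightarrow> ds_instance" where
  "instance_of I = (16 * num_cells I, tile_edges (rows I + 1) (cell_ty I) (16 * num_cells I), Suc, 4 * num_cells I)"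

definition word_count :: "(nat \<Rightarrow> nat) \<Rightarrow> nat" where
  "word_count I = 16 * num_cells I * (16 * num_cells I) + 16 * num_cells I + 2"

lemma length_enc_instance: "length (enc_ds (instance_of I)) = word_count I"
  unfolding instance_of_def word_count_def by (rule length_enc_ds)

lemma word_eq: "word I k = input_fun (enc_ds (instance_of I)) k"
proof -
  define n where "n = 16 * num_cells I"
  show ?thesis
  proof (cases "k < n * n + n + 2")
    case True
    have edge: "tile_arc (rows I + 1) (cell_ty I) ((k - 1) div n) ((k - 1) mod n) \<or>
        tile_arc (rows I + 1) (cell_ty I) ((k - 1) mod n) ((k - 1) div n) \<longleftrightarrow>
        {(k - 1) div n, (k - 1) mod n} \<in> tile_edges (rows I + 1) (cell_ty I) n" if "k \<noteq> 0" "k \<le> n * n"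
    proof -
      have "0 < n" using that by (cases n) auto
      moreover have "(k - 1) div n < n" using that by (intro less_mult_imp_div_less) simp
      ultimately show ?thesis by (intro edge_iff[symmetric]) auto
    qed
    have "input_fun (enc_ds (instance_of I)) k = enc_ds (instance_of I) ! k"
      unfolding input_fun_def instance_of_def length_enc_ds n_def[symmetric] using True by simp
    also have "\<dots> = (if k = 0 then n else if k \<le> n * n
        then of_bool ({(k - 1) div n, (k - 1) mod n} \<in> tile_edges (rows I + 1) (cell_ty I) n)
       else if k \<le> n * n + n then Suc (k - 1 - n * n) else 4 * num_cells I)"
      unfolding instance_of_def n_def[symmetric] by (rule enc_ds_nth) (rule True)
    also have "\<dots> = word I k"
      unfolding word_def Let_def n_def[symmetric] using True edge by auto
    finally show ?thesis ..
  next
    case False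
    then show ?thesis
      unfolding word_def Let_def input_fun_def instance_of_def length_enc_ds n_def[symmetric] by auto
  qed
qed

lemma instance_in: "instance_of I \<in> planar_ds_instances"
  and cutwidth_instance: "ds_cutwidth (instance_of I) \<le> p * (num_vars q I div b + 1) + 260"
proof -
  interpret tiles: clause_tiles "I 0" "groups I" p q "clause_len q I" "lit_grp I" "lit_bit I" "lit_sgn I"
    by (rule clause_tiles)
  show "instance_of I \<in> planar_ds_instances"
    unfolding planar_ds_instances_def instance_of_def num_cells_def rows_def cols_def cell_ty_def
    using tiles.simple tiles.planar_edges tiles.linear_layout_Suc by blast
  \<comment> \<open>The bottom row adds 1 to the number of rows, whence 260 = 259 + 1.\<close>
  have "ds_cutwidth (instance_of I) \<le> tiles.R + 1 + 259"
    using tiles.cutwidth_le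
    unfolding instance_of_def num_cells_def rows_def cols_def cell_ty_def ds_cutwidth.simps .
  moreover have "tiles.R = p * (num_vars q I div b + 1)" unfolding clause_data.R_def groups_def ..
  ultimately show "ds_cutwidth (instance_of I) \<le> p * (num_vars q I div b + 1) + 260" by linarith
qed

lemma has_dominating_set_iff_sat:
  "has_dominating_set (instance_of I) \<longleftrightarrow>
     (\<exists>N. (\<forall>g<groups I. N g < 3 ^ p) \<and>
       (\<forall>c<I 0. \<exists>l<clause_len q I c. N (lit_grp I c l) div 2 ^ lit_bit I c l mod 2 = lit_sgn I c l))"
proof -
  interpret tiles: clause_tiles "I 0" "groups I" p q "clause_len q I" "lit_grp I" "lit_bit I" "lit_sgn I"
    by (rule clause_tiles)
  show ?thesis
    using tiles.dominating_set_iff_sat unfolding tiles.sat_def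
    unfolding instance_of_def num_cells_def rows_def cols_def cell_ty_def has_dominating_set.simps .
qed

text \<open>The variable of rank \<open>i\<close> is bit \<open>i mod b\<close> of group
  \<open>i div b\<close>. Reading bits turns any group values below \<open>3 ^ p\<close> into an
  assignment; conversely the bits of an assignment give values below \<open>2 ^ b\<close>, which fit
  because of \<open>bp\<close>.\<close>

lemma has_dominating_set_iff_satisfiable:
  assumes F: "F \<in> q_cnf q"
  shows "has_dominating_set (instance_of (input_fun (enc_cnf F))) \<longleftrightarrow> satisfiable F"
proof -
  interpret encoded_cnf F q by standard (use F q in auto)
  define idx where "idx = (\<lambda>v. card {w \<in> cnf_vars F. w < v})"
  have idx_inj: "inj_on idx (cnf_vars F)"
  proof (rule linorder_inj_onI)
    fix v w assume "v < w" "v \<in> cnf_vars F" "w \<in> cnf_vars F"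
    then have "{u \<in> cnf_vars F. u < v} \<subset> {u \<in> cnf_vars F. u < w}" by auto
    then have "idx v < idx w" unfolding idx_def using finite_cnf_vars by (intro psubset_card_mono) auto
    then show "idx v \<noteq> idx w" by simp
  qed (rule linear)
  have lit: "lit_grp I c l = idx (fst (F ! c ! l)) div b" "lit_bit I c l = idx (fst (F ! c ! l)) mod b"
    "lit_sgn I c l = of_bool (snd (F ! c ! l))" "fst (F ! c ! l) \<in> cnf_vars F"
    if "c < length F" "l < length (F ! c)" for c l
  proof -
    show "lit_grp I c l = idx (fst (F ! c ! l)) div b" "lit_bit I c l = idx (fst (F ! c ! l)) mod b"
      "lit_sgn I c l = of_bool (snd (F ! c ! l))"
      unfolding lit_grp_def lit_bit_def lit_sgn_def var_index_eq lit_pos_eq[OF that] idx_def by auto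
    show "fst (F ! c ! l) \<in> cnf_vars F"
      unfolding cnf_vars_def using that by (intro UN_I[of "F ! c"] imageI) auto
  qed
  have sat: "satisfiable F \<longleftrightarrow> (\<exists>\<alpha>. \<forall>c<length F. \<exists>l<length (F ! c). \<alpha> (fst (F ! c ! l)) = snd (F ! c ! l))"
  proof -
    have "(\<exists>x\<in>set c. P x) \<longleftrightarrow> (\<exists>l<length c. P (c ! l))" for c :: "literal list" and P
      by (metis in_set_conv_nth)
    then show ?thesis unfolding satisfiable_def all_set_conv_all_nth case_prod_beta by simp
  qed
  define val :: "(nat \<Rightarrow> nat) \<Rightarrow> nat \<Rightarrow> nat" where
    "val = (\<lambda>N v. N (idx v div b) div 2 ^ (idx v mod b) mod 2)"
  define good where "good = (\<lambda>N c. \<exists>l<length (F ! c). val N (fst (F ! c ! l)) = of_bool (snd (F ! c ! l)))"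
  have eq: "(\<exists>l<clause_len q I c. N (lit_grp I c l) div 2 ^ lit_bit I c l mod 2 = lit_sgn I c l) \<longleftrightarrow> good N c" if "c < length F" for c and N :: "nat \<Rightarrow> nat"
    unfolding clause_len_eq[OF that] good_def val_def by (intro ex_cong1 conj_cong refl) (simp only: lit[OF that])
  have "has_dominating_set (instance_of I) \<longleftrightarrow> (\<exists>N :: nat \<Rightarrow> nat. (\<forall>g<groups I. N g < 3 ^ p) \<and> (\<forall>c<length F. good N c))"
    unfolding has_dominating_set_iff_sat I_0 by (simp only: eq cong: conj_cong all_cong)
  also have "\<dots> \<longleftrightarrow> satisfiable F"
  proof
    assume "\<exists>N :: nat \<Rightarrow> nat. (\<forall>g<groups I. N g < 3 ^ p) \<and> (\<forall>c<length F. good N c)"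
    then obtain N :: "nat \<Rightarrow> nat" where N: "\<And>c. c < length F \<Longrightarrow> good N c"
      by blast
    define \<alpha> where "\<alpha> = (\<lambda>v. val N v = 1)"
    have "\<exists>l<length (F ! c). \<alpha> (fst (F ! c ! l)) = snd (F ! c ! l)" if c: "c < length F" for c
    proof -
      obtain l where l: "l < length (F ! c)"
        "val N (fst (F ! c ! l)) = of_bool (snd (F ! c ! l))"
        using N[OF c] unfolding good_def by blast
      then have "\<alpha> (fst (F ! c ! l)) = snd (F ! c ! l)" unfolding \<alpha>_def by (simp only: l(2)) simp
      with l(1) show ?thesis by blast
    qed
    then show "satisfiable F" unfolding sat by blast
  next
    assume "satisfiable F"
    then obtain \<alpha> where \<alpha>: "\<And>c. c < length F \<Longrightarrow> \<exists>l<length (F ! c). \<alpha> (fst (F ! c ! l)) = snd (F ! c ! l)"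
      unfolding sat by blast
    \<comment> \<open>Bit \<open>k\<close> of group \<open>g\<close> is the truth value of the
      variable of rank \<open>g * b + k\<close>, and 0 if no variable has that rank.\<close>
    define N :: "nat \<Rightarrow> nat" where
      "N = (\<lambda>g. \<Sum>k<b. of_bool (\<exists>v\<in>cnf_vars F. idx v = g * b + k \<and> \<alpha> v) * 2 ^ k)"
    have N: "N g < 3 ^ p" for g
    proof -
      have "N g < 2 ^ b" unfolding N_def by (rule digit_sum_less) auto
      then show ?thesis using bp by linarith
    qed
    have digit: "val N v = of_bool (\<alpha> v)" if v: "v \<in> cnf_vars F" for v
    proof -
      have "val N v = of_bool (\<exists>w\<in>cnf_vars F. idx w = idx v div b * b + idx v mod b \<and> \<alpha> w)"
        unfolding val_def N_def by (rule digit_sum_digit) (use b in auto)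
      also have "(\<exists>w\<in>cnf_vars F. idx w = idx v div b * b + idx v mod b \<and> \<alpha> w) \<longleftrightarrow> \<alpha> v"
        using v idx_inj unfolding div_mult_mod_eq by (auto dest: inj_onD)
      finally show ?thesis .
    qed
    show "\<exists>N :: nat \<Rightarrow> nat. (\<forall>g<groups I. N g < 3 ^ p) \<and> (\<forall>c<length F. good N c)"
    proof (intro exI[of _ N] conjI allI impI N)
      fix c assume c: "c < length F"
      then obtain l where l: "l < length (F ! c)" "\<alpha> (fst (F ! c ! l)) = snd (F ! c ! l)" using \<alpha> by blast
      show "good N c"
        using l digit[OF lit(4)[OF c l(1)]] unfolding good_def by (intro exI[of _ l]) simp
    qed
  qed
  finally show ?thesis unfolding I_def .
qed

end

section \<open>Running an algorithm on the output of a reduction\<close>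

lemma input_memory_eq: "input_memory xs = (\<lambda>_ _. 0)(0 := input_fun xs)"
  by (auto simp: input_memory_def input_fun_def fun_eq_iff)

text \<open>The input is copied to a fresh array, array 0 is overwritten by the output computed from
  the copy, and \<open>c\<close> follows. The assumptions range over all \<open>ia\<close> and
  \<open>ra\<close> because the fresh arrays depend on \<open>c\<close> and the input length is
  first computed from array 0. Since \<open>ilen \<le> olen\<close>, writing \<open>olen\<close>
  cells leaves nothing of the old input.\<close>

lemma reduction_program:
  assumes ilen: "\<And>ia ra. ia \<noteq> ra \<Longrightarrow> pcomp ia ra 0 (\<lambda>I _. ilen I)"
    and olen: "\<And>ia ra. ia \<noteq> ra \<Longrightarrow> pcomp ia ra 0 (\<lambda>I _. olen I)"
    and out: "\<And>ia ra. ia \<noteq> ra \<Longrightarrow> pcomp ia ra 2 (\<lambda>I \<rho>. out I (\<rho> 1))"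
  obtains c' t where "poly_bdd t"
    "\<And>xs ys Y T s. 2 \<le> Y \<Longrightarrow> admissible Y (input_fun xs) \<Longrightarrow>
       length xs \<le> ilen (input_fun xs) \<Longrightarrow> ilen (input_fun xs) \<le> olen (input_fun xs) \<Longrightarrow>
       length ys \<le> olen (input_fun xs) \<Longrightarrow> (\<And>k. out (input_fun xs) k = input_fun ys k) \<Longrightarrow>
       exec c (input_memory ys) T s \<Longrightarrow>
       \<exists>T' s'. exec c' (input_memory xs) T' s' \<and> s' 0 0 = s 0 0 \<and> T' \<le> t Y + T"
proof -
  \<comment> \<open>Larger than 0 and every array of \<open>c\<close>, so neither the copy nor the
    registers can influence \<open>c\<close>.\<close>
  define ib where "ib = Suc (Max (insert 0 (com_arrays c)))"
  define ra where "ra = Suc ib"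
  have ib: "a < ib" if "a \<in> insert 0 (com_arrays c)" for a
    unfolding ib_def using that finite_com_arrays by (intro le_imp_less_Suc Max_ge) auto
  have neq: "0 \<noteq> ib" "0 \<noteq> ra" "ib \<noteq> ra" "ib \<noteq> 0" "ra \<noteq> 0" "ra \<noteq> ib" by (auto simp: ib_def ra_def)
  obtain c1 e1 where c1: "computes_at 0 ra 0 (\<lambda>I _. ilen I) c1 (\<lambda>Y. Y ^ e1)"
    using pcompE[OF ilen order_refl] neq(2) by metis
  obtain c2 e2 where c2: "computes_at ib ra 0 (\<lambda>I _. olen I) c2 (\<lambda>Y. Y ^ e2)"
    using pcompE[OF olen order_refl] neq(3) by metis
  obtain c3 e3 where c3: "computes_at ib ra 2 (\<lambda>I \<rho>. out I (\<rho> 1)) c3 (\<lambda>Y. Y ^ e3)"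
    using pcompE[OF out order_refl] neq(3) by metis
  define R where "R = (\<lambda>j. Get ra (Const j))"
  define test where "test = Sub (R 0) (R 1)"
  define zero where "zero = Put ra (Const 1) (Const 0)"
  define incr where "incr = Put ra (Const 1) (Add (R 1) (Const 1))"
  define copy where "copy = Seq (Put ib (R 1) (Get 0 (R 1))) incr"
  \<comment> \<open>Registers 0 and 1 hold the loop bound and the counter, hence \<open>out\<close>
    is computed at level 2.\<close>
  define emit where "emit = Seq c3 (Seq (Put 0 (R 1) (R 2)) incr)"
  define c' where "c' = Seq (Seq c1 (Seq zero (While test copy))) (Seq (Seq c2 (Seq zero (While test emit))) c)"
  define mem :: "(nat \<Rightarrow> nat) \<Rightarrow> (nat \<Rightarrow> nat) \<Rightarrow> (nat \<Rightarrow> nat) \<Rightarrow> memory" where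
    "mem = (\<lambda>a b r. (\<lambda>_ _. 0)(0 := a, ib := b, ra := r))"
  have mem [simp]: "mem a b r 0 = a" "mem a b r ib = b" "mem a b r ra = r"
    "(mem a b r)(0 := a') = mem a' b r" "(mem a b r)(ib := b') = mem a b' r" "(mem a b r)(ra := r') = mem a b r'"
    for a b r a' b' r'
    using neq unfolding mem_def by (auto simp: fun_eq_iff)
  have zero: "exec zero (mem a b r) (Suc (log_cost 1 + log_cost 0)) (mem a b (r(1 := 0)))" for a b r
    using exec.Put[of ra "Const 1" "Const 0" "mem a b r"] by (simp add: zero_def)
  define icost where "icost = (\<lambda>i. Suc (log_cost 1 + (log_cost 1 + log_cost i + log_cost 1 + log_cost (i + 1))))"
  have incr: "exec incr (mem a b r) (icost (r 1)) (mem a b (r(1 := r 1 + 1)))" for a b r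
    using exec.Put[of ra "Const 1" "Add (R 1) (Const 1)" "mem a b r"] by (simp add: incr_def R_def icost_def)
  have rcost_R: "rcost (R j) (mem a b r) \<le> j + 1 + (r j + 1)" for a b r j
    using log_cost_le[of j] log_cost_le[of "r j"] by (simp add: R_def)
  have rval_R: "rval (R j) (mem a b r) = r j" for a b r j by (simp add: R_def)
  have test: "(rval test (mem a b r) \<noteq> 0 \<longleftrightarrow> i < n) \<and> rcost test (mem a b r) \<le> 3 * n + 6"
    if "r 0 = n" "r 1 = i" "i \<le> n" for a b r i n
    using that rcost_R[of 0 a b r] rcost_R[of 1 a b r] log_cost_le[of "n - i"]
    by (auto simp add: test_def rval_R)
  have incr_le: "icost i \<le> 2 * n + 10" if "i < n" for i n
    using that log_cost_le[of 1] log_cost_le[of i] log_cost_le[of "i + 1"] by (simp add: icost_def)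
  define L where "L = (\<lambda>Y::nat. Y ^ e1 + Y ^ e2)"
  define t where "t = (\<lambda>Y. (L Y + (5 + Suc (L Y) * ((Y + 4 * L Y + 20) + (3 * L Y + 6) + 1))) +
     (L Y + (5 + Suc (L Y) * (((Y + L Y) ^ e3 + ((Y + L Y) ^ e3 + 4 * L Y + 20)) + (3 * L Y + 6) + 1))))"
  have "poly_bdd t" unfolding t_def L_def by (intro poly_bdd_intros)
  moreover have "\<exists>T' s'. exec c' (input_memory xs) T' s' \<and> s' 0 0 = s 0 0 \<and> T' \<le> t Y + T"
    if Y: "2 \<le> Y" "admissible Y (input_fun xs)" and
      len: "length xs \<le> ilen (input_fun xs)" "ilen (input_fun xs) \<le> olen (input_fun xs)" "length ys \<le> olen (input_fun xs)"
      and out_eq: "\<And>k. out (input_fun xs) k = input_fun ys k"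
      and ex: "exec c (input_memory ys) T s" for xs ys Y T s
  proof -
    define X where "X = input_fun xs"
    define n where "n = ilen X"
    define m where "m = olen X"
    have X0: "X k = 0" if "n \<le> k" for k using that len(1) unfolding X_def n_def input_fun_def by auto
    have adm: "admissible Y (mem a X r ib)" "admissible Y (mem X b r 0)" for a b r using Y(2) by (simp_all add: X_def)
    have s0: "input_memory xs = mem X (\<lambda>_. 0) (\<lambda>_. 0)"
      unfolding input_memory_eq mem_def X_def using neq by (auto simp: fun_eq_iff)

    obtain T1 r1 where r1: "n \<le> Y ^ e1" "exec c1 (input_memory xs) T1 (mem X (\<lambda>_. 0) r1)" "r1 0 = n" "T1 \<le> Y ^ e1"
      using computes_atE[where s = "mem X (\<lambda>_. 0) (\<lambda>_. 0)", OF c1 Y(1) adm(2)] unfolding s0 n_def by auto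
    have nL: "n \<le> L Y" using r1(1) by (simp add: L_def)
    define Inv1 where "Inv1 = (\<lambda>i s. \<exists>r. s = mem X (\<lambda>k. if k < i then X k else 0) r \<and> r 0 = n \<and> r 1 = i)"
    have "\<exists>T s'. exec (While test copy) (mem X (\<lambda>_. 0) (r1(1 := 0))) T s' \<and> Inv1 n s' \<and>
        T \<le> Suc n * ((Y + 4 * n + 20) + (3 * n + 6) + 1)"
    proof (rule exec_while_for)
      show "Inv1 0 (mem X (\<lambda>_. 0) (r1(1 := 0)))"
        unfolding Inv1_def using r1(3) by (intro exI[of _ "r1(1 := 0)"]) simp
    next
      fix i s' assume "i \<le> n" "Inv1 i s'"
      then show "(rval test s' \<noteq> 0 \<longleftrightarrow> i < n) \<and> rcost test s' \<le> 3 * n + 6"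
        unfolding Inv1_def using test by blast
    next
      fix i s' assume i: "i < n" and "Inv1 i s'"
      then obtain r where r: "s' = mem X (\<lambda>k. if k < i then X k else 0) r" "r 0 = n" "r 1 = i"
        unfolding Inv1_def by blast
      let ?b = "(\<lambda>k. if k < i then X k else 0)(i := X i)"
      have b: "?b = (\<lambda>k. if k < Suc i then X k else 0)" by auto
      have 1: "exec (Put ib (R 1) (Get 0 (R 1))) s' (Suc (rcost (R 1) s' + rcost (Get 0 (R 1)) s')) (mem X ?b r)"
        using exec.Put[of ib "R 1" "Get 0 (R 1)" s'] r by (simp add: rval_R)
      have "exec copy s' (Suc (rcost (R 1) s' + rcost (Get 0 (R 1)) s') + icost (r 1)) (mem X ?b (r(1 := r 1 + 1)))"
        unfolding copy_def using 1 incr by (rule exec.Seq)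
      moreover have "Inv1 (Suc i) (mem X ?b (r(1 := r 1 + 1)))"
        unfolding Inv1_def b using r by (intro exI[of _ "r(1 := r 1 + 1)"]) simp
      moreover have "log_cost (X i) \<le> Y" using Y(2) by (simp add: X_def admissible_def)
      then have "rcost (Get 0 (R 1)) s' \<le> rcost (R 1) s' + Y" using r by (simp add: rval_R)
      then have "Suc (rcost (R 1) s' + rcost (Get 0 (R 1)) s') + icost (r 1) \<le> Y + 4 * n + 20"
        using rcost_R[of 1 X "\<lambda>k. if k < i then X k else 0" r] incr_le[OF i] i unfolding r by linarith
      ultimately show "\<exists>T s''. exec copy s' T s'' \<and> Inv1 (Suc i) s'' \<and> T \<le> Y + 4 * n + 20" by blast
    qed
    then obtain T2 r2 where r2: "exec (While test copy) (mem X (\<lambda>_. 0) (r1(1 := 0))) T2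
        (mem X (\<lambda>k. if k < n then X k else 0) r2)" "T2 \<le> Suc n * ((Y + 4 * n + 20) + (3 * n + 6) + 1)"
      unfolding Inv1_def by blast
    have X_eq: "(\<lambda>k. if k < n then X k else 0) = X" using X0 by (auto simp: fun_eq_iff)
    have phase1: "exec (Seq c1 (Seq zero (While test copy))) (input_memory xs)
        (T1 + (Suc (log_cost 1 + log_cost 0) + T2)) (mem X X r2)"
      using r1(2) zero r2(1)[unfolded X_eq] by (intro exec.Seq)

    obtain T3 r3 where r3: "m \<le> Y ^ e2" "exec c2 (mem X X r2) T3 (mem X X r3)" "r3 0 = m" "T3 \<le> Y ^ e2"
      using computes_atE[where s = "mem X X r2", OF c2 Y(1) adm(1)] unfolding m_def by auto
    have mL: "m \<le> L Y" using r3(1) by (simp add: L_def)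
    define D where "D = (Y + L Y) ^ e3"
    define Inv2 where "Inv2 = (\<lambda>i s. \<exists>r. s = mem (\<lambda>k. if k < i then out X k else X k) X r \<and> r 0 = m \<and> r 1 = i)"
    have "\<exists>T s'. exec (While test emit) (mem X X (r3(1 := 0))) T s' \<and> Inv2 m s' \<and>
        T \<le> Suc m * ((D + (D + 4 * m + 20)) + (3 * m + 6) + 1)"
    proof (rule exec_while_for)
      show "Inv2 0 (mem X X (r3(1 := 0)))"
        unfolding Inv2_def using r3(3) by (intro exI[of _ "r3(1 := 0)"]) simp
    next
      fix i s' assume "i \<le> m" "Inv2 i s'"
      then show "(rval test s' \<noteq> 0 \<longleftrightarrow> i < m) \<and> rcost test s' \<le> 3 * m + 6"
        unfolding Inv2_def using test by blast
    next
      fix i s' assume i: "i < m" and "Inv2 i s'"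
      then obtain r where r: "s' = mem (\<lambda>k. if k < i then out X k else X k) X r" "r 0 = m" "r 1 = i"
        unfolding Inv2_def by blast
      let ?a = "\<lambda>k. if k < i then out X k else X k"
      have "admissible (Y + L Y) (mem ?a X r ib)" using adm(1) by (rule admissible_mono) simp
      moreover have "mem ?a X r ra j \<le> Y + L Y" if "j < 2" for j
      proof -
        have "j = 0 \<or> j = 1" using that by auto
        then show ?thesis using r(2,3) i mL by auto
      qed
      moreover have "2 \<le> Y + L Y" using Y(1) by simp
      ultimately obtain T r' where c3_run: "out (mem ?a X r ib) (mem ?a X r ra 1) \<le> D"
          "exec c3 (mem ?a X r) T ((mem ?a X r)(ra := r'))" "r' 2 = out (mem ?a X r ib) (mem ?a X r ra 1)"
          "\<And>j. j < 2 \<Longrightarrow> r' j = mem ?a X r ra j" "T \<le> D"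
        using computes_atE[where s = "mem ?a X r", OF c3, of "Y + L Y"] unfolding D_def by blast
      have r': "exec c3 s' T (mem ?a X r')" "r' 2 = out X i" "r' 0 = m" "r' 1 = i" "T \<le> D" "out X i \<le> D"
        using c3_run(1-3,5) c3_run(4)[of 0] c3_run(4)[of 1] r by simp_all
      let ?a' = "?a(i := out X i)"
      have a': "?a' = (\<lambda>k. if k < Suc i then out X k else X k)" by (auto simp: less_Suc_eq)
      have 1: "exec (Put 0 (R 1) (R 2)) (mem ?a X r') (Suc (rcost (R 1) (mem ?a X r') + rcost (R 2) (mem ?a X r'))) (mem ?a' X r')"
        using exec.Put[of 0 "R 1" "R 2" "mem ?a X r'"] r' by (simp add: rval_R)
      have "exec emit s' (T + (Suc (rcost (R 1) (mem ?a X r') + rcost (R 2) (mem ?a X r')) + icost (r' 1))) (mem ?a' X (r'(1 := r' 1 + 1)))"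
        unfolding emit_def using r'(1) 1 incr by (intro exec.Seq)
      moreover have "Inv2 (Suc i) (mem ?a' X (r'(1 := r' 1 + 1)))"
        unfolding Inv2_def a' using r' by (intro exI[of _ "r'(1 := r' 1 + 1)"]) simp
      moreover have "T + (Suc (rcost (R 1) (mem ?a X r') + rcost (R 2) (mem ?a X r')) + icost (r' 1)) \<le> D + (D + 4 * m + 20)"
        using rcost_R[of 1 ?a X r', unfolded r'(4)] rcost_R[of 2 ?a X r', unfolded r'(2)] incr_le[OF i] i r'(5,6)
        unfolding r'(4) by linarith
      ultimately show "\<exists>T s''. exec emit s' T s'' \<and> Inv2 (Suc i) s'' \<and> T \<le> D + (D + 4 * m + 20)" by blast
    qed
    then obtain T4 r4 where r4: "exec (While test emit) (mem X X (r3(1 := 0))) T4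
        (mem (\<lambda>k. if k < m then out X k else X k) X r4)" "T4 \<le> Suc m * ((D + (D + 4 * m + 20)) + (3 * m + 6) + 1)"
      unfolding Inv2_def by blast
    \<comment> \<open>From cell \<open>m\<close> on, both the old input and the encoded output are
      0.\<close>
    have ys_eq: "(\<lambda>k. if k < m then out X k else X k) = input_fun ys"
    proof
      fix k
      have "X k = 0" "input_fun ys k = 0" if "\<not> k < m"
        using that X0[of k] len(2,3) unfolding m_def n_def X_def by (auto simp: input_fun_def)
      then show "(if k < m then out X k else X k) = input_fun ys k" using out_eq by (simp add: X_def)
    qed
    have phase2: "exec (Seq c2 (Seq zero (While test emit))) (mem X X r2)
        (T3 + (Suc (log_cost 1 + log_cost 0) + T4)) (mem (input_fun ys) X r4)"
      using r3(2) zero r4(1)[unfolded ys_eq] by (intro exec.Seq)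

    have "input_memory ys a = mem (input_fun ys) X r4 a" if "a \<in> insert 0 (com_arrays c)" for a
      using ib[OF that] unfolding input_memory_eq mem_def ra_def by auto
    from exec_frame[OF ex _ this]
    obtain s' where s': "exec c (mem (input_fun ys) X r4) T s'" "s 0 = s' 0" by blast
    have "exec c' (input_memory xs) ((T1 + (Suc (log_cost 1 + log_cost 0) + T2)) + ((T3 + (Suc (log_cost 1 + log_cost 0) + T4)) + T)) s'"
      unfolding c'_def by (rule exec.Seq[OF phase1 exec.Seq[OF phase2 s'(1)]])
    moreover have "(T1 + (Suc (log_cost 1 + log_cost 0) + T2)) + ((T3 + (Suc (log_cost 1 + log_cost 0) + T4)) + T) \<le> t Y + T"
    proof -
      have "log_cost 1 + log_cost 0 \<le> 3" using log_cost_le[of 1] log_cost_le[of 0] by simp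
      moreover have "Suc n * ((Y + 4 * n + 20) + (3 * n + 6) + 1) \<le> Suc (L Y) * ((Y + 4 * L Y + 20) + (3 * L Y + 6) + 1)"
        using nL by (intro mult_mono) auto
      moreover have "Suc m * ((D + (D + 4 * m + 20)) + (3 * m + 6) + 1) \<le> Suc (L Y) * ((D + (D + 4 * L Y + 20)) + (3 * L Y + 6) + 1)"
        using mL by (intro mult_mono) auto
      moreover have "Y ^ e1 \<le> L Y" "Y ^ e2 \<le> L Y" by (auto simp: L_def)
      ultimately show ?thesis using r1(4) r2(2) r3(4) r4(2) unfolding t_def D_def by linarith
    qed
    ultimately show ?thesis using s'(2) by metis
  qed
  ultimately show ?thesis by (rule that)
qed

section \<open>Sizes and running times\<close>

lemma exec_time_pos: "exec c s T s' \<Longrightarrow> 0 < T"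
  by (induction rule: exec.induct) auto

lemma log_cost_pos: "0 < log_cost x"
  by (simp add: log_cost_def)

lemma length_le_input_size: "length xs \<le> input_size xs"
proof (induction xs)
  case (Cons x xs)
  then show ?case using log_cost_pos[of x] by (simp add: input_size_def)
qed (simp add: input_size_def)

lemma input_size_le: "(\<And>x. x \<in> set xs \<Longrightarrow> x \<le> B) \<Longrightarrow> input_size xs \<le> length xs * (B + 1)"
proof (induction xs)
  case (Cons x xs)
  then have "log_cost x \<le> B + 1" using log_cost_le[of x] by (meson add_le_mono1 le_trans list.set_intros(1))
  with Cons show ?case by (simp add: input_size_def)
qed (simp add: input_size_def)

text \<open>The summand 2 guarantees a parameter of at least 2, as the polynomial bounds
  require.\<close>

lemma admissible_enc_cnf: "admissible (input_size (enc_cnf F) + 2) (input_fun (enc_cnf F))"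
  unfolding admissible_def
proof (intro conjI allI)
  have "length F \<le> length (enc_cnf F)" unfolding enc_cnf_eq by (induction F) (auto simp: enc_clause_def)
  then show "input_fun (enc_cnf F) 0 \<le> input_size (enc_cnf F) + 2"
    using length_le_input_size[of "enc_cnf F"] by (simp add: input_fun_def enc_cnf_eq)
  fix i
  show "log_cost (input_fun (enc_cnf F) i) \<le> input_size (enc_cnf F) + 2"
  proof (cases "i < length (enc_cnf F)")
    case True
    then have "log_cost (enc_cnf F ! i) \<le> (\<Sum>x\<leftarrow>enc_cnf F. log_cost x)"
      by (intro member_le_sum_list) auto
    with True show ?thesis by (simp add: input_fun_def input_size_def)
  qed (use log_cost_le[of 0] in \<open>simp add: input_fun_def\<close>)
qed

context reduction
begin

text \<open>The length and every entry of the output are values of polynomial-time functions, hence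
  polynomially bounded.\<close>

lemma instance_size:
  obtains e where "\<And>Y I. 2 \<le> Y \<Longrightarrow> admissible Y I \<Longrightarrow> input_size (enc_ds (instance_of I)) \<le> Y ^ e"
proof -
  have "pcomp 0 1 0 (\<lambda>I _. word_count I)"
    unfolding word_count_def by (intro pcomp_add pcomp_mult pcomp_num_cells pcomp_const) auto
  then obtain d where d: "\<And>Y I. 2 \<le> Y \<Longrightarrow> admissible Y I \<Longrightarrow> word_count I \<le> Y ^ d"
    using pcomp_poly_bdd by (metis less_nat_zero_code)
  have word: "pcomp 0 1 1 (\<lambda>I \<rho>. word I (\<rho> 0))" by (intro pcomp_word pcomp_reg) auto
  obtain e where e: "\<And>Y I (\<rho> :: nat \<Rightarrow> nat). 2 \<le> Y \<Longrightarrow> admissible Y I \<Longrightarrow>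
      (\<And>j. j < 1 \<Longrightarrow> \<rho> j \<le> Y) \<Longrightarrow> word I (\<rho> 0) \<le> Y ^ e"
    using pcomp_poly_bdd[OF word] by blast
  have "poly_bdd (\<lambda>Y. Y ^ d * ((Y + Y ^ d) ^ e + 1))" by (intro poly_bdd_intros)
  then obtain g where g: "\<And>Y :: nat. 2 \<le> Y \<Longrightarrow> Y ^ d * ((Y + Y ^ d) ^ e + 1) \<le> Y ^ g" unfolding poly_bdd_def by blast
  have "input_size (enc_ds (instance_of I)) \<le> Y ^ g" if Y: "2 \<le> Y" "admissible Y I" for Y I
  proof -
    have "x \<le> (Y + Y ^ d) ^ e" if x: "x \<in> set (enc_ds (instance_of I))" for x
    proof -
      obtain k where k: "k < word_count I" "x = enc_ds (instance_of I) ! k"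
        using x unfolding in_set_conv_nth length_enc_instance by blast
      then have "x = word I k" by (simp add: word_eq input_fun_def length_enc_instance)
      moreover have "k \<le> Y + Y ^ d" using k(1) d[OF Y] by linarith
      moreover have "admissible (Y + Y ^ d) I" using Y(2) by (rule admissible_mono) simp
      ultimately show ?thesis using e[of "Y + Y ^ d" I "\<lambda>_. k"] Y(1) by simp
    qed
    then have "input_size (enc_ds (instance_of I)) \<le> word_count I * ((Y + Y ^ d) ^ e + 1)"
      unfolding length_enc_instance[symmetric] by (rule input_size_le)
    also have "\<dots> \<le> Y ^ d * ((Y + Y ^ d) ^ e + 1)" using d[OF Y] by (rule mult_right_mono) simp
    also have "\<dots> \<le> Y ^ g" using g Y(1) .
    finally show ?thesis .
  qed
  then show ?thesis by (rule that)
qed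

text \<open>\<open>f\<close> is kept apart from the powers of \<open>a\<close> because the base in
  question may be below 1; with \<open>a \<ge> 1\<close> the cutwidth may be replaced by its upper
  bound.\<close>

lemma reduction_solves_sat:
  fixes a r :: real
  assumes a: "1 \<le> a" and r: "1 \<le> r" "a ^ p \<le> r ^ b"
    and f: "\<And>k. 0 \<le> f k" "\<And>k. f k \<le> a ^ k"
    and solvable: "solvable_O_star planar_ds_instances enc_ds has_dominating_set ds_cutwidth f"
  shows "solvable_O_star (q_cnf q) enc_cnf satisfiable (\<lambda>F. card (cnf_vars F)) (\<lambda>n. r ^ n)"
proof -
  obtain c C0 d where c: "\<And>x. x \<in> planar_ds_instances \<Longrightarrow>
      decides_within c (enc_ds x) (has_dominating_set x) (C0 * f (ds_cutwidth x) * real (input_size (enc_ds x)) ^ d)"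
    using solvable unfolding solvable_O_star_def by blast
  define ilen where "ilen = (\<lambda>I :: nat \<Rightarrow> nat. start q I (I 0))"
  \<comment> \<open>Exceeds both the length of the output and that of the CNF to be erased.\<close>
  define olen where "olen = (\<lambda>I. word_count I + ilen I)"
  have ilen: "pcomp ia ra k (\<lambda>I _. ilen I)" if "ia \<noteq> ra" for ia ra k
    unfolding ilen_def by (intro pcomp_start pcomp_head that)
  have olen: "pcomp ia ra k (\<lambda>I _. olen I)" if "ia \<noteq> ra" for ia ra k
    unfolding olen_def word_count_def by (intro pcomp_add pcomp_mult pcomp_num_cells pcomp_const ilen that)
  have out: "pcomp ia ra 2 (\<lambda>I \<rho>. word I (\<rho> 1))" if "ia \<noteq> ra" for ia ra
    by (intro pcomp_word pcomp_reg that) simp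
  obtain c' t where t: "poly_bdd t" and c': "\<And>xs ys Y T s. 2 \<le> Y \<Longrightarrow> admissible Y (input_fun xs) \<Longrightarrow>
       length xs \<le> ilen (input_fun xs) \<Longrightarrow> ilen (input_fun xs) \<le> olen (input_fun xs) \<Longrightarrow>
       length ys \<le> olen (input_fun xs) \<Longrightarrow> (\<And>k. word (input_fun xs) k = input_fun ys k) \<Longrightarrow>
       exec c (input_memory ys) T s \<Longrightarrow>
       \<exists>T' s'. exec c' (input_memory xs) T' s' \<and> s' 0 0 = s 0 0 \<and> T' \<le> t Y + T"
    using reduction_program[OF ilen olen out] by metis
  obtain e1 where e1: "\<And>Y. 2 \<le> Y \<Longrightarrow> t Y \<le> Y ^ e1" using t unfolding poly_bdd_def by blast
  obtain e2 where e2: "\<And>Y I. 2 \<le> Y \<Longrightarrow> admissible Y I \<Longrightarrow> input_size (enc_ds (instance_of I)) \<le> Y ^ e2"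
    using instance_size by blast
  define e where "e = e1 + e2 * d"
  \<comment> \<open>The 1 pays for the reduction itself, the absolute value is taken since the sign
    of \<open>C0\<close> is unknown, and \<open>3 ^ e\<close> comes from replacing \<open>Y\<close>
    by three times the input size.\<close>
  define K where "K = (1 + \<bar>C0\<bar> * a ^ (p + 260)) * 3 ^ e"
  have "decides_within c' (enc_cnf F) (satisfiable F) (K * r ^ card (cnf_vars F) * real (input_size (enc_cnf F)) ^ e)"
    if F: "F \<in> q_cnf q" for F
  proof -
    interpret encoded_cnf F q by standard (use F q in auto)
    define n where "n = card (cnf_vars F)"
    define ys where "ys = enc_ds (instance_of I)"
    define Y where "Y = input_size (enc_cnf F) + 2"
    have Y: "2 \<le> Y" "admissible Y I" unfolding Y_def I_def using admissible_enc_cnf by auto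
    have len: "length (enc_cnf F) \<le> ilen I" unfolding ilen_def I_0 start_length ..
    define k where "k = ds_cutwidth (instance_of I)"
    obtain T s where T: "exec c (input_memory ys) T s" "s 0 0 \<noteq> 0 \<longleftrightarrow> has_dominating_set (instance_of I)"
        "real T \<le> C0 * f k * real (input_size ys) ^ d"
      using c[OF instance_in[of I]] unfolding decides_within_def ys_def k_def by blast
    obtain T' s' where T': "exec c' (input_memory (enc_cnf F)) T' s'" "s' 0 0 = s 0 0" "T' \<le> t Y + T"
      using c'[OF Y(1) Y(2)[unfolded I_def] len[unfolded I_def] _ _ _ T(1)]
      unfolding olen_def ys_def I_def by (auto simp: word_eq length_enc_instance)
    have Y3: "Y \<le> 3 * input_size (enc_cnf F)"
      using length_le_input_size[of "enc_cnf F"] unfolding Y_def enc_cnf_eq by simp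
    have k: "k \<le> (p + 260) + p * (n div b)"
      using cutwidth_instance[of I] unfolding k_def num_vars_eq n_def by simp
    have Y1: "1 \<le> real Y" using Y(1) by simp
    have "a ^ k \<le> a ^ ((p + 260) + p * (n div b))" using k a by (intro power_increasing)
    also have "\<dots> = a ^ (p + 260) * (a ^ p) ^ (n div b)" by (simp add: power_add power_mult)
    \<comment> \<open>Each full group of \<open>b\<close> variables costs \<open>p\<close> rows, a
      factor \<open>a ^ p \<le> r ^ b\<close>; the last group and the constant part of the cutwidth
      go into \<open>a ^ (p + 260)\<close>.\<close>
    also have "\<dots> \<le> a ^ (p + 260) * (r ^ b) ^ (n div b)" using r a by (intro mult_left_mono power_mono) auto
    also have "(r ^ b) ^ (n div b) = r ^ (b * (n div b))" by (simp add: power_mult)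
    also have "\<dots> \<le> r ^ n" using r by (intro power_increasing) auto
    finally have ak: "a ^ k \<le> a ^ (p + 260) * r ^ n" using a by (simp add: mult_left_mono)
    have "input_size ys \<le> Y ^ e2" unfolding ys_def using e2[OF Y] .
    then have "real (input_size ys) \<le> real Y ^ e2" by (metis of_nat_le_iff of_nat_power)
    then have "real (input_size ys) ^ d \<le> (real Y ^ e2) ^ d" by (intro power_mono) auto
    also have "\<dots> \<le> real Y ^ e" unfolding e_def power_mult[symmetric] using Y1 by (intro power_increasing) auto
    finally have S: "real (input_size ys) ^ d \<le> real Y ^ e" .
    have "C0 * f k \<le> \<bar>C0\<bar> * (a ^ (p + 260) * r ^ n)"
      using f[of k] ak by (intro mult_mono) auto
    from this S have "C0 * f k * real (input_size ys) ^ d \<le> \<bar>C0\<bar> * (a ^ (p + 260) * r ^ n) * real Y ^ e"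
      by (rule mult_mono) (use S a r in auto)
    then have T_le: "real T \<le> \<bar>C0\<bar> * a ^ (p + 260) * r ^ n * real Y ^ e"
      using T(3) by (simp add: mult.assoc)
    have "t Y \<le> Y ^ e1" by (rule e1) (rule Y(1))
    also have "\<dots> \<le> Y ^ e" using Y(1) by (intro power_increasing) (auto simp: e_def)
    finally have "real (t Y) \<le> real Y ^ e" by (metis of_nat_le_iff of_nat_power)
    also have "\<dots> \<le> r ^ n * real Y ^ e" using r(1) by (simp add: mult_le_cancel_right1)
    finally have t_le: "real (t Y) \<le> r ^ n * real Y ^ e" .
    have "real Y ^ e \<le> (3 * real (input_size (enc_cnf F))) ^ e" using Y3 by (intro power_mono) auto
    then have Ye: "real Y ^ e \<le> 3 ^ e * real (input_size (enc_cnf F)) ^ e" by (simp add: power_mult_distrib)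
    have "real T' \<le> real (t Y) + real T" using T'(3) by linarith
    also have "\<dots> \<le> (1 + \<bar>C0\<bar> * a ^ (p + 260)) * r ^ n * real Y ^ e"
      using T_le t_le by (simp add: algebra_simps)
    also have "\<dots> \<le> (1 + \<bar>C0\<bar> * a ^ (p + 260)) * r ^ n * (3 ^ e * real (input_size (enc_cnf F)) ^ e)"
      using Ye a r by (intro mult_left_mono) auto
    also have "\<dots> = K * r ^ n * real (input_size (enc_cnf F)) ^ e" unfolding K_def by simp
    finally have "real T' \<le> K * r ^ n * real (input_size (enc_cnf F)) ^ e" .
    moreover have "s' 0 0 \<noteq> 0 \<longleftrightarrow> satisfiable F"
      using T'(2) T(2) has_dominating_set_iff_satisfiable[OF F] unfolding I_def by simp
    ultimately show ?thesis unfolding decides_within_def n_def using T'(1) by blast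
  qed
  then show ?thesis unfolding solvable_O_star_def by blast
qed

end

section \<open>Choice of the parameters and conclusion\<close>

lemma K2_instance:
  "(0, {}, Suc, 0) \<in> planar_ds_instances" "ds_cutwidth (0, {}, Suc, 0) = 0"
  "(2, {{0, 1}}, Suc, 0) \<in> planar_ds_instances" "ds_cutwidth (2, {{0, 1}}, Suc, 0) = 1"
proof -
  show "(0, {}, Suc, 0) \<in> planar_ds_instances"
    by (simp add: planar_ds_instances_def simple_graph_def planar_def linear_layout_def)
  show "ds_cutwidth (0, {}, Suc, 0) = 0"
    by (simp add: cutwidth_def)
  have simple: "simple_graph {..<2::nat} {{0, 1}}" by (auto simp: simple_graph_def)
  have lt2: "{..<2::nat} = {0, 1}" by auto
  have "planar {..<2::nat} {{0, 1}}"
    by (rule planar_straight_line[OF simple, where x = int and y = "\<lambda>_. 0"]) (auto simp: lt2 inj_on_def)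
  moreover have "linear_layout {..<2} Suc"
    unfolding linear_layout_def by (intro bij_betw_imageI) (auto simp: image_Suc_lessThan)
  ultimately show "(2, {{0, 1}}, Suc, 0) \<in> planar_ds_instances"
    using simple by (simp add: planar_ds_instances_def)
  have "{e \<in> {{0::nat, 1}}. \<exists>u v. e = {u, v} \<and> Suc u \<le> 1 \<and> 1 < Suc v} = {{0, 1}}" by auto
  moreover have "{1..<2::nat} = {1}" by auto
  ultimately show "ds_cutwidth (2, {{0, 1}}, Suc, 0) = 1" by (simp add: cutwidth_def)
qed

text \<open>Running times are positive, so an instance of cutwidth 0 gives \<open>0 < C\<close> and
  one of cutwidth 1 gives \<open>0 < C * a\<close>. This rules out \<epsilon> \<ge> 3, where the
  powers could vanish or alternate in sign.\<close>

lemma solvable_base_pos: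
  assumes "solvable_O_star planar_ds_instances enc_ds has_dominating_set ds_cutwidth (\<lambda>k. a ^ k)"
  shows "0 < a"
proof -
  obtain c C d where c: "\<And>x. x \<in> planar_ds_instances \<Longrightarrow>
      decides_within c (enc_ds x) (has_dominating_set x) (C * a ^ ds_cutwidth x * real (input_size (enc_ds x)) ^ d)"
    using assms unfolding solvable_O_star_def by blast
  have pos: "0 < C * a ^ ds_cutwidth x" if x: "x \<in> planar_ds_instances" for x
  proof -
    obtain T s where "exec c (input_memory (enc_ds x)) T s"
        "real T \<le> C * a ^ ds_cutwidth x * real (input_size (enc_ds x)) ^ d"
      using c[OF x] unfolding decides_within_def by blast
    then have "0 < C * a ^ ds_cutwidth x * real (input_size (enc_ds x)) ^ d"
      using exec_time_pos by (metis of_nat_0_less_iff less_le_trans)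
    moreover have "0 \<le> real (input_size (enc_ds x)) ^ d" by simp
    ultimately show ?thesis unfolding zero_less_mult_iff[of "C * a ^ ds_cutwidth x"] by linarith
  qed
  have "0 < C" "0 < C * a" using pos[OF K2_instance(1)] pos[OF K2_instance(3)] K2_instance(2,4) by simp_all
  then show ?thesis by (simp add: zero_less_mult_iff)
qed

theorem theorem2:
  assumes SETH
  shows "\<not> (\<exists>\<epsilon>::real. \<epsilon> > 0 \<and>
    solvable_O_star planar_ds_instances enc_ds has_dominating_set ds_cutwidth
      (\<lambda>k. (3 - \<epsilon>) ^ k))"
proof
  assume "\<exists>\<epsilon>::real. \<epsilon> > 0 \<and>
    solvable_O_star planar_ds_instances enc_ds has_dominating_set ds_cutwidth (\<lambda>k. (3 - \<epsilon>) ^ k)"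
  then obtain \<epsilon> :: real where \<epsilon>: "0 < \<epsilon>"
    and sol: "solvable_O_star planar_ds_instances enc_ds has_dominating_set ds_cutwidth (\<lambda>k. (3 - \<epsilon>) ^ k)"
    by blast
  have pos: "0 < 3 - \<epsilon>" using sol by (rule solvable_base_pos)
  \<comment> \<open>The maximum keeps the powers monotone in the exponent when 3 - \<epsilon> is
    below 1.\<close>
  define a where "a = max 1 (3 - \<epsilon>)"
  have a: "1 \<le> a" "a < 3" "3 - \<epsilon> \<le> a" using \<epsilon> by (auto simp: a_def)
  \<comment> \<open>The gain \<open>(3 / a) ^ p\<close> has to beat the factor 2 lost in rounding
    \<open>3 ^ p\<close> down to a power of 2; it yields \<open>a ^ p < 2 ^ b\<close>.\<close>
  obtain p where "2 < (3 / a) ^ p" using real_arch_pow[of "3 / a" 2] a by auto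
  then have p: "2 * a ^ p < 3 ^ p" using a by (simp add: power_divide field_simps)
  have p0: "0 < p" using p by (cases p) auto
  obtain b where b: "2 ^ b \<le> (3::nat) ^ p" "(3::nat) ^ p < 2 ^ (b + 1)"
    using ex_power_ivl1[of 2 "3 ^ p"] by auto
  have b0: "0 < b"
  proof (rule ccontr)
    assume "\<not> 0 < b"
    then have "(3::nat) ^ p < 2" using b(2) by simp
    moreover have "(3::nat) ^ 1 \<le> 3 ^ p" using p0 by (intro power_increasing) auto
    ultimately show False by simp
  qed
  have "real (3 ^ p) < real (2 ^ (b + 1))" using b(2) by (rule of_nat_less_iff[THEN iffD2])
  then have ab: "a ^ p < 2 ^ b" using p by simp
  \<comment> \<open>The base per variable; it is below 2 as \<open>a ^ p < 2 ^ b\<close>, so SETH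
    applies with \<epsilon> = 2 - r.\<close>
  define r where "r = root b (a ^ p)"
  have "1 \<le> a ^ p" using a by simp
  then have r: "1 \<le> r" "r ^ b = a ^ p" "r < 2"
    using b0 ab real_root_less_iff[of b "a ^ p" "2 ^ b"] real_root_power_cancel[of b 2]
    unfolding r_def by (simp_all add: real_root_ge_1_iff)
  obtain q where unsolvable: "\<not> solvable_O_star (q_cnf q) enc_cnf satisfiable (\<lambda>F. card (cnf_vars F)) (\<lambda>n. (2 - (2 - r)) ^ n)"
    using assms r(3) unfolding SETH_def by (metis diff_gt_0_iff_gt)
  \<comment> \<open>The width supplied by SETH could be 0, whereas slots are counted in blocks of
    positive size.\<close>
  interpret reduction p b "Suc q" by standard (use p0 b0 b(1) in auto)
  have "(3 - \<epsilon>) ^ k \<le> a ^ k" for k using pos a(3) by (intro power_mono) auto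
  then have "solvable_O_star (q_cnf (Suc q)) enc_cnf satisfiable (\<lambda>F. card (cnf_vars F)) (\<lambda>n. r ^ n)"
    using a(1) r pos sol by (intro reduction_solves_sat[where a = a and f = "\<lambda>k. (3 - \<epsilon>) ^ k"]) auto
  moreover have "q_cnf q \<subseteq> q_cnf (Suc q)" by (auto simp: q_cnf_def le_Suc_eq)
  ultimately have "solvable_O_star (q_cnf q) enc_cnf satisfiable (\<lambda>F. card (cnf_vars F)) (\<lambda>n. r ^ n)"
    unfolding solvable_O_star_def by (meson subsetD)
  with unsolvable show False by simp
qed

end
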